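(* There is an $O(1)$-approximation algorithm in the Congested Clique model, in the explicit metric setting, for Robust Facility Location, running in $O(\log\log\log n)$ rounds with high probability.
   Context: Robust Facility Location: the input is a set $F$ of facilities with opening costs $f_i\ge 0$, a set $C$ of clients, a metric $d$ on $F\cup C$, and an integer $0\le p\le |C|$. A feasible solution is $(C',F')$ with $F'\subseteq F$, $C'\subseteq C$, $|C'|\ge p$; its cost is $\sum_{i\in F'}f_i+\sum_{j\in C'}d(j,F')$ with $d(j,F')=\min_{i\in F'}d(i,j)$. An $\alpha$-approximation algorithm outputs a feasible solution of cost at most $\alpha$ times the minimum cost. Assume $|F|=|C|=n$ and that every individual number in the input can be represented in $O(\log n)$ bits. Congested Clique model: the communication network is a clique with $|F|+|C|$ nodes, each node hosting one facility or client. In each synchronous round each node performs local computation and sends a (possibly distinct) $O(\log n)$-bit message to each other node. The node hosting facility $i$ initially knows $f_i$. Explicit metric setting: the node hosting a vertex $v\in F\cup C$ initially knows $d(u,v)$ for all $u\in F\cup C$. The algorithm is randomized; "with high probability" means with probability at least $1-1/\mathrm{poly}(n)$. *)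

theory Defs
  imports "HOL-Probability.Probability" "HOL-Library.Landau_Symbols"
begin

subsection \<open>Robust Facility Location\<close>

text \<open>
  The sets of facilities and clients may overlap as sets of points of the metric space;
  the communication nodes are nevertheless distinct, see below.
\<close>

record rfl_instance =
  facilities :: "nat set"
  clients :: "nat set"
  opening_cost :: "nat \<Rightarrow> real"
  distance :: "nat \<Rightarrow> nat \<Rightarrow> real"
  threshold :: nat

definition rfl_instance :: "rfl_instance \<Rightarrow> bool" where
  "rfl_instance I \<longleftrightarrow>
     finite (facilities I) \<and> finite (clients I) \<and>
     (\<forall>i\<in>facilities I. 0 \<le> opening_cost I i) \<and>
     Metric_space (facilities I \<union> clients I) (distance I) \<and>
     threshold I \<le> card (clients I)"

text \<open>
  Solutions are pairs of a set of served clients and a set of open facilities. The minimum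
  over the empty set is read as infinity, so clients can be served only if some
  facility is open.
\<close>

definition rfl_feasible :: "rfl_instance \<Rightarrow> nat set \<times> nat set \<Rightarrow> bool" where
  "rfl_feasible I = (\<lambda>(C', F').
     C' \<subseteq> clients I \<and> F' \<subseteq> facilities I \<and> threshold I \<le> card C' \<and>
     (C' \<noteq> {} \<longrightarrow> F' \<noteq> {}))"

definition rfl_cost :: "rfl_instance \<Rightarrow> nat set \<times> nat set \<Rightarrow> real" where
  "rfl_cost I = (\<lambda>(C', F').
     (\<Sum>i\<in>F'. opening_cost I i) + (\<Sum>j\<in>C'. Min ((\<lambda>i. distance I i j) ` F')))"

definition rfl_opt :: "rfl_instance \<Rightarrow> real" where
  "rfl_opt I = Min (rfl_cost I ` {S. rfl_feasible I S})"

definition rfl_approx_solution :: "real \<Rightarrow> rfl_instance \<Rightarrow> nat set \<times> nat set \<Rightarrow> bool" where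
  "rfl_approx_solution \<alpha> I S \<longleftrightarrow> rfl_feasible I S \<and> rfl_cost I S \<le> \<alpha> * rfl_opt I"

text \<open>
  Input numbers are nonnegative rationals whose numerator and denominator are both
  given by \<open>k\<close> bits (integers being the case of denominator 1).
\<close>

definition representable :: "nat \<Rightarrow> real \<Rightarrow> bool" where
  "representable k x \<longleftrightarrow>
     (\<exists>a b :: nat. a < 2 ^ k \<and> 0 < b \<and> b < 2 ^ k \<and> x = real a / real b)"

definition rfl_representable :: "nat \<Rightarrow> rfl_instance \<Rightarrow> bool" where
  "rfl_representable k I \<longleftrightarrow>
     (\<forall>i\<in>facilities I. representable k (opening_cost I i)) \<and>
     (\<forall>u\<in>facilities I \<union> clients I. \<forall>v\<in>facilities I \<union> clients I.
        representable k (distance I u v))"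


subsection \<open>The Congested Clique\<close>

text \<open>\<open>Inl i\<close> is the node hosting facility \<open>i\<close>, and \<open>Inr j\<close> the node hosting client \<open>j\<close>.\<close>

type_synonym node = "nat + nat"

definition nodes :: "rfl_instance \<Rightarrow> node set" where
  "nodes I = facilities I <+> clients I"

text \<open>
  The initial knowledge of a node in the explicit metric setting: the participants and the
  parameter \<open>p\<close>, its own identity, its opening cost if it hosts a facility, and the
  distances from the hosted vertex to all vertices.
\<close>

record knowledge =
  known_facilities :: "nat set"
  known_clients :: "nat set"
  known_threshold :: nat
  self :: node
  own_cost :: "real option"
  dist_row :: "nat \<Rightarrow> real"

definition initial_knowledge :: "rfl_instance \<Rightarrow> node \<Rightarrow> knowledge" where
  "initial_knowledge I v =
     \<lparr>known_facilities = facilities I,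
      known_clients = clients I,
      known_threshold = threshold I,
      self = v,
      own_cost = (case v of Inl i \<Rightarrow> Some (opening_cost I i) | Inr j \<Rightarrow> None),
      dist_row = restrict (\<lambda>u. distance I u (case v of Inl i \<Rightarrow> i | Inr j \<Rightarrow> j))
                   (facilities I \<union> clients I)\<rparr>"

type_synonym message = "bool list"

text \<open>An inbox maps each sender to the message received from it in one round.\<close>

type_synonym inbox = "node \<Rightarrow> message"

text \<open>
  In every round a node either stops for good, announcing whether the vertex it hosts
  belongs to the solution (is opened, respectively served), or sends messages. Local
  computation is unrestricted, so without loss of generality the local state consists of the
  initial knowledge, the private tape of random bits and all inboxes so far (oldest first).
\<close>

datatype action = Halt bool | Send "node \<Rightarrow> message"

type_synonym algorithm = "knowledge \<Rightarrow> (nat \<Rightarrow> bool) \<Rightarrow> inbox list \<Rightarrow> action"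

datatype state = Active "inbox list" | Halted bool

type_synonym coins = "node \<times> nat \<Rightarrow> bool"

definition coin_space :: "coins measure" where
  "coin_space = PiM UNIV (\<lambda>_. measure_pmf (bernoulli_pmf (1/2)))"

definition node_action ::
  "algorithm \<Rightarrow> rfl_instance \<Rightarrow> coins \<Rightarrow> node \<Rightarrow> inbox list \<Rightarrow> action" where
  "node_action A I \<omega> v h = A (initial_knowledge I v) (\<lambda>k. \<omega> (v, k)) h"

text \<open>The empty bit string stands for the absence of a message.\<close>

definition sent :: "algorithm \<Rightarrow> rfl_instance \<Rightarrow> coins \<Rightarrow> (node \<Rightarrow> state) \<Rightarrow> node \<Rightarrow> node \<Rightarrow> message" where
  "sent A I \<omega> S u v =
     (case S u of
        Halted _ \<Rightarrow> []
      | Active h \<Rightarrow> (case node_action A I \<omega> u h of Halt _ \<Rightarrow> [] | Send m \<Rightarrow> m v))"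

definition round_step ::
  "algorithm \<Rightarrow> rfl_instance \<Rightarrow> coins \<Rightarrow> (node \<Rightarrow> state) \<Rightarrow> node \<Rightarrow> state" where
  "round_step A I \<omega> S v =
     (case S v of
        Halted b \<Rightarrow> Halted b
      | Active h \<Rightarrow>
          (case node_action A I \<omega> v h of
             Halt b \<Rightarrow> Halted b
           | Send _ \<Rightarrow>
               Active (h @ [\<lambda>u. if u \<in> nodes I - {v} then sent A I \<omega> S u v else []])))"

primrec run :: "algorithm \<Rightarrow> rfl_instance \<Rightarrow> coins \<Rightarrow> nat \<Rightarrow> node \<Rightarrow> state" where
  "run A I \<omega> 0 = (\<lambda>_. Active [])"
| "run A I \<omega> (Suc t) = round_step A I \<omega> (run A I \<omega> t)"

definition halted_by :: "algorithm \<Rightarrow> rfl_instance \<Rightarrow> coins \<Rightarrow> nat \<Rightarrow> bool" where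
  "halted_by A I \<omega> t \<longleftrightarrow> (\<forall>v\<in>nodes I. \<exists>b. run A I \<omega> t v = Halted b)"

definition result :: "algorithm \<Rightarrow> rfl_instance \<Rightarrow> coins \<Rightarrow> nat \<Rightarrow> nat set \<times> nat set" where
  "result A I \<omega> t =
     ({j \<in> clients I. run A I \<omega> t (Inr j) = Halted True},
      {i \<in> facilities I. run A I \<omega> t (Inl i) = Halted True})"

definition bandwidth_le :: "algorithm \<Rightarrow> rfl_instance \<Rightarrow> nat \<Rightarrow> bool" where
  "bandwidth_le A I k \<longleftrightarrow>
     (\<forall>\<omega> t. \<forall>u\<in>nodes I. \<forall>v\<in>nodes I - {u}. length (sent A I \<omega> (run A I \<omega> t) u v) \<le> k)"

definition outputs_approx :: "algorithm \<Rightarrow> rfl_instance \<Rightarrow> real \<Rightarrow> bool" where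
  "outputs_approx A I \<alpha> \<longleftrightarrow>
     (AE \<omega> in coin_space. \<exists>t. halted_by A I \<omega> t \<and> rfl_approx_solution \<alpha> I (result A I \<omega> t))"

definition halting_probability :: "algorithm \<Rightarrow> rfl_instance \<Rightarrow> nat \<Rightarrow> real" where
  "halting_probability A I t = measure coin_space {\<omega> \<in> space coin_space. halted_by A I \<omega> t}"

end

theory Submission
  imports Defs "HOL-Real_Asymp.Real_Asymp"
begin

text \<open>
  The algorithm is deterministic. As in Mettu and Plaxton's algorithm, facility \<open>i\<close> has a radius
  \<open>r i\<close> at which the clients in a ball around it can jointly pay its opening cost, and the reach
  \<open>R j = min_i (2 r i + d i j)\<close> of a client lower-bounds what it costs on average. To handle the
  outliers, the opening cost of the most expensive open facility is guessed: the facility node \<open>i\<close>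
  evaluates the guess \<open>f i\<close>, and the best one is announced. Clients are then visited by
  increasing reach, each together with the clients paying for its target, until \<open>p\<close> clients have
  been taken. Only the last ball can overshoot, and it costs no more than the guess.

  The facilities are opened in phases. In a phase with parameter \<open>b\<close>, every unserved client \<open>u\<close>
  opens the cheapest facility within about \<open>R u\<close>, of cost \<open>c\<close> say, with probability
  \<open>min 1 (b R u / c)\<close>; all but an \<open>exp (- b / 2)\<close> fraction of the weighted clients get served.
  So \<open>b\<close> can be squared from phase to phase at geometrically decreasing cost. After about
  \<open>log log log n\<close> phases it reaches \<open>2 ln n\<close>, and the few clients left open their own facility.
  The service distance may grow by a constant factor per phase, which the decreasing weights
  absorb.

  The sampling is derandomized. There is a family of \<open>n^2\<close> subsets, known to all nodes, that is
  as good as a random subset against all target sets at once. A good member is found in two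
  steps of \<open>n\<close> candidates each: every client node collects one number from each facility to judge
  one block of \<open>n\<close> members, and then one member of a good block.
\<close>

section \<open>Deterministic protocols with abstract messages\<close>

text \<open>The obstacle is that a ball is known only to its facility node and is too large to
  announce. Hence every use of the balls is condensed into single numbers sent by facility nodes:
  membership bits when clients are selected, counts of missing samples when a sample is judged. The
  size \<open>n^2\<close> comes from the union bound over up to \<open>2^n\<close> target sets: at
  the largest parameter \<open>b = 2 ln n\<close> only a fraction of about \<open>1/n\<close> of the
  members may miss a target, and for the bound this fraction has to comprise about \<open>n\<close>
  members. Squaring \<open>b\<close> is affordable because a phase costs about \<open>b\<close>
  times the weight still unserved and shrinks that weight to a fraction of order
  \<open>exp (- b / 2)\<close>; for \<open>b \<ge> 16\<close> the budget at least halves from phase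
  to phase although \<open>b\<close> is squared. Whatever all nodes must agree on without talking,
  such as the family or the visiting order, is fixed by a \<open>SOME\<close> term over commonly
  known data; local computation is unrestricted. As no coins are used, the round bound holds with
  certainty.\<close>

primrec hist ::
  "(knowledge \<Rightarrow> (node \<Rightarrow> 'm) list \<Rightarrow> node \<Rightarrow> 'm) \<Rightarrow> rfl_instance \<Rightarrow> nat \<Rightarrow> node \<Rightarrow> (node \<Rightarrow> 'm) list"
where
  "hist \<mu> I 0 = (\<lambda>v. [])"
| "hist \<mu> I (Suc t) = (\<lambda>v. hist \<mu> I t v @
     [\<lambda>u. if u \<in> nodes I then \<mu> (initial_knowledge I u) (hist \<mu> I t u) v else undefined])"

text \<open>Unlike in the model, a node here also receives its own messages.\<close>

definition common_after ::
  "rfl_instance set \<Rightarrow> 'm set \<Rightarrow> nat \<Rightarrow> (rfl_instance \<Rightarrow> 'c) \<Rightarrow> bool" where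
  "common_after V X t c \<longleftrightarrow>
     (\<exists>\<mu> G. \<forall>I\<in>V.
        (\<forall>s<t. \<forall>u\<in>nodes I. \<forall>v\<in>nodes I. \<mu> (initial_knowledge I u) (hist \<mu> I s u) v \<in> X) \<and>
        (\<forall>v\<in>nodes I. G (initial_knowledge I v) (hist \<mu> I t v) = c I))"

lemma length_hist [simp]: "length (hist \<mu> I t v) = t"
  by (induction t) auto

text \<open>Changing a protocol on histories of length at least \<open>t\<close> leaves its first
  \<open>t\<close> rounds intact. This is how further rounds are appended below.\<close>

lemma hist_cong:
  assumes "\<And>k h v. length h < t \<Longrightarrow> \<mu> k h v = \<mu>' k h v"
  shows "s \<le> t \<Longrightarrow> hist \<mu> I s = hist \<mu>' I s"
proof (induction s)
  case (Suc s)
  hence "hist \<mu> I s = hist \<mu>' I s" by simp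
  moreover have "\<mu> k (hist \<mu>' I s u) v = \<mu>' k (hist \<mu>' I s u) v" for k u v
    by (rule assms) (use Suc.prems in simp)
  ultimately show ?case by (simp add: fun_eq_iff)
qed simp

lemma common_after_const: "common_after V X 0 (\<lambda>I. c)"
  unfolding common_after_def by (intro exI[of _ "\<lambda>_ _ _. undefined"] exI[of _ "\<lambda>_ _. c"]) simp

lemma common_after_map:
  assumes "common_after V X t c" and "\<And>I. I \<in> V \<Longrightarrow> c' I = f (c I)"
  shows "common_after V X t c'"
proof -
  from assms(1) obtain \<mu> G where *: "\<forall>I\<in>V.
        (\<forall>s<t. \<forall>u\<in>nodes I. \<forall>v\<in>nodes I. \<mu> (initial_knowledge I u) (hist \<mu> I s u) v \<in> X) \<and>
        (\<forall>v\<in>nodes I. G (initial_knowledge I v) (hist \<mu> I t v) = c I)"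
    unfolding common_after_def by blast
  show ?thesis
    unfolding common_after_def
    by (rule exI[of _ \<mu>], rule exI[of _ "\<lambda>k h. f (G k h)"]) (use * assms(2) in simp)
qed

text \<open>The message \<open>m\<close> does not depend on the receiver, so all nodes get the same
  inbox, and any function of it and of the old common value is common again. The length of the
  history tells a node which round it is in.\<close>

lemma common_after_broadcast:
  assumes c: "common_after V X t c"
    and valid: "\<And>I u. I \<in> V \<Longrightarrow> u \<in> nodes I \<Longrightarrow> m (initial_knowledge I u) (c I) \<in> X"
    and c': "\<And>I. I \<in> V \<Longrightarrow>
      c' I = f (c I) (\<lambda>u. if u \<in> nodes I then m (initial_knowledge I u) (c I) else undefined)"
  shows "common_after V X (Suc t) c'"
proof -
  from c obtain \<mu> G where *: "\<And>I. I \<in> V \<Longrightarrow>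
        (\<forall>s<t. \<forall>u\<in>nodes I. \<forall>v\<in>nodes I. \<mu> (initial_knowledge I u) (hist \<mu> I s u) v \<in> X) \<and>
        (\<forall>v\<in>nodes I. G (initial_knowledge I v) (hist \<mu> I t v) = c I)"
    unfolding common_after_def by blast
  define \<mu>' where "\<mu>' k h v = (if length h < t then \<mu> k h v else m k (G k h))" for k h v
  define G' where "G' k h = f (G k (butlast h)) (last h)" for k h
  have eq: "hist \<mu>' I s = hist \<mu> I s" if "s \<le> t" for I s
    by (rule hist_cong[OF _ that]) (simp add: \<mu>'_def)
  show ?thesis
    unfolding common_after_def
  proof (rule exI[of _ \<mu>'], rule exI[of _ G'], intro ballI conjI allI impI)
    fix I s u v assume I: "I \<in> V" and s: "s < Suc t" and u: "u \<in> nodes I" and v: "v \<in> nodes I"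
    show "\<mu>' (initial_knowledge I u) (hist \<mu>' I s u) v \<in> X"
    proof (cases "s < t")
      case True
      thus ?thesis using *[OF I] u v by (simp add: eq \<mu>'_def)
    next
      case False
      hence "s = t" using s by simp
      thus ?thesis using *[OF I] u valid[OF I u] by (simp add: eq \<mu>'_def)
    qed
  next
    fix I v assume I: "I \<in> V" and v: "v \<in> nodes I"
    have "\<mu>' (initial_knowledge I u) (hist \<mu>' I t u) v = m (initial_knowledge I u) (c I)"
      if "u \<in> nodes I" for u
      using *[OF I] that by (simp add: eq \<mu>'_def)
    thus "G' (initial_knowledge I v) (hist \<mu>' I (Suc t) v) = c' I"
      using *[OF I] v by (simp add: G'_def c'[OF I] eq cong: if_cong)
  qed
qed

text \<open>Information held pairwise becomes common in condensed form: in one round node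
  \<open>v\<close> collects a personal message from every node, in the next it broadcasts a digest
  \<open>m'\<close> of what it received.\<close>

lemma common_after_gather:
  assumes c: "common_after V X t c"
    and valid1: "\<And>I u v. I \<in> V \<Longrightarrow> u \<in> nodes I \<Longrightarrow> v \<in> nodes I \<Longrightarrow> m (initial_knowledge I u) (c I) v \<in> X"
    and valid2: "\<And>I v. I \<in> V \<Longrightarrow> v \<in> nodes I \<Longrightarrow> m' (initial_knowledge I v) (c I)
       (\<lambda>u. if u \<in> nodes I then m (initial_knowledge I u) (c I) v else undefined) \<in> X"
    and c': "\<And>I. I \<in> V \<Longrightarrow>
      c' I = f (c I) (\<lambda>v. if v \<in> nodes I then m' (initial_knowledge I v) (c I)
       (\<lambda>u. if u \<in> nodes I then m (initial_knowledge I u) (c I) v else undefined) else undefined)"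
  shows "common_after V X (Suc (Suc t)) c'"
proof -
  from c obtain \<mu> G where *: "\<And>I. I \<in> V \<Longrightarrow>
        (\<forall>s<t. \<forall>u\<in>nodes I. \<forall>v\<in>nodes I. \<mu> (initial_knowledge I u) (hist \<mu> I s u) v \<in> X) \<and>
        (\<forall>v\<in>nodes I. G (initial_knowledge I v) (hist \<mu> I t v) = c I)"
    unfolding common_after_def by blast
  define \<mu>' where "\<mu>' k h v = (if length h < t then \<mu> k h v
     else if length h = t then m k (G k h) v else m' k (G k (butlast h)) (last h))" for k h v
  define G' where "G' k h = f (G k (butlast (butlast h))) (last h)" for k h
  have eq: "hist \<mu>' I s = hist \<mu> I s" if "s \<le> t" for I s
    by (rule hist_cong[OF _ that]) (simp add: \<mu>'_def)
  have m: "\<mu>' (initial_knowledge I u) (hist \<mu> I t u) v = m (initial_knowledge I u) (c I) v"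
    if "I \<in> V" "u \<in> nodes I" for I u v
    using *[OF that(1)] that by (simp add: \<mu>'_def)
  have m': "\<mu>' (initial_knowledge I v) (hist \<mu>' I (Suc t) v) w = m' (initial_knowledge I v) (c I)
       (\<lambda>u. if u \<in> nodes I then m (initial_knowledge I u) (c I) v else undefined)"
    if "I \<in> V" "v \<in> nodes I" for I v w
  proof -
    have "hist \<mu>' I (Suc t) v = hist \<mu> I t v @ [\<lambda>u. if u \<in> nodes I then m (initial_knowledge I u) (c I) v else undefined]"
      using m[OF that(1)] by (simp add: eq cong: if_cong)
    thus ?thesis using *[OF that(1)] that(2) by (simp add: \<mu>'_def)
  qed
  show ?thesis
    unfolding common_after_def
  proof (rule exI[of _ \<mu>'], rule exI[of _ G'], intro ballI conjI allI impI)
    fix I s u v assume I: "I \<in> V" and s: "s < Suc (Suc t)" and u: "u \<in> nodes I" and v: "v \<in> nodes I"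
    consider "s < t" | "s = t" | "s = Suc t" using s by linarith
    thus "\<mu>' (initial_knowledge I u) (hist \<mu>' I s u) v \<in> X"
    proof cases
      case 1
      thus ?thesis using *[OF I] u v by (simp add: eq \<mu>'_def)
    next
      case 2
      thus ?thesis using m[OF I u] valid1[OF I u v] by (simp add: eq)
    next
      case 3
      thus ?thesis using m'[OF I u] valid2[OF I u] by simp
    qed
  next
    fix I v assume I: "I \<in> V" and v: "v \<in> nodes I"
    have "hist \<mu>' I (Suc (Suc t)) v = hist \<mu>' I (Suc t) v @ [\<lambda>v. if v \<in> nodes I then m' (initial_knowledge I v) (c I)
       (\<lambda>u. if u \<in> nodes I then m (initial_knowledge I u) (c I) v else undefined) else undefined]"
      using m'[OF I] by (simp only: hist.simps(2)[of _ _ "Suc t"] cong: if_cong)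
    moreover have "G (initial_knowledge I v) (butlast (hist \<mu>' I (Suc t) v)) = c I"
      using *[OF I] v by (simp add: eq)
    ultimately show "G' (initial_knowledge I v) (hist \<mu>' I (Suc (Suc t)) v) = c' I"
      by (simp add: G'_def c'[OF I] del: hist.simps)
  qed
qed

lemma self_initial_knowledge [simp]: "self (initial_knowledge I v) = v"
  and known_facilities_initial_knowledge [simp]: "known_facilities (initial_knowledge I v) = facilities I"
  and known_clients_initial_knowledge [simp]: "known_clients (initial_knowledge I v) = clients I"
  and known_threshold_initial_knowledge [simp]: "known_threshold (initial_knowledge I v) = threshold I"
  by (simp_all add: initial_knowledge_def)

text \<open>An inbox of the model lacks the node's own message and carries bit strings. Replaying
  \<open>\<mu>\<close> on the prefix rebuilt so far supplies the former, \<open>dec\<close> decodes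
  the latter.\<close>

definition local_hist ::
  "(knowledge \<Rightarrow> (node \<Rightarrow> 'm) list \<Rightarrow> node \<Rightarrow> 'm) \<Rightarrow> (message \<Rightarrow> 'm) \<Rightarrow> knowledge \<Rightarrow> inbox list \<Rightarrow> (node \<Rightarrow> 'm) list" where
  "local_hist \<mu> dec k h = foldl (\<lambda>g b. g @ [\<lambda>u.
     if u \<in> known_facilities k <+> known_clients k
     then (if u = self k then \<mu> k g u else dec (b u)) else undefined]) [] h"

text \<open>The message set \<open>X\<close> embeds into the bit strings of length \<open>M\<close>,
  so the abstract protocol can be simulated round by round. The additional round is the one in which
  all nodes halt.\<close>

lemma common_after_algorithm:
  fixes X :: "'m set"
  assumes "common_after V X t c" and "finite X" and "card X \<le> 2 ^ M"
  obtains A :: algorithm where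
    "\<And>I. bandwidth_le A I M"
    "\<And>I \<omega> v. I \<in> V \<Longrightarrow> v \<in> nodes I \<Longrightarrow> run A I \<omega> (Suc t) v = Halted (out (initial_knowledge I v) (c I))"
proof -
  from assms(1) obtain \<mu> G where *: "\<And>I. I \<in> V \<Longrightarrow>
        (\<forall>s<t. \<forall>u\<in>nodes I. \<forall>v\<in>nodes I. \<mu> (initial_knowledge I u) (hist \<mu> I s u) v \<in> X) \<and>
        (\<forall>v\<in>nodes I. G (initial_knowledge I v) (hist \<mu> I t v) = c I)"
    unfolding common_after_def by blast
  have "card {xs::bool list. set xs \<subseteq> UNIV \<and> length xs = M} = 2 ^ M"
    by (subst card_lists_length_eq) simp_all
  moreover have "finite {xs::bool list. set xs \<subseteq> UNIV \<and> length xs = M}"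
    by (rule finite_lists_length_eq) simp
  ultimately obtain enc :: "'m \<Rightarrow> message" where
    enc: "inj_on enc X" "enc ` X \<subseteq> {xs. set xs \<subseteq> UNIV \<and> length xs = M}"
    using inj_on_iff_card_le[of X "{xs::bool list. set xs \<subseteq> UNIV \<and> length xs = M}"] assms(2,3)
    by auto
  define dec where "dec = inv_into X enc"
  have dec: "dec (enc x) = x" if "x \<in> X" for x
    using enc(1) that by (simp add: dec_def inv_into_f_f)
  \<comment> \<open>The bandwidth bound is claimed for all instances, also outside \<open>V\<close>,
    where \<open>\<mu>\<close> may leave \<open>X\<close>; in that case nothing is sent.\<close>
  define A :: algorithm where "A k w h =
    (if length h < t
     then Send (\<lambda>v. let x = \<mu> k (local_hist \<mu> dec k h) v in if x \<in> X then enc x else [])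
     else Halt (out k (G k (local_hist \<mu> dec k h))))" for k w h
  have "bandwidth_le A I M" for I
    using enc(2)
    unfolding bandwidth_le_def sent_def node_action_def A_def
    by (auto split: state.splits action.splits simp: Let_def image_subset_iff)
  moreover have active: "\<forall>v\<in>nodes I. \<exists>h. run A I \<omega> s v = Active h \<and> length h = s \<and>
       local_hist \<mu> dec (initial_knowledge I v) h = hist \<mu> I s v"
    if I: "I \<in> V" and "s \<le> t" for I \<omega> s
    using that(2)
  proof (induction s)
    case 0
    show ?case by (simp add: local_hist_def)
  next
    case (Suc s)
    hence IH: "\<forall>v\<in>nodes I. \<exists>h. run A I \<omega> s v = Active h \<and> length h = s \<and>
       local_hist \<mu> dec (initial_knowledge I v) h = hist \<mu> I s v" and s: "s < t"
      by auto
    have sent: "dec (sent A I \<omega> (run A I \<omega> s) u v) = \<mu> (initial_knowledge I u) (hist \<mu> I s u) v"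
      if "u \<in> nodes I" "v \<in> nodes I" for u v
    proof -
      from IH that(1) obtain h where h: "run A I \<omega> s u = Active h" "length h = s"
        "local_hist \<mu> dec (initial_knowledge I u) h = hist \<mu> I s u" by blast
      have "\<mu> (initial_knowledge I u) (hist \<mu> I s u) v \<in> X" using *[OF I] s that by blast
      thus ?thesis using h s by (simp add: sent_def node_action_def A_def dec)
    qed
    show ?case
    proof
      fix v assume v: "v \<in> nodes I"
      from IH v obtain h where h: "run A I \<omega> s v = Active h" "length h = s"
        "local_hist \<mu> dec (initial_knowledge I v) h = hist \<mu> I s v" by blast
      define b where "b u = (if u \<in> nodes I - {v} then sent A I \<omega> (run A I \<omega> s) u v else [])" for u
      have "run A I \<omega> (Suc s) v = Active (h @ [b])"
        using h s by (simp add: round_step_def node_action_def A_def b_def fun_eq_iff)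
      moreover have "(if u \<in> nodes I then (if u = v then \<mu> (initial_knowledge I v) (hist \<mu> I s v) u else dec (b u)) else undefined)
        = (if u \<in> nodes I then \<mu> (initial_knowledge I u) (hist \<mu> I s u) v else undefined)" for u
        using sent[OF _ v, of u] by (auto simp: b_def)
      hence "local_hist \<mu> dec (initial_knowledge I v) (h @ [b]) = hist \<mu> I (Suc s) v"
        using h(3) unfolding local_hist_def by (simp flip: nodes_def cong: if_cong)
      ultimately show "\<exists>h. run A I \<omega> (Suc s) v = Active h \<and> length h = Suc s \<and>
         local_hist \<mu> dec (initial_knowledge I v) h = hist \<mu> I (Suc s) v"
        using h(2) by auto
    qed
  qed
  moreover have "run A I \<omega> (Suc t) v = Halted (out (initial_knowledge I v) (c I))"
    if I: "I \<in> V" and v: "v \<in> nodes I" for I \<omega> v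
  proof -
    from active[OF I, of t \<omega>] v obtain h where "run A I \<omega> t v = Active h" "length h = t"
       "local_hist \<mu> dec (initial_knowledge I v) h = hist \<mu> I t v" by blast
    thus ?thesis using *[OF I] v by (simp add: round_step_def node_action_def A_def)
  qed
  ultimately show ?thesis using that by blast
qed

text \<open>Meant for an algorithm that dispatches on the participants: it behaves like the selected
  algorithm as soon as both agree on all knowledge occurring in the instance.\<close>

lemma run_cong:
  assumes "\<And>v. initial_knowledge I v \<in> K" and "\<And>k w h. k \<in> K \<Longrightarrow> A k w h = A' k w h"
  shows "run A I \<omega> t = run A' I \<omega> t" and "sent A I \<omega> S = sent A' I \<omega> S"
proof -
  have eq: "node_action A I \<omega> v h = node_action A' I \<omega> v h" for v h
    unfolding node_action_def using assms by blast
  show sent: "sent A I \<omega> S = sent A' I \<omega> S" for S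
    by (intro ext) (simp add: sent_def eq split: state.split)
  show "run A I \<omega> t = run A' I \<omega> t"
  proof (induction t)
    case (Suc t)
    show ?case by (intro ext) (simp add: Suc.IH round_step_def eq sent split: state.split action.split cong: if_cong)
  qed simp
qed

section \<open>Independent sampling as finite weighted sums, and its derandomization\<close>

text \<open>The summand is the probability that independent sampling yields exactly
  \<open>T\<close>. Avoiding \<open>S\<close> means \<open>T \<subseteq> P - S\<close>; the factors
  over \<open>S\<close> come out, and the rest is the expanded product of the
  \<open>q u + (1 - q u)\<close>.\<close>

lemma sum_Pow_bernoulli_disjoint:
  fixes q :: "'a \<Rightarrow> real"
  assumes "finite P" "S \<subseteq> P"
  shows "(\<Sum>T | T \<subseteq> P \<and> T \<inter> S = {}. (\<Prod>u\<in>T. q u) * (\<Prod>u\<in>P - T. 1 - q u)) = (\<Prod>u\<in>S. 1 - q u)"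
proof -
  have "(\<Sum>T | T \<subseteq> P \<and> T \<inter> S = {}. (\<Prod>u\<in>T. q u) * (\<Prod>u\<in>P - T. 1 - q u))
      = (\<Sum>T\<in>Pow (P - S). ((\<Prod>u\<in>T. q u) * (\<Prod>u\<in>P - S - T. 1 - q u)) * (\<Prod>u\<in>S. 1 - q u))"
  proof (rule sum.cong)
    fix T assume T: "T \<in> Pow (P - S)"
    have "P - T = (P - S - T) \<union> S" using T assms by auto
    hence "(\<Prod>u\<in>P - T. 1 - q u) = (\<Prod>u\<in>P - S - T. 1 - q u) * (\<Prod>u\<in>S. 1 - q u)"
      using assms by (simp only:) (rule prod.union_disjoint, auto intro: finite_subset)
    thus "(\<Prod>u\<in>T. q u) * (\<Prod>u\<in>P - T. 1 - q u) =
       ((\<Prod>u\<in>T. q u) * (\<Prod>u\<in>P - S - T. 1 - q u)) * (\<Prod>u\<in>S. 1 - q u)" by simp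
  qed auto
  also have "\<dots> = (\<Prod>u\<in>P - S. q u + (1 - q u)) * (\<Prod>u\<in>S. 1 - q u)"
    using assms by (subst prod_add) (simp_all add: sum_distrib_right)
  finally show ?thesis by simp
qed

lemma sum_Pow_bernoulli:
  fixes q :: "'a \<Rightarrow> real"
  assumes "finite P"
  shows "(\<Sum>T\<in>Pow P. (\<Prod>u\<in>T. q u) * (\<Prod>u\<in>P - T. 1 - q u)) = 1"
  using sum_Pow_bernoulli_disjoint[OF assms, of "{}" q] by (simp add: Pow_def)

text \<open>Linearity of expectation; the probability that \<open>u\<close> is sampled is
  complementary to missing \<open>{u}\<close>.\<close>

lemma sum_Pow_bernoulli_linear:
  fixes q c :: "'a \<Rightarrow> real"
  assumes "finite P"
  shows "(\<Sum>T\<in>Pow P. (\<Prod>u\<in>T. q u) * (\<Prod>u\<in>P - T. 1 - q u) * (\<Sum>u\<in>T. c u)) = (\<Sum>u\<in>P. q u * c u)"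
proof -
  let ?p = "\<lambda>T. (\<Prod>u\<in>T. q u) * (\<Prod>u\<in>P - T. 1 - q u)"
  have single: "(\<Sum>T\<in>Pow P. ?p T * (if u \<in> T then c u else 0)) = q u * c u" if u: "u \<in> P" for u
  proof -
    have "(\<Sum>T\<in>Pow P. ?p T * (if u \<in> T then 0 else 1)) = (\<Sum>T | T \<subseteq> P \<and> T \<inter> {u} = {}. ?p T)"
      using assms by (intro sum.mono_neutral_cong_right) auto
    also have "\<dots> = 1 - q u"
      using sum_Pow_bernoulli_disjoint[OF assms, of "{u}" q] u by simp
    finally have *: "(\<Sum>T\<in>Pow P. ?p T * (if u \<in> T then 0 else 1)) = 1 - q u" .
    have "(\<Sum>T\<in>Pow P. ?p T * (if u \<in> T then c u else 0))
        = c u * ((\<Sum>T\<in>Pow P. ?p T) - (\<Sum>T\<in>Pow P. ?p T * (if u \<in> T then 0 else 1)))"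
      unfolding sum_subtractf[symmetric] sum_distrib_left by (intro sum.cong) auto
    thus ?thesis using * sum_Pow_bernoulli[OF assms, of q] by simp
  qed
  have "(\<Sum>T\<in>Pow P. ?p T * (\<Sum>u\<in>T. c u)) = (\<Sum>T\<in>Pow P. \<Sum>u\<in>P. ?p T * (if u \<in> T then c u else 0))"
  proof (rule sum.cong)
    fix T assume "T \<in> Pow P"
    hence "(\<Sum>u\<in>T. c u) = (\<Sum>u\<in>P. if u \<in> T then c u else 0)"
      using assms by (intro sum.mono_neutral_cong_left) auto
    thus "?p T * (\<Sum>u\<in>T. c u) = (\<Sum>u\<in>P. ?p T * (if u \<in> T then c u else 0))"
      by (simp only: sum_distrib_left)
  qed simp
  also have "\<dots> = (\<Sum>u\<in>P. q u * c u)"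
    by (subst sum.swap) (intro sum.cong single refl)
  finally show ?thesis .
qed

text \<open>A family of subsets of \<open>P\<close> that does as well as independent sampling with probabilities
  \<open>q\<close>, up to constant factors, simultaneously against all target sets \<open>S\<close>. It exists because a
  random family fails with probability less than 1, by an exponential moment bound and a union
  bound over \<open>S\<close>.\<close>

lemma hitting_family:
  fixes q c :: "'a \<Rightarrow> real" and V b :: real
  assumes P: "finite P" and J: "finite J"
    and q: "\<And>u. u \<in> P \<Longrightarrow> 0 \<le> q u" "\<And>u. u \<in> P \<Longrightarrow> q u \<le> 1" and c: "\<And>u. u \<in> P \<Longrightarrow> 0 \<le> c u"
    and V: "(\<Sum>u\<in>P. q u * c u) \<le> V" "P \<noteq> {} \<Longrightarrow> 0 < V" and b: "3 \<le> b"
    and card: "real (card P) \<le> exp (- b / 2) * real (card J)"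
  obtains H where "\<And>x. x \<in> J \<Longrightarrow> H x \<subseteq> P"
    and "(\<Sum>x\<in>J. \<Sum>u\<in>H x. c u) \<le> 2 * real (card J) * V"
    and "\<And>S. S \<subseteq> P \<Longrightarrow> (\<Prod>u\<in>S. 1 - q u) \<le> exp (- b) \<Longrightarrow>
           real (card {x\<in>J. H x \<inter> S = {}}) \<le> 2 * exp (- b / 2) * real (card J)"
proof (cases "P = {}")
  case True
  show ?thesis
    by (rule that[of "\<lambda>_. {}"]) (use True V b in auto)
next
  case False
  let ?N = "real (card J)"
  define m where "m = exp (- b / 2) * ?N"
  define p where "p T = (\<Prod>u\<in>T. q u) * (\<Prod>u\<in>P - T. 1 - q u)" for T
  define w where "w h = (\<Prod>x\<in>J. p (h x))" for h
  define \<Omega> where "\<Omega> = J \<rightarrow>\<^sub>E Pow P"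
  define SS where "SS = {S. S \<subseteq> P \<and> (\<Prod>u\<in>S. 1 - q u) \<le> exp (- b)}"
  \<comment> \<open>Both summands are nonnegative and \<open>\<Psi> h < 1\<close> forces each
    exponential below 1, that is, fewer than \<open>2 * m\<close> misses of every \<open>S\<close>.
    It therefore suffices that the mean of \<open>\<Psi>\<close> is below 1: the cost contributes at
    most 1/2 and the sum over \<open>SS\<close> less than 1/2.\<close>
  define \<Psi> where "\<Psi> h = (\<Sum>x\<in>J. \<Sum>u\<in>h x. c u) / (2 * ?N * V)
     + (\<Sum>S\<in>SS. exp (b / 2 * (real (card {x\<in>J. h x \<inter> S = {}}) - 2 * m)))" for h
  have card1: "1 \<le> card P" using False P by (simp add: Suc_le_eq card_gt_0_iff)
  have m1: "real (card P) \<le> m" using card by (simp add: m_def)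
  have N: "0 < ?N" using m1 card1 unfolding m_def by (cases "card J = 0") auto
  have V0: "0 < V" using V False by simp
  have p_nonneg: "0 \<le> p T" if "T \<subseteq> P" for T
    using that q unfolding p_def by (intro mult_nonneg_nonneg prod_nonneg) (auto simp: subset_iff)
  have w_nonneg: "0 \<le> w h" if "h \<in> \<Omega>" for h
    using that p_nonneg unfolding w_def \<Omega>_def by (intro prod_nonneg) (auto simp: PiE_iff)
  have p1: "(\<Sum>T\<in>Pow P. p T) = 1"
    unfolding p_def by (rule sum_Pow_bernoulli[OF P])
  have fin: "finite \<Omega>" unfolding \<Omega>_def using P J by (intro finite_PiE) auto
  have finSS: "finite SS" unfolding SS_def using P by simp
  have prod_expect: "(\<Sum>h\<in>\<Omega>. w h * (\<Prod>x\<in>J. g x (h x))) = (\<Prod>x\<in>J. \<Sum>T\<in>Pow P. p T * g x T)" for g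
    unfolding \<Omega>_def w_def prod.distrib[symmetric] using P J by (subst prod_sum_PiE) auto
  have w1: "(\<Sum>h\<in>\<Omega>. w h) = 1" using prod_expect[of "\<lambda>_ _. 1"] p1 by simp
  have cost: "(\<Sum>h\<in>\<Omega>. w h * (\<Sum>x\<in>J. \<Sum>u\<in>h x. c u)) = ?N * (\<Sum>u\<in>P. q u * c u)"
  proof -
    have "(\<Sum>h\<in>\<Omega>. w h * (\<Sum>u\<in>h x. c u)) = (\<Sum>u\<in>P. q u * c u)" if x: "x \<in> J" for x
    proof -
      have "(\<Sum>h\<in>\<Omega>. w h * (\<Sum>u\<in>h x. c u))
          = (\<Sum>h\<in>\<Omega>. w h * (\<Prod>y\<in>J. if y = x then (\<Sum>u\<in>h y. c u) else 1))"
        using J x by (simp add: prod.delta)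
      also have "\<dots> = (\<Prod>y\<in>J. if y = x then (\<Sum>T\<in>Pow P. p T * (\<Sum>u\<in>T. c u)) else 1)"
        by (subst prod_expect) (auto intro!: prod.cong simp: p1)
      also have "\<dots> = (\<Sum>u\<in>P. q u * c u)"
        using J x sum_Pow_bernoulli_linear[OF P, of q c] by (simp add: p_def)
      finally show ?thesis .
    qed
    hence "(\<Sum>x\<in>J. \<Sum>h\<in>\<Omega>. w h * (\<Sum>u\<in>h x. c u)) = (\<Sum>x\<in>J. \<Sum>u\<in>P. q u * c u)"
      by (intro sum.cong) auto
    thus ?thesis by (subst (asm) sum.swap) (simp add: sum_distrib_left)
  qed
  \<comment> \<open>A member misses \<open>S\<close> with probability at most
    \<open>exp (- b)\<close>. At rate \<open>b / 2\<close> each of the independent factors thus has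
    mean at most \<open>1 + exp (- b / 2)\<close>, all together at most \<open>exp m\<close>. The
    subtracted \<open>2 * m\<close> turns this into \<open>exp ((1 - b) * m)\<close>, which is where
    \<open>3 \<le> b\<close> enters.\<close>
  have moment: "(\<Sum>h\<in>\<Omega>. w h * exp (b / 2 * (real (card {x\<in>J. h x \<inter> S = {}}) - 2 * m))) \<le> exp (- 2 * m)"
    if S: "S \<in> SS" for S
  proof -
    let ?\<mu> = "\<Prod>u\<in>S. 1 - q u"
    have \<mu>0: "0 \<le> ?\<mu>" using S q unfolding SS_def by (intro prod_nonneg) auto
    have count: "exp (b / 2 * real (card {x\<in>J. h x \<inter> S = {}}))
        = (\<Prod>x\<in>J. if h x \<inter> S = {} then exp (b / 2) else 1)" for h
      using J by (simp add: prod.If_cases exp_of_nat_mult[symmetric] mult.commute Int_def)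
    have one: "(\<Sum>T\<in>Pow P. p T * (if T \<inter> S = {} then exp (b / 2) else 1)) = 1 + (exp (b / 2) - 1) * ?\<mu>"
    proof -
      have "(\<Sum>T\<in>Pow P. p T * (if T \<inter> S = {} then exp (b / 2) else 1))
          = (\<Sum>T\<in>Pow P. p T) + (exp (b / 2) - 1) * (\<Sum>T\<in>Pow P. if T \<inter> S = {} then p T else 0)"
        unfolding sum_distrib_left sum.distrib[symmetric] by (intro sum.cong) (auto simp: algebra_simps)
      also have "(\<Sum>T\<in>Pow P. if T \<inter> S = {} then p T else 0) = (\<Sum>T | T \<subseteq> P \<and> T \<inter> S = {}. p T)"
        using P by (intro sum.mono_neutral_cong_right) auto
      also have "\<dots> = ?\<mu>"
        unfolding p_def using S P unfolding SS_def by (subst sum_Pow_bernoulli_disjoint) auto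
      finally show ?thesis using p1 by simp
    qed
    have "(\<Sum>h\<in>\<Omega>. w h * exp (b / 2 * real (card {x\<in>J. h x \<inter> S = {}})))
        = (1 + (exp (b / 2) - 1) * ?\<mu>) ^ card J"
      unfolding count by (subst prod_expect) (simp add: one)
    also have "\<dots> \<le> exp (exp (- b / 2)) ^ card J"
    proof (rule power_mono)
      have "(exp (b / 2) - 1) * ?\<mu> \<le> exp (b / 2) * exp (- b)"
        using S \<mu>0 b unfolding SS_def by (intro mult_mono) auto
      also have "\<dots> = exp (- b / 2)" by (simp flip: exp_add)
      finally show "1 + (exp (b / 2) - 1) * ?\<mu> \<le> exp (exp (- b / 2))"
        using exp_ge_add_one_self[of "exp (- b / 2)"] by linarith
      show "0 \<le> 1 + (exp (b / 2) - 1) * ?\<mu>" using \<mu>0 b by (intro add_nonneg_nonneg mult_nonneg_nonneg) auto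
    qed
    also have "\<dots> = exp m" by (simp add: m_def exp_of_nat_mult[symmetric] mult.commute)
    finally have "exp (- b * m) * (\<Sum>h\<in>\<Omega>. w h * exp (b / 2 * real (card {x\<in>J. h x \<inter> S = {}}))) \<le> exp (- b * m) * exp m"
      by simp
    also have "exp (- b * m) * exp m = exp ((1 - b) * m)" by (simp add: algebra_simps flip: exp_add)
    also have "\<dots> \<le> exp (- 2 * m)"
      using b m1 by (subst exp_le_cancel_iff, intro mult_right_mono) auto
    also have "exp (- b * m) * (\<Sum>h\<in>\<Omega>. w h * exp (b / 2 * real (card {x\<in>J. h x \<inter> S = {}})))
        = (\<Sum>h\<in>\<Omega>. w h * exp (b / 2 * (real (card {x\<in>J. h x \<inter> S = {}}) - 2 * m)))"
      unfolding sum_distrib_left by (intro sum.cong) (simp_all add: algebra_simps flip: exp_add)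
    finally show ?thesis .
  qed
  have "(\<Sum>h\<in>\<Omega>. w h * \<Psi> h) = (\<Sum>h\<in>\<Omega>. w h * (\<Sum>x\<in>J. \<Sum>u\<in>h x. c u)) / (2 * ?N * V)
     + (\<Sum>S\<in>SS. \<Sum>h\<in>\<Omega>. w h * exp (b / 2 * (real (card {x\<in>J. h x \<inter> S = {}}) - 2 * m)))"
    by (subst sum.swap) (simp add: \<Psi>_def distrib_left sum.distrib sum_divide_distrib sum_distrib_left)
  also have "\<dots> \<le> 1 / 2 + (\<Sum>S\<in>SS. exp (- 2 * m))"
  proof (intro add_mono sum_mono moment)
    show "(\<Sum>h\<in>\<Omega>. w h * (\<Sum>x\<in>J. \<Sum>u\<in>h x. c u)) / (2 * ?N * V) \<le> 1 / 2"
      using V V0 N unfolding cost by (simp add: field_simps)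
  qed
  \<comment> \<open>The union bound: at most \<open>2 ^ card P\<close> target sets against
    \<open>m \<ge> card P\<close>, leaving powers of \<open>2 * exp (- 2) < 1/2\<close>.\<close>
  also have "(\<Sum>S\<in>SS. exp (- 2 * m)) \<le> 2 ^ card P * exp (- 2 * real (card P))"
  proof -
    have "card SS \<le> card (Pow P)" unfolding SS_def using P by (intro card_mono) auto
    hence "real (card SS) \<le> 2 ^ card P" using P by (simp add: card_Pow flip: of_nat_le_iff)
    thus ?thesis using m1 by (simp add: mult_mono)
  qed
  also have "2 ^ card P * exp (- 2 * real (card P)) = (2 * exp (- 2)) ^ card P"
    by (simp add: power_mult_distrib exp_of_nat_mult[symmetric] mult.commute)
  also have "(2 * exp (- 2)) ^ card P \<le> (2 * exp (- 2 :: real)) ^ 1"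
    using card1 exp_ge_add_one_self[of 2] by (intro power_decreasing) (auto simp: exp_minus field_simps)
  also have "(2 * exp (- 2 :: real)) ^ 1 < 1 / 2"
  proof -
    have "5 \<le> exp (2::real)" using exp_lower_Taylor_quadratic[of "2::real"] by simp
    thus ?thesis by (simp add: exp_minus field_simps)
  qed
  finally have less: "(\<Sum>h\<in>\<Omega>. w h * \<Psi> h) < (\<Sum>h\<in>\<Omega>. w h)" using w1 by simp
  have "\<exists>h\<in>\<Omega>. \<Psi> h < 1"
  proof (rule ccontr)
    assume "\<not> ?thesis"
    hence "(\<Sum>h\<in>\<Omega>. w h) \<le> (\<Sum>h\<in>\<Omega>. w h * \<Psi> h)"
    proof (intro sum_mono)
      fix h assume "h \<in> \<Omega>"
      thus "w h \<le> w h * \<Psi> h"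
        using \<open>\<not> (\<exists>h\<in>\<Omega>. \<Psi> h < 1)\<close> w_nonneg[of h] mult_left_mono[of 1 "\<Psi> h" "w h"] by auto
    qed
    thus False using less by simp
  qed
  then obtain h where h: "h \<in> \<Omega>" "\<Psi> h < 1" by blast
  have hP: "h x \<subseteq> P" if "x \<in> J" for x using h(1) that by (auto simp: \<Omega>_def PiE_iff)
  show ?thesis
  proof (rule that[of h])
    show "h x \<subseteq> P" if "x \<in> J" for x using hP[OF that] .
    have "0 \<le> (\<Sum>S\<in>SS. exp (b / 2 * (real (card {x\<in>J. h x \<inter> S = {}}) - 2 * m)))"
      by (intro sum_nonneg) simp
    hence "(\<Sum>x\<in>J. \<Sum>u\<in>h x. c u) / (2 * ?N * V) < 1" using h(2) unfolding \<Psi>_def by linarith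
    thus "(\<Sum>x\<in>J. \<Sum>u\<in>h x. c u) \<le> 2 * ?N * V" using N V0 by (simp add: field_simps)
  next
    fix S assume "S \<subseteq> P" "(\<Prod>u\<in>S. 1 - q u) \<le> exp (- b)"
    hence S: "S \<in> SS" by (simp add: SS_def)
    have "0 \<le> (\<Sum>x\<in>J. \<Sum>u\<in>h x. c u)" using hP c by (intro sum_nonneg) auto
    hence "0 \<le> (\<Sum>x\<in>J. \<Sum>u\<in>h x. c u) / (2 * ?N * V)" using N V0 by (intro divide_nonneg_pos) auto
    hence "(\<Sum>S\<in>SS. exp (b / 2 * (real (card {x\<in>J. h x \<inter> S = {}}) - 2 * m))) < 1"
      using h(2) unfolding \<Psi>_def by linarith
    moreover have "exp (b / 2 * (real (card {x\<in>J. h x \<inter> S = {}}) - 2 * m))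
        \<le> (\<Sum>S\<in>SS. exp (b / 2 * (real (card {x\<in>J. h x \<inter> S = {}}) - 2 * m)))"
      using S finSS by (intro member_le_sum) auto
    ultimately have "exp (b / 2 * (real (card {x\<in>J. h x \<inter> S = {}}) - 2 * m)) < 1" by linarith
    hence "b / 2 * (real (card {x\<in>J. h x \<inter> S = {}}) - 2 * m) < 0" by simp
    hence "real (card {x\<in>J. h x \<inter> S = {}}) - 2 * m < 0" using b by (simp add: mult_less_0_iff)
    thus "real (card {x\<in>J. h x \<inter> S = {}}) \<le> 2 * exp (- b / 2) * ?N" by (simp add: m_def)
  qed
qed

section \<open>Radii and targets\<close>

text \<open>Weight 2 on the radius: for a client within \<open>r\<close> of a target, the triangle
  inequality uses up one \<open>r\<close>, and the other remains as a lower bound for its reach (see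
  \<open>ball_target\<close>).\<close>

definition reach :: "nat set \<Rightarrow> (nat \<Rightarrow> real) \<Rightarrow> (nat \<Rightarrow> real) \<Rightarrow> real" where
  "reach E r \<delta> = Min ((\<lambda>i. 2 * r i + \<delta> i) ` E)"

definition target :: "nat set \<Rightarrow> (nat \<Rightarrow> real) \<Rightarrow> (nat \<Rightarrow> real) \<Rightarrow> nat" where
  "target E r \<delta> = (SOME i. i \<in> E \<and> 2 * r i + \<delta> i = reach E r \<delta>)"

text \<open>The slack 3 admits every target whose ball contains the client: its radius and its
  distance are both at most the reach. So the chosen facility is no dearer than any such
  target.\<close>

definition cheapest :: "nat set \<Rightarrow> (nat \<Rightarrow> real) \<Rightarrow> (nat \<Rightarrow> real) \<Rightarrow> (nat \<Rightarrow> real) \<Rightarrow> nat" where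
  "cheapest E f r \<delta> = (SOME i. is_arg_min f (\<lambda>i. i \<in> E \<and> 2 * r i + \<delta> i \<le> 3 * reach E r \<delta>) i)"

lemma target_spec:
  assumes "finite E" "E \<noteq> {}"
  shows "target E r \<delta> \<in> E" "2 * r (target E r \<delta>) + \<delta> (target E r \<delta>) = reach E r \<delta>"
proof -
  have "reach E r \<delta> \<in> (\<lambda>i. 2 * r i + \<delta> i) ` E" unfolding reach_def using assms by (intro Min_in) auto
  hence "\<exists>i. i \<in> E \<and> 2 * r i + \<delta> i = reach E r \<delta>" by auto
  from someI_ex[OF this]
  show "target E r \<delta> \<in> E" "2 * r (target E r \<delta>) + \<delta> (target E r \<delta>) = reach E r \<delta>"
    unfolding target_def by auto
qed

text \<open>\<open>E\<close> are the facilities allowed by a guess. \<open>B i\<close> has enough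
  clients to pay \<open>f i\<close> in shares of \<open>r i\<close>, but overpays by at most one
  share; the former drives the sampling, the latter bounds the last ball taken.
  \<open>half_ball\<close>, which says that half the radius does not pay more than the cost, yields
  the lower bound on solutions.\<close>

locale facility_radii =
  fixes E C :: "nat set" and d :: "nat \<Rightarrow> nat \<Rightarrow> real" and f r :: "nat \<Rightarrow> real" and B :: "nat \<Rightarrow> nat set"
  assumes finite_E: "finite E" and E_ne: "E \<noteq> {}" and finite_C: "finite C"
    and d_nonneg: "x \<in> E \<union> C \<Longrightarrow> y \<in> E \<union> C \<Longrightarrow> 0 \<le> d x y"
    and d_sym: "x \<in> E \<union> C \<Longrightarrow> y \<in> E \<union> C \<Longrightarrow> d x y = d y x"
    and d_tri: "x \<in> E \<union> C \<Longrightarrow> y \<in> E \<union> C \<Longrightarrow> z \<in> E \<union> C \<Longrightarrow> d x z \<le> d x y + d y z"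
    and f_pos: "i \<in> E \<Longrightarrow> 0 < f i" and r_pos: "i \<in> E \<Longrightarrow> 0 < r i"
    and B_sub: "i \<in> E \<Longrightarrow> B i \<subseteq> C" and B_dist: "i \<in> E \<Longrightarrow> u \<in> B i \<Longrightarrow> d i u \<le> r i"
    and B_lower: "i \<in> E \<Longrightarrow> f i \<le> real (card (B i)) * r i"
    and B_upper: "i \<in> E \<Longrightarrow> real (card (B i)) * r i \<le> f i + r i"
    and half_ball: "i \<in> E \<Longrightarrow> real (card {j\<in>C. d i j \<le> r i / 2}) * (r i / 2) \<le> f i"
begin

definition R :: "nat \<Rightarrow> real" where "R j = reach E r (\<lambda>i. d i j)"
definition tgt :: "nat \<Rightarrow> nat" where "tgt j = target E r (\<lambda>i. d i j)"
definition chp :: "nat \<Rightarrow> nat" where "chp j = cheapest E f r (\<lambda>i. d i j)"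

lemma R_le: "i \<in> E \<Longrightarrow> R j \<le> 2 * r i + d i j"
  unfolding R_def reach_def using finite_E by (intro Min_le) auto

lemma tgt: "tgt j \<in> E" "R j = 2 * r (tgt j) + d (tgt j) j"
  using target_spec[OF finite_E E_ne, of r "\<lambda>i. d i j"] by (auto simp: tgt_def R_def)

lemma R_pos: "j \<in> C \<Longrightarrow> 0 < R j"
  using tgt[of j] r_pos[of "tgt j"] d_nonneg[of "tgt j" j] by auto

lemma chp:
  assumes "j \<in> C"
  shows "chp j \<in> E" "2 * r (chp j) + d (chp j) j \<le> 3 * R j"
    "\<And>i. i \<in> E \<Longrightarrow> 2 * r i + d i j \<le> 3 * R j \<Longrightarrow> f (chp j) \<le> f i"
proof -
  let ?P = "\<lambda>i. i \<in> E \<and> 2 * r i + d i j \<le> 3 * reach E r (\<lambda>i. d i j)"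
  have "?P (tgt j)" using tgt[of j] R_pos[OF assms] by (simp add: R_def)
  hence "\<exists>i. is_arg_min f ?P i"
    using finite_E ex_is_arg_min_if_finite[of "{i. ?P i}" f] by auto
  from someI_ex[OF this] have "is_arg_min f ?P (chp j)" unfolding chp_def cheapest_def .
  thus "chp j \<in> E" "2 * r (chp j) + d (chp j) j \<le> 3 * R j"
    "\<And>i. i \<in> E \<Longrightarrow> 2 * r i + d i j \<le> 3 * R j \<Longrightarrow> f (chp j) \<le> f i"
    unfolding R_def is_arg_min_linorder by auto
qed

lemma dist_chp: "j \<in> C \<Longrightarrow> d (chp j) j \<le> 3 * R j"
  using chp(1,2)[of j] r_pos[of "chp j"] by force

lemma r_tgt_le: "j \<in> C \<Longrightarrow> 2 * r (tgt j) \<le> R j"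
  using tgt[of j] d_nonneg[of "tgt j" j] by auto

text \<open>By minimality of the target, the clients funding a target all have a reach comparable
  to its radius.\<close>

lemma ball_target:
  assumes j: "j \<in> C" and u: "u \<in> B (tgt j)"
  shows "r (tgt j) \<le> R u" "R u \<le> 3 * r (tgt j)" "f (chp u) \<le> f (tgt j)"
proof -
  let ?t = "tgt j"
  have t: "?t \<in> E" and uC: "u \<in> C" using tgt B_sub u by auto
  have du: "d ?t u \<le> r ?t" using B_dist t u by auto
  have tu: "tgt u \<in> E" "R u = 2 * r (tgt u) + d (tgt u) u" using tgt by auto
  \<comment> \<open>Going from \<open>tgt u\<close> to \<open>j\<close> via \<open>u\<close> and
    \<open>?t\<close> lets \<open>d ?t j\<close> cancel, leaving
    \<open>2 * r ?t - d ?t u \<le> R u\<close>.\<close>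
  have "2 * r ?t + d ?t j \<le> 2 * r (tgt u) + d (tgt u) j" using tgt(2)[of j] R_le[OF tu(1), of j] by simp
  also have "d (tgt u) j \<le> d (tgt u) u + d u j" using tu(1) uC j by (intro d_tri) auto
  also have "d u j \<le> d u ?t + d ?t j" using t uC j by (intro d_tri) auto
  also have "d u ?t = d ?t u" using t uC by (intro d_sym) auto
  finally show 1: "r ?t \<le> R u" using tu(2) du by linarith
  show 2: "R u \<le> 3 * r ?t" using R_le[OF t, of u] du by linarith
  show "f (chp u) \<le> f ?t" using chp(3)[OF uC t] 1 du by linarith
qed

text \<open>Assign each client to a nearest open facility \<open>i\<close>. Clients farther than
  \<open>r i / 2\<close> pay half the radius by their own distance; for the closer ones
  \<open>half_ball\<close> charges all halves to \<open>f i\<close>. So the radii sum to at most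
  twice the cost, and \<open>R j \<le> 2 * r i + d i j\<close> gives 5 = 2 * 2 + 1.\<close>

lemma lower_bound:
  assumes S: "S \<subseteq> C" and F': "F' \<subseteq> E" "F' \<noteq> {}"
  shows "(\<Sum>j\<in>S. R j) \<le> 5 * ((\<Sum>i\<in>F'. f i) + (\<Sum>j\<in>S. Min ((\<lambda>i. d i j) ` F')))"
proof -
  have fS: "finite S" and fF: "finite F'" using S F' finite_C finite_E by (auto intro: finite_subset)
  have "\<exists>i. i \<in> F' \<and> d i j = Min ((\<lambda>i. d i j) ` F')" for j
  proof -
    have "Min ((\<lambda>i. d i j) ` F') \<in> (\<lambda>i. d i j) ` F'" using fF F'(2) by (intro Min_in) auto
    thus ?thesis by force
  qed
  then obtain a where a: "\<And>j. a j \<in> F'" "\<And>j. d (a j) j = Min ((\<lambda>i. d i j) ` F')" by metis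
  define S' where "S' i = {j\<in>S. a j = i}" for i
  have part: "(\<Sum>j\<in>S. g j) = (\<Sum>i\<in>F'. \<Sum>j\<in>S' i. g j)" for g :: "nat \<Rightarrow> real"
    unfolding S'_def using fS fF a(1) by (subst sum.group) auto
  have "(\<Sum>j\<in>S' i. r i) \<le> 2 * (f i + (\<Sum>j\<in>S' i. d i j))" if i: "i \<in> F'" for i
  proof -
    have iE: "i \<in> E" using i F' by auto
    have fin: "finite (S' i)" and sub: "S' i \<subseteq> C" using fS S by (auto simp: S'_def)
    have "(\<Sum>j\<in>S' i. r i / 2) \<le> (\<Sum>j\<in>S' i. d i j + (if d i j \<le> r i / 2 then r i / 2 else 0))"
      using sub iE d_nonneg[of i] by (intro sum_mono) (auto simp: subset_iff)
    also have "\<dots> = (\<Sum>j\<in>S' i. d i j) + (\<Sum>j | j \<in> S' i \<and> d i j \<le> r i / 2. r i / 2)"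
      by (simp only: sum.distrib sum.inter_filter[OF fin])
    also have "(\<Sum>j | j \<in> S' i \<and> d i j \<le> r i / 2. r i / 2) \<le> (\<Sum>j | j \<in> C \<and> d i j \<le> r i / 2. r i / 2)"
      using sub finite_C r_pos[OF iE] by (intro sum_mono2) auto
    also have "\<dots> \<le> f i" using half_ball[OF iE] by simp
    finally show ?thesis by (simp add: sum_divide_distrib[symmetric])
  qed
  note half = this
  have "(\<Sum>j\<in>S. R j) \<le> (\<Sum>j\<in>S. 2 * r (a j) + d (a j) j)"
    using a(1) F' by (intro sum_mono R_le) auto
  also have "\<dots> = (\<Sum>i\<in>F'. 2 * (\<Sum>j\<in>S' i. r i) + (\<Sum>j\<in>S' i. d i j))"
    unfolding part by (intro sum.cong) (auto simp: S'_def sum.distrib sum_distrib_left)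
  also have "\<dots> \<le> (\<Sum>i\<in>F'. 5 * (f i + (\<Sum>j\<in>S' i. d i j)))"
  proof (intro sum_mono)
    fix i assume i: "i \<in> F'"
    have "0 \<le> f i" using i F' f_pos[of i] by auto
    thus "2 * (\<Sum>j\<in>S' i. r i) + (\<Sum>j\<in>S' i. d i j) \<le> 5 * (f i + (\<Sum>j\<in>S' i. d i j))"
      using half[OF i] by argo
  qed
  also have "\<dots> = 5 * ((\<Sum>i\<in>F'. f i) + (\<Sum>i\<in>F'. \<Sum>j\<in>S' i. d (a j) j))"
    by (simp add: S'_def sum_distrib_left[symmetric] sum.distrib)
  also have "(\<Sum>i\<in>F'. \<Sum>j\<in>S' i. d (a j) j) = (\<Sum>j\<in>S. Min ((\<lambda>i. d i j) ` F'))"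
    unfolding part[symmetric] a(2) ..
  finally show ?thesis .
qed

end

section \<open>Choosing the clients to be served\<close>

text \<open>Clients are visited in the order \<open>e\<close> of increasing reach; each visited client is taken
  together with the ball funding its target. Client \<open>u\<close> is taken at step \<open>idx u\<close>.\<close>

locale ordered_clients = facility_radii +
  fixes e :: "nat \<Rightarrow> nat" and p :: nat
  assumes e_bij: "bij_betw e {..<card C} C"
    and e_mono: "k \<le> l \<Longrightarrow> l < card C \<Longrightarrow> R (e k) \<le> R (e l)"
    and p_pos: "1 \<le> p" and p_le: "p \<le> card C"
begin

definition idx :: "nat \<Rightarrow> nat" where
  "idx u = (LEAST l. u = e l \<or> u \<in> B (tgt (e l)))"

definition prefix :: "nat \<Rightarrow> nat set" where "prefix m = {u\<in>C. idx u < m}"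

definition steps :: nat where "steps = (LEAST m. p \<le> card (prefix m))"

definition served :: "nat set" where "served = prefix steps"

text \<open>Used in place of \<open>tgt u\<close>, because the ball of this target is taken no later
  than \<open>u\<close> and hence is served whenever \<open>u\<close> is.\<close>

definition tau :: "nat \<Rightarrow> nat" where "tau u = tgt (e (idx u))"

lemma e_in: "l < card C \<Longrightarrow> e l \<in> C"
  using e_bij by (auto simp: bij_betw_def)

lemma idx:
  assumes "u \<in> C"
  shows "idx u < card C" "u = e (idx u) \<or> u \<in> B (tgt (e (idx u)))"
proof -
  obtain l where l: "l < card C" "u = e l"
    using assms e_bij by (auto simp: bij_betw_def image_iff)
  hence "u = e l \<or> u \<in> B (tgt (e l))" by simp
  from LeastI[of "\<lambda>l. u = e l \<or> u \<in> B (tgt (e l))", OF this] Least_le[of "\<lambda>l. u = e l \<or> u \<in> B (tgt (e l))", OF this] l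
  show "idx u < card C" "u = e (idx u) \<or> u \<in> B (tgt (e (idx u)))" unfolding idx_def by auto
qed

lemma idx_le: "u = e l \<or> u \<in> B (tgt (e l)) \<Longrightarrow> idx u \<le> l"
  unfolding idx_def by (rule Least_le)

lemma prefix_sub: "prefix m \<subseteq> C" by (auto simp: prefix_def)

lemma finite_prefix: "finite (prefix m)"
  using prefix_sub finite_C by (rule finite_subset)

lemma steps: "p \<le> card served" "m < steps \<Longrightarrow> card (prefix m) < p" "1 \<le> steps" "steps \<le> card C"
proof -
  have "prefix (card C) = C" using idx by (auto simp: prefix_def)
  hence all: "p \<le> card (prefix (card C))" using p_le by simp
  show "p \<le> card served" unfolding served_def steps_def by (rule LeastI[of "\<lambda>m. p \<le> card (prefix m)", OF all])
  show "m < steps \<Longrightarrow> card (prefix m) < p" unfolding steps_def by (metis not_less_Least not_le)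
  show "steps \<le> card C" unfolding steps_def using all by (rule Least_le)
  have "prefix 0 = {}" by (simp add: prefix_def)
  hence "steps \<noteq> 0" using \<open>p \<le> card served\<close> p_pos unfolding served_def by (metis card.empty not_one_le_zero order_trans)
  thus "1 \<le> steps" by simp
qed

lemma served_sub: "served \<subseteq> C" unfolding served_def by (rule prefix_sub)

lemma finite_served: "finite served" unfolding served_def by (rule finite_prefix)

lemma tau:
  assumes "u \<in> C"
  shows "tau u \<in> E" "d (tau u) u \<le> R u" "r (tau u) \<le> R u"
proof -
  let ?j = "e (idx u)"
  have j: "?j \<in> C" using idx(1)[OF assms] e_in by auto
  show "tau u \<in> E" unfolding tau_def by (rule tgt)
  have rp: "0 < r (tau u)" using \<open>tau u \<in> E\<close> r_pos by auto
  have "d (tau u) u \<le> R u \<and> r (tau u) \<le> R u"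
  proof (cases "u \<in> B (tgt ?j)")
    case True
    thus ?thesis using ball_target(1)[OF j True] B_dist[of "tau u" u] tgt(1) unfolding tau_def by force
  next
    case False
    hence "u = ?j" using idx(2)[OF assms] by auto
    hence "tau u = tgt u" unfolding tau_def by simp
    thus ?thesis using tgt[of u] rp d_nonneg[of "tgt u" u] assms by auto
  qed
  thus "d (tau u) u \<le> R u" "r (tau u) \<le> R u" by auto
qed

lemma tau_ball:
  assumes u: "u \<in> C" and v: "v \<in> B (tau u)"
  shows "v \<in> C" "r (tau u) \<le> R v" "R v \<le> 3 * r (tau u)" "f (chp v) \<le> f (tau u)"
  using ball_target[of "e (idx u)" v] v e_in[OF idx(1)[OF u]] B_sub[OF tau(1)[OF u]] unfolding tau_def by auto

lemma tau_ball_served: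
  assumes u: "u \<in> served"
  shows "B (tau u) \<subseteq> served"
proof
  fix v assume v: "v \<in> B (tau u)"
  have "u \<in> C" using u served_sub by auto
  hence "v \<in> C" using tau_ball v by auto
  moreover have "idx v \<le> idx u" using v unfolding tau_def by (intro idx_le) auto
  ultimately show "v \<in> served" using u by (auto simp: served_def prefix_def)
qed

text \<open>Apart from the ball of the last step, at most \<open>p\<close> clients are taken; these,
  called \<open>Q\<close>, are compared with \<open>S\<close> at a loss of 3/2. The last ball is
  charged to \<open>g\<close> by \<open>B_upper\<close>, up to another 3/2 times the sum over
  \<open>S\<close>.\<close>

lemma sum_served_le:
  assumes g: "\<And>i. i \<in> E \<Longrightarrow> f i \<le> g" and S: "S \<subseteq> C" "card S = p"
  shows "(\<Sum>u\<in>served. R u) \<le> 3 * (g + (\<Sum>u\<in>S. R u))"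
proof -
  define m where "m = steps - 1"
  have m: "m < steps" "steps = Suc m" and mC: "m < card C" using steps(3,4) by (auto simp: m_def)
  define L where "L = e ` {..m}"
  define Q where "Q = prefix m \<union> {e m}"
  define \<rho> where "\<rho> = R (e m)"
  let ?B = "B (tgt (e m))"
  have em: "e m \<in> C" using e_in mC by auto
  have cardL: "card L = Suc m"
    unfolding L_def using e_bij mC by (subst card_image) (auto simp: bij_betw_def intro: inj_on_subset)
  have LC: "L \<subseteq> C" unfolding L_def using e_in mC by auto
  have finL: "finite L" by (simp add: L_def)
  have finQ: "finite Q" using finite_prefix by (simp add: Q_def)
  have finS: "finite S" using S finite_C by (auto intro: finite_subset)
  have LQ: "L \<subseteq> Q"
  proof
    fix u assume "u \<in> L"
    then obtain l where l: "l \<le> m" "u = e l" by (auto simp: L_def)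
    show "u \<in> Q"
    proof (cases "l = m")
      case False
      hence "idx u < m" using idx_le[of u l] l by auto
      thus ?thesis using l mC e_in by (auto simp: Q_def prefix_def)
    qed (use l in \<open>simp add: Q_def\<close>)
  qed
  have cardQ: "card Q \<le> p"
    using steps(2)[OF m(1)] card_Un_le[of "prefix m" "{e m}"] by (simp add: Q_def)
  have served_cover: "served \<subseteq> Q \<union> ?B"
  proof
    fix u assume "u \<in> served"
    hence u: "u \<in> C" "idx u \<le> m" using m(2) by (auto simp: served_def prefix_def)
    thus "u \<in> Q \<union> ?B" using idx(2)[OF u(1)] by (cases "idx u = m") (auto simp: Q_def prefix_def)
  qed
  have L_le: "R u \<le> \<rho>" if "u \<in> L" for u
    using that e_mono[OF _ mC] by (auto simp: L_def \<rho>_def)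
  have out_ge: "\<rho> \<le> R u" if "u \<in> C - L" for u
  proof -
    have "u \<in> e ` {..<card C}" using that e_bij by (simp add: bij_betw_def)
    then obtain l where l: "l < card C" "u = e l" by auto
    hence "m \<le> l" using that by (auto simp: L_def not_le)
    thus ?thesis using e_mono[OF _ l(1)] l(2) by (simp add: \<rho>_def)
  qed
  \<comment> \<open>Such a \<open>u\<close> was taken in the ball of an earlier visited client. Its
    reach is at most three radii of that target, and two radii are at most the reach of the visited
    client.\<close>
  have Q_le: "R u \<le> 3 / 2 * \<rho>" if "u \<in> Q - L" for u
  proof -
    have "u \<in> prefix m" using that LQ by (auto simp: Q_def L_def)
    hence u: "u \<in> C" "idx u < m" by (auto simp: prefix_def)
    hence "e (idx u) \<in> L" "e (idx u) \<in> C" using e_in mC by (auto simp: L_def)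
    moreover have "u \<noteq> e (idx u)" using that \<open>e (idx u) \<in> L\<close> by auto
    hence "u \<in> B (tgt (e (idx u)))" using idx(2)[OF u(1)] by auto
    ultimately show ?thesis
      using ball_target(2)[of "e (idx u)" u] r_tgt_le[of "e (idx u)"] L_le[of "e (idx u)"] by linarith
  qed
  have \<rho>0: "0 < \<rho>" unfolding \<rho>_def using em by (rule R_pos)
  \<comment> \<open>Exchange argument: the \<open>m + 1\<close> clients of \<open>L\<close> have
    reach at most \<open>\<rho>\<close>, all others at least \<open>\<rho>\<close>.\<close>
  have core: "(\<Sum>u\<in>L. R u) + (real p - real (Suc m)) * \<rho> \<le> (\<Sum>u\<in>S. R u)"
  proof -
    have "(\<Sum>u\<in>S - L. \<rho>) \<le> (\<Sum>u\<in>S - L. R u)" using S out_ge by (intro sum_mono) auto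
    moreover have "(\<Sum>u\<in>L - S. R u) \<le> (\<Sum>u\<in>L - S. \<rho>)" using L_le by (intro sum_mono) auto
    moreover have "(\<Sum>u\<in>S. R u) = (\<Sum>u\<in>S - L. R u) + (\<Sum>u\<in>S \<inter> L. R u)"
      using finS by (simp add: sum.Int_Diff[of S _ L])
    moreover have "(\<Sum>u\<in>L. R u) = (\<Sum>u\<in>L - S. R u) + (\<Sum>u\<in>S \<inter> L. R u)"
      using finL by (simp add: sum.Int_Diff[of L _ S] Int_commute)
    moreover have "real (card (S - L)) - real (card (L - S)) = real p - real (Suc m)"
    proof -
      have "card S = card (S - L) + card (S \<inter> L)" "card L = card (L - S) + card (S \<inter> L)"
        using card_Int_Diff[OF finS, of L] card_Int_Diff[OF finL, of S] by (auto simp: Int_commute)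
      thus ?thesis using S(2) cardL by simp
    qed
    hence "(\<Sum>u\<in>S - L. \<rho>) - (\<Sum>u\<in>L - S. \<rho>) = (real p - real (Suc m)) * \<rho>"
      by (simp add: left_diff_distrib[symmetric])
    ultimately show ?thesis by linarith
  qed
  have Sm: "Suc m \<le> p" using card_mono[OF finQ LQ] cardQ cardL by simp
  have "(\<Sum>u\<in>Q. R u) = (\<Sum>u\<in>L. R u) + (\<Sum>u\<in>Q - L. R u)"
    using sum.subset_diff[OF LQ finQ, of R] by simp
  also have "(\<Sum>u\<in>Q - L. R u) \<le> (\<Sum>u\<in>Q - L. 3 / 2 * \<rho>)" by (intro sum_mono Q_le)
  also have "\<dots> \<le> (real p - real (Suc m)) * (3 / 2 * \<rho>)"
  proof -
    have "card (Q - L) + Suc m \<le> p"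
      using card_Diff_subset[OF finL LQ] cardL cardQ card_mono[OF finQ LQ] by simp
    hence "real (card (Q - L)) \<le> real p - real (Suc m)" by linarith
    thus ?thesis using \<rho>0 by (simp add: mult_right_mono)
  qed
  finally have Q_bound: "(\<Sum>u\<in>Q. R u) \<le> 3 / 2 * (\<Sum>u\<in>S. R u)"
    using core sum_nonneg[of L R] R_pos LC by (auto simp: subset_iff less_imp_le intro: order_trans)
  have \<rho>_le: "\<rho> \<le> (\<Sum>u\<in>S. R u)"
  proof -
    have "\<rho> \<le> (\<Sum>u\<in>L. R u)"
      unfolding \<rho>_def using finL R_pos LC by (intro member_le_sum) (auto simp: L_def less_imp_le subset_iff)
    moreover have "0 \<le> (real p - real (Suc m)) * \<rho>" using Sm \<rho>0 by (intro mult_nonneg_nonneg) auto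
    ultimately show ?thesis using core by linarith
  qed
  have "(\<Sum>u\<in>?B. R u) \<le> (\<Sum>u\<in>?B. 3 * r (tgt (e m)))"
    using ball_target(2)[OF em] by (intro sum_mono)
  also have "\<dots> = 3 * (real (card ?B) * r (tgt (e m)))" by simp
  also have "\<dots> \<le> 3 * (f (tgt (e m)) + r (tgt (e m)))" using B_upper[OF tgt(1)[of "e m"]] by simp
  also have "\<dots> \<le> 3 * g + 3 / 2 * \<rho>"
  proof -
    have "f (tgt (e m)) \<le> g" "2 * r (tgt (e m)) \<le> \<rho>"
      using g[OF tgt(1)[of "e m"]] r_tgt_le[OF em] by (auto simp: \<rho>_def)
    thus ?thesis by argo
  qed
  finally have B_bound: "(\<Sum>u\<in>?B. R u) \<le> 3 * g + 3 / 2 * \<rho>" .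
  have finB: "finite ?B" using B_sub[OF tgt(1)] finite_C by (rule finite_subset)
  have QC: "Q \<subseteq> C" and BC: "?B \<subseteq> C" using prefix_sub em B_sub[OF tgt(1)] by (auto simp: Q_def)
  have "(\<Sum>u\<in>served. R u) \<le> (\<Sum>u\<in>Q \<union> ?B. R u)"
    using served_cover finQ finB QC BC R_pos by (intro sum_mono2) (auto simp: less_imp_le subset_iff)
  also have "\<dots> \<le> (\<Sum>u\<in>Q. R u) + (\<Sum>u\<in>?B. R u)"
  proof -
    have "0 \<le> (\<Sum>u\<in>Q \<inter> ?B. R u)" using QC R_pos by (intro sum_nonneg) (auto simp: less_imp_le subset_iff)
    thus ?thesis using sum.union_inter[OF finQ finB, of R] by linarith
  qed
  finally show ?thesis using Q_bound B_bound \<rho>_le by argo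
qed

end

section \<open>Sampling phases\<close>

definition subset_min :: "nat set \<Rightarrow> (nat \<Rightarrow> real) \<Rightarrow> nat \<Rightarrow> real" where
  "subset_min C R p = Min (sum R ` {S. S \<subseteq> C \<and> card S = p})"

lemma subset_min_le:
  assumes "finite C" "S \<subseteq> C" "card S = p"
  shows "subset_min C R p \<le> sum R S"
  unfolding subset_min_def using assms by (intro Min_le) auto

lemma subset_min_obtain:
  assumes "finite C" "p \<le> card C"
  obtains S where "S \<subseteq> C" "card S = p" "subset_min C R p = sum R S"
proof -
  have "sum R ` {S. S \<subseteq> C \<and> card S = p} \<noteq> {}"
    using obtain_subset_with_card_n[OF assms(2)] by auto
  hence "subset_min C R p \<in> sum R ` {S. S \<subseteq> C \<and> card S = p}"
    unfolding subset_min_def using assms(1) by (intro Min_in) auto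
  thus ?thesis using that by auto
qed

text \<open>The potential decreased by a phase: \<open>cost\<close> is the cost of the facilities opened, and
  \<open>cnt i\<close> counts how often the ball of facility \<open>i\<close> is missed.\<close>

definition score :: "nat set \<Rightarrow> (nat \<Rightarrow> nat) \<Rightarrow> (nat \<Rightarrow> real) \<Rightarrow> real \<Rightarrow> real \<Rightarrow> (nat \<Rightarrow> nat) \<Rightarrow> real" where
  "score P \<tau> X b cost cnt =
     2 * exp (- b / 2) * cost + b * (\<Sum>i\<in>\<tau> ` P. (\<Sum>j | j \<in> P \<and> \<tau> j = i. X j) * real (cnt i))"

text \<open>The average score that a hitting family guarantees. With \<open>V = b * sum X P\<close>
  the mean cost \<open>2 * V\<close> contributes 4 of the factor 6, the miss rate
  \<open>2 * exp (- b / 2)\<close> the other 2.\<close>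

definition score_bound :: "nat set \<Rightarrow> (nat \<Rightarrow> real) \<Rightarrow> real \<Rightarrow> real" where
  "score_bound P X b = 6 * exp (- b / 2) * b * sum X P"

text \<open>The conclusion of \<open>hitting_family\<close> as a predicate, so that all nodes can
  choose the same \<open>H\<close>. Members are indexed by pairs (block, position), taken from the
  clients so that each block and each position has a client node to judge it.\<close>

definition is_hitting_family ::
  "nat set \<Rightarrow> (nat \<times> nat) set \<Rightarrow> (nat \<Rightarrow> real) \<Rightarrow> (nat \<Rightarrow> real) \<Rightarrow> real \<Rightarrow> real \<Rightarrow> (nat \<times> nat \<Rightarrow> nat set) \<Rightarrow> bool" where
  "is_hitting_family P J q c V b H \<longleftrightarrow>
     (\<forall>x\<in>J. H x \<subseteq> P) \<and>
     (\<Sum>x\<in>J. \<Sum>u\<in>H x. c u) \<le> 2 * real (card J) * V \<and>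
     (\<forall>S. S \<subseteq> P \<longrightarrow> (\<Prod>u\<in>S. 1 - q u) \<le> exp (- b) \<longrightarrow>
        real (card {x\<in>J. H x \<inter> S = {}}) \<le> 2 * exp (- b / 2) * real (card J))"

context ordered_clients
begin

definition opening_prob :: "real \<Rightarrow> nat \<Rightarrow> real" where
  "opening_prob b u = min 1 (b * R u / f (chp u))"

lemma f_chp_pos: "u \<in> C \<Longrightarrow> 0 < f (chp u)"
  using chp(1) f_pos by auto

lemma opening_prob:
  assumes "u \<in> C" "0 \<le> b"
  shows "0 \<le> opening_prob b u" "opening_prob b u \<le> 1" "opening_prob b u * f (chp u) \<le> b * R u"
proof -
  have *: "0 \<le> b * R u" "0 < f (chp u)" using assms R_pos[of u] f_chp_pos[of u] by auto
  show "0 \<le> opening_prob b u" "opening_prob b u \<le> 1" using * by (auto simp: opening_prob_def)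
  have "opening_prob b u * f (chp u) \<le> b * R u / f (chp u) * f (chp u)"
    using * by (intro mult_right_mono) (auto simp: opening_prob_def)
  thus "opening_prob b u * f (chp u) \<le> b * R u" using * by simp
qed

text \<open>Every \<open>u\<close> in the ball of \<open>i\<close> has \<open>R u \<ge> r i\<close>
  and \<open>f (chp u) \<le> f i\<close>, so the uncapped rate is at least
  \<open>y = b * r i / f i\<close>. If \<open>y \<ge> 1\<close>, some member opens with certainty;
  otherwise the product is at most \<open>exp (- card (B i) * y)\<close>, and
  \<open>card (B i) * r i \<ge> f i\<close> makes this at most \<open>exp (- b)\<close>.\<close>

lemma prod_ball_le:
  assumes j: "j \<in> C" and b: "0 \<le> b"
  shows "(\<Prod>u\<in>B (tau j). 1 - opening_prob b u) \<le> exp (- b)"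
proof -
  let ?i = "tau j"
  have i: "?i \<in> E" "0 < r ?i" "0 < f ?i" using tau(1)[OF j] r_pos f_pos by auto
  have fin: "finite (B ?i)" using B_sub[OF i(1)] finite_C by (rule finite_subset)
  have "0 < real (card (B ?i))" using B_lower[OF i(1)] i by (metis mult_zero_left not_le of_nat_0_le_iff order_le_less)
  hence ne: "B ?i \<noteq> {}" by auto
  define y where "y = b * r ?i / f ?i"
  have y0: "0 \<le> y" using b i by (simp add: y_def)
  have ratio: "y \<le> b * R u / f (chp u)" if u: "u \<in> B ?i" for u
  proof -
    have "u \<in> C" using tau_ball(1)[OF j u] .
    thus ?thesis
      unfolding y_def using tau_ball[OF j u] b i f_chp_pos by (intro frac_le mult_left_mono mult_nonneg_nonneg) auto
  qed
  show ?thesis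
  proof (cases "1 \<le> y")
    case True
    from ne obtain u where u: "u \<in> B ?i" by auto
    have "opening_prob b u = 1" using ratio[OF u] True by (simp add: opening_prob_def)
    hence "(\<Prod>u\<in>B ?i. 1 - opening_prob b u) = 0" using u fin by auto
    thus ?thesis by simp
  next
    case False
    have "(\<Prod>u\<in>B ?i. 1 - opening_prob b u) \<le> (\<Prod>u\<in>B ?i. exp (- y))"
    proof (intro prod_mono conjI)
      fix u assume u: "u \<in> B ?i"
      show "0 \<le> 1 - opening_prob b u" by (simp add: opening_prob_def)
      have "1 - opening_prob b u \<le> 1 - y" using ratio[OF u] False by (simp add: opening_prob_def)
      also have "\<dots> \<le> exp (- y)" using exp_ge_add_one_self[of "- y"] by simp
      finally show "1 - opening_prob b u \<le> exp (- y)" .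
    qed
    also have "\<dots> = exp (- (real (card (B ?i)) * y))" by (simp add: exp_of_nat_mult[symmetric])
    also have "\<dots> \<le> exp (- b)"
    proof -
      have "b * f ?i \<le> b * (real (card (B ?i)) * r ?i)" using B_lower[OF i(1)] b by (intro mult_left_mono)
      hence "b \<le> real (card (B ?i)) * y" using i(3) by (simp add: y_def field_simps)
      thus ?thesis by simp
    qed
    finally show ?thesis .
  qed
qed

text \<open>The bound \<open>exp (b / 2) \<le> card C\<close> is what makes
  \<open>C \<times> C\<close> a large enough index set: then
  \<open>card P \<le> n \<le> exp (- b / 2) * n^2\<close>.\<close>

lemma hitting_family_exists:
  assumes P: "P \<subseteq> C" and X: "\<And>u. u \<in> C \<Longrightarrow> R u \<le> X u" and b: "3 \<le> b"
    and size: "exp (b / 2) \<le> real (card C)"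
  shows "\<exists>H. is_hitting_family P (C \<times> C) (opening_prob b) (\<lambda>u. f (chp u)) (b * sum X P) b H"
proof -
  have fin: "finite P" using P finite_C by (rule finite_subset)
  have X_pos: "0 < X u" if "u \<in> C" for u using X[OF that] R_pos[OF that] by linarith
  have V: "(\<Sum>u\<in>P. opening_prob b u * f (chp u)) \<le> b * sum X P"
    unfolding sum_distrib_left
  proof (intro sum_mono)
    fix u assume "u \<in> P"
    hence u: "u \<in> C" using P by auto
    have "opening_prob b u * f (chp u) \<le> b * R u" using opening_prob(3)[OF u] b by simp
    also have "\<dots> \<le> b * X u" using X[OF u] b by simp
    finally show "opening_prob b u * f (chp u) \<le> b * X u" .
  qed
  have V0: "0 < b * sum X P" if "P \<noteq> {}"
    using that P b X_pos fin by (intro mult_pos_pos sum_pos) auto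
  have "real (card P) \<le> exp (- b / 2) * real (card (C \<times> C))"
  proof -
    have "real (card P) \<le> real (card C)" using P finite_C by (simp add: card_mono)
    also have "\<dots> = exp (- b / 2) * exp (b / 2) * real (card C)" by (simp flip: exp_add)
    also have "\<dots> \<le> exp (- b / 2) * real (card C) * real (card C)"
      using size by (intro mult_right_mono mult_left_mono) auto
    finally show ?thesis by (simp add: card_cartesian_product)
  qed
  note card = this
  have q: "0 \<le> opening_prob b u" "opening_prob b u \<le> 1" "0 \<le> f (chp u)" if "u \<in> P" for u
    using opening_prob[of u b] f_chp_pos[of u] that P b by auto
  obtain H where "\<And>x. x \<in> C \<times> C \<Longrightarrow> H x \<subseteq> P"
    "(\<Sum>x\<in>C \<times> C. \<Sum>u\<in>H x. f (chp u)) \<le> 2 * real (card (C \<times> C)) * (b * sum X P)"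
    "\<And>S. S \<subseteq> P \<Longrightarrow> (\<Prod>u\<in>S. 1 - opening_prob b u) \<le> exp (- b) \<Longrightarrow>
       real (card {x\<in>C \<times> C. H x \<inter> S = {}}) \<le> 2 * exp (- b / 2) * real (card (C \<times> C))"
    using hitting_family[where P=P and J="C \<times> C" and q="opening_prob b" and c="\<lambda>u. f (chp u)" and b=b,
      OF fin finite_cartesian_product[OF finite_C finite_C] q V V0 b card] by blast
  thus ?thesis unfolding is_hitting_family_def by blast
qed

text \<open>Averaging twice: the score is additive over members because \<open>cnt\<close> sums
  \<open>hit\<close> over a block, so some block, and some member of any good block, does not exceed
  the average. The two summands of the score are nonnegative, so each obeys the bound by itself. A
  ball not inside \<open>P\<close> counts as never missed; \<open>unserved_step\<close> shows that
  its client is served anyway.\<close>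

lemma hitting_family_pick:
  assumes P: "P \<subseteq> C" and X: "\<And>u. u \<in> C \<Longrightarrow> 0 \<le> X u" and b: "3 \<le> b"
    and H: "is_hitting_family P (C \<times> C) (opening_prob b) (\<lambda>u. f (chp u)) (b * sum X P) b H"
  defines "cnt \<equiv> \<lambda>x i. card {y\<in>C. B i \<subseteq> P \<and> H (x, y) \<inter> B i = {}}"
    and "hit \<equiv> \<lambda>x y i. if B i \<subseteq> P \<and> H (x, y) \<inter> B i = {} then 1 else 0"
  shows "\<exists>x\<in>C. score P tau X b (\<Sum>y\<in>C. \<Sum>u\<in>H (x, y). f (chp u)) (cnt x) \<le> real (card C) * score_bound P X b"
    and "x \<in> C \<Longrightarrow> score P tau X b (\<Sum>y\<in>C. \<Sum>u\<in>H (x, y). f (chp u)) (cnt x) \<le> real (card C) * score_bound P X b \<Longrightarrow>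
         \<exists>y\<in>C. score P tau X b (\<Sum>u\<in>H (x, y). f (chp u)) (hit x y) \<le> score_bound P X b"
    and "x \<in> C \<Longrightarrow> y \<in> C \<Longrightarrow> score P tau X b (\<Sum>u\<in>H (x, y). f (chp u)) (hit x y) \<le> score_bound P X b \<Longrightarrow>
         (\<Sum>u\<in>H (x, y). f (chp u)) \<le> 3 * b * sum X P \<and>
         (\<Sum>j | j \<in> P \<and> B (tau j) \<subseteq> P \<and> B (tau j) \<inter> H (x, y) = {}. X j) \<le> 6 * exp (- b / 2) * sum X P"
proof -
  let ?n = "real (card C)"
  have fin: "finite P" using P finite_C by (rule finite_subset)
  have C_ne: "C \<noteq> {}" using p_pos p_le by auto
  have HP: "H (x, y) \<subseteq> P" if "x \<in> C" "y \<in> C" for x y using H that by (auto simp: is_hitting_family_def)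
  define Xw where "Xw i = (\<Sum>j | j \<in> P \<and> tau j = i. X j)" for i
  have Xw0: "0 \<le> Xw i" for i unfolding Xw_def using X P by (intro sum_nonneg) auto
  have sumXw: "(\<Sum>i\<in>tau ` P. Xw i) = sum X P"
    unfolding Xw_def by (rule sum.image_gen[OF fin, symmetric])
  have cnt_sum: "cnt x i = (\<Sum>y\<in>C. hit x y i)" for x i
    unfolding cnt_def hit_def using finite_C by (simp add: sum.inter_filter[symmetric])
  have miss: "(\<Sum>x\<in>C. real (cnt x i)) \<le> 2 * exp (- b / 2) * (?n * ?n)" if i: "i \<in> tau ` P" for i
  proof (cases "B i \<subseteq> P")
    case True
    from i obtain j where j: "j \<in> P" "i = tau j" by auto
    have "(\<Sum>x\<in>C. cnt x i) = card (SIGMA x:C. {y\<in>C. H (x, y) \<inter> B i = {}})"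
      using finite_C True by (simp add: cnt_def)
    also have "(SIGMA x:C. {y\<in>C. H (x, y) \<inter> B i = {}}) = {x\<in>C \<times> C. H x \<inter> B i = {}}" by auto
    finally have "(\<Sum>x\<in>C. real (cnt x i)) = real (card {x\<in>C \<times> C. H x \<inter> B i = {}})"
      by (metis of_nat_sum)
    also have "\<dots> \<le> 2 * exp (- b / 2) * real (card (C \<times> C))"
      using H True prod_ball_le[of j b] j P b unfolding is_hitting_family_def by auto
    finally show ?thesis by (simp add: card_cartesian_product)
  next
    case False
    thus ?thesis by (simp add: cnt_def)
  qed
  let ?s = "\<lambda>x. score P tau X b (\<Sum>y\<in>C. \<Sum>u\<in>H (x, y). f (chp u)) (cnt x)"
  let ?s' = "\<lambda>x y. score P tau X b (\<Sum>u\<in>H (x, y). f (chp u)) (hit x y)"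
  have "(\<Sum>x\<in>C. ?s x) = 2 * exp (- b / 2) * (\<Sum>x\<in>C. \<Sum>y\<in>C. \<Sum>u\<in>H (x, y). f (chp u))
      + b * (\<Sum>i\<in>tau ` P. Xw i * (\<Sum>x\<in>C. real (cnt x i)))"
    unfolding score_def sum.distrib sum_distrib_left[symmetric] Xw_def[symmetric]
    by (subst sum.swap) (simp add: sum_distrib_left)
  also have "(\<Sum>x\<in>C. \<Sum>y\<in>C. \<Sum>u\<in>H (x, y). f (chp u)) = (\<Sum>x\<in>C \<times> C. \<Sum>u\<in>H x. f (chp u))"
    by (simp add: sum.cartesian_product)
  also have "\<dots> \<le> 2 * (?n * ?n) * (b * sum X P)"
    using H by (simp add: is_hitting_family_def card_cartesian_product)
  also have "(\<Sum>i\<in>tau ` P. Xw i * (\<Sum>x\<in>C. real (cnt x i)))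
      \<le> (\<Sum>i\<in>tau ` P. Xw i * (2 * exp (- b / 2) * (?n * ?n)))"
    by (intro sum_mono mult_left_mono miss Xw0)
  also have "\<dots> = 2 * exp (- b / 2) * (?n * ?n) * sum X P"
    unfolding sum_distrib_right[symmetric] sumXw by simp
  finally have total: "(\<Sum>x\<in>C. ?s x) \<le> ?n * (?n * score_bound P X b)"
    using b by (simp add: score_bound_def algebra_simps)
  have avg: "\<exists>x\<in>C. h x \<le> t" if "(\<Sum>x\<in>C. h x) \<le> ?n * t" for h :: "nat \<Rightarrow> real" and t
  proof (rule ccontr)
    assume "\<not> ?thesis"
    hence "(\<Sum>x\<in>C. t) < (\<Sum>x\<in>C. h x)" using finite_C C_ne by (intro sum_strict_mono) auto
    thus False using that by simp
  qed
  from avg[OF total] show "\<exists>x\<in>C. ?s x \<le> ?n * score_bound P X b" .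
  show "\<exists>y\<in>C. ?s' x y \<le> score_bound P X b" if "x \<in> C" "?s x \<le> ?n * score_bound P X b"
  proof (rule avg)
    have "(\<Sum>y\<in>C. ?s' x y) = ?s x"
      unfolding score_def sum.distrib sum_distrib_left[symmetric] cnt_sum
      by (subst sum.swap) (simp add: sum_distrib_left)
    thus "(\<Sum>y\<in>C. ?s' x y) \<le> ?n * score_bound P X b" using that by simp
  qed
  show "(\<Sum>u\<in>H (x, y). f (chp u)) \<le> 3 * b * sum X P \<and>
         (\<Sum>j | j \<in> P \<and> B (tau j) \<subseteq> P \<and> B (tau j) \<inter> H (x, y) = {}. X j) \<le> 6 * exp (- b / 2) * sum X P"
    if x: "x \<in> C" and y: "y \<in> C" and le: "?s' x y \<le> score_bound P X b"
  proof -
    let ?c = "\<Sum>u\<in>H (x, y). f (chp u)"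
    let ?m = "\<Sum>j | j \<in> P \<and> B (tau j) \<subseteq> P \<and> B (tau j) \<inter> H (x, y) = {}. X j"
    have "(\<Sum>i\<in>tau ` P. (\<Sum>j | j \<in> P \<and> tau j = i. X j) * real (hit x y i))
        = (\<Sum>i\<in>tau ` P. \<Sum>j | j \<in> P \<and> tau j = i. X j * real (hit x y (tau j)))"
      unfolding sum_distrib_right by (intro sum.cong) auto
    also have "\<dots> = (\<Sum>j\<in>P. X j * real (hit x y (tau j)))"
      by (rule sum.image_gen[OF fin, symmetric])
    also have "\<dots> = ?m"
      using fin unfolding hit_def by (subst sum.inter_filter) (auto intro!: sum.cong)
    finally have s: "?s' x y = 2 * exp (- b / 2) * ?c + b * ?m" unfolding score_def by simp
    have c0: "0 \<le> ?c" using HP[OF x y] P f_chp_pos by (intro sum_nonneg) (auto simp: less_imp_le subset_iff)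
    have m0: "0 \<le> ?m" using X P by (intro sum_nonneg) auto
    have bound: "score_bound P X b = 2 * exp (- b / 2) * (3 * b * sum X P)"
      "score_bound P X b = b * (6 * exp (- b / 2) * sum X P)"
      by (simp_all add: score_bound_def)
    have "0 \<le> b * ?m" using m0 b by simp
    hence "2 * exp (- b / 2) * ?c \<le> 2 * exp (- b / 2) * (3 * b * sum X P)"
      using le unfolding s bound(1) by linarith
    hence 1: "?c \<le> 3 * b * sum X P" by (subst (asm) mult_le_cancel_left_pos) auto
    have "0 \<le> 2 * exp (- b / 2) * ?c" using c0 by simp
    hence "b * ?m \<le> b * (6 * exp (- b / 2) * sum X P)"
      using le unfolding s bound(2) by linarith
    hence "?m \<le> 6 * exp (- b / 2) * sum X P" using b by (subst (asm) mult_le_cancel_left_pos) auto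
    with 1 show ?thesis by blast
  qed
qed

text \<open>A client left unserved by a phase has its ball entirely among the unserved clients and
  missed by the sample: a single served member of the ball would serve it at a constant
  factor more.\<close>

lemma unserved_step:
  assumes P: "P \<subseteq> served" and opened: "Op \<subseteq> E" and T: "T \<subseteq> P"
    and inv: "\<And>u. u \<in> served - P \<Longrightarrow> \<exists>i\<in>Op. d i u \<le> \<kappa> * R u" and \<kappa>: "11 \<le> \<kappa>"
    and j: "j \<in> P" and far: "\<And>i. i \<in> Op \<union> chp ` T \<Longrightarrow> 4 * \<kappa> * R j < d i j"
  shows "B (tau j) \<subseteq> P \<and> B (tau j) \<inter> T = {}"
proof -
  have jC: "j \<in> C" and js: "j \<in> served" using j P served_sub by auto
  let ?t = "tau j"
  have t: "?t \<in> E" "d ?t j \<le> R j" "r ?t \<le> R j" using tau[OF jC] by auto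
  have Rj: "0 < R j" using jC by (rule R_pos)
  have near: "d i j \<le> d i u + 2 * R j" if "i \<in> E" "u \<in> B ?t" for i u
  proof -
    have u: "u \<in> C" using tau_ball(1)[OF jC that(2)] .
    have "d i j \<le> d i u + d u j" using that(1) u jC by (intro d_tri) auto
    also have "d u j \<le> d u ?t + d ?t j" using t u jC by (intro d_tri) auto
    also have "d u ?t = d ?t u" using t u by (intro d_sym) auto
    also have "d ?t u \<le> r ?t" using B_dist[OF t(1) that(2)] .
    finally show ?thesis using t by linarith
  qed
  \<comment> \<open>11 = 9 + 2: \<open>chp u\<close> is within \<open>3 * R u \<le> 9 * R j\<close>
    of \<open>u\<close>, and \<open>near\<close> adds \<open>2 * R j\<close>. Through a served
    \<open>u\<close> the distance is \<open>3 * \<kappa> * R j\<close> plus at most another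
    \<open>\<kappa> * R j\<close>; hence the growth factor 4.\<close>
  have scale: "11 * R j \<le> \<kappa> * R j" using \<kappa> Rj by (intro mult_right_mono) auto
  have "u \<in> P \<and> u \<notin> T" if u: "u \<in> B ?t" for u
  proof -
    have uC: "u \<in> C" and Ru: "R u \<le> 3 * R j" using tau_ball[OF jC u] t by auto
    have "u \<in> P"
    proof (rule ccontr)
      assume "u \<notin> P"
      hence "u \<in> served - P" using tau_ball_served[OF js] u by auto
      from inv[OF this] obtain i where i: "i \<in> Op" "d i u \<le> \<kappa> * R u" by auto
      have "\<kappa> * R u \<le> \<kappa> * (3 * R j)" using Ru \<kappa> by (intro mult_left_mono) auto
      also have "\<dots> = 3 * (\<kappa> * R j)" by simp
      finally have "d i u \<le> 3 * (\<kappa> * R j)" using i(2) by linarith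
      moreover have "d i j \<le> d i u + 2 * R j" using near i(1) opened u by auto
      ultimately have "d i j \<le> 4 * (\<kappa> * R j)" using scale Rj by linarith
      thus False using far[of i] i(1) by (simp add: mult.assoc)
    qed
    moreover have "u \<notin> T"
    proof
      assume "u \<in> T"
      moreover have "d (chp u) j \<le> 4 * (\<kappa> * R j)"
        using near[OF chp(1)[OF uC] u] dist_chp[OF uC] Ru scale Rj by linarith
      ultimately show False using far[of "chp u"] by (force simp: mult.assoc)
    qed
    ultimately show ?thesis by blast
  qed
  thus ?thesis by auto
qed

end

text \<open>These make \<open>6 * exp (- b / 2) * b\<^sup>2\<close> at most \<open>b / 2\<close> and
  \<open>6 * exp (- b / 2)\<close> at most 1/8, which lets the phase budgets halve.\<close>

lemma exp_half_ge:
  fixes b :: real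
  assumes "16 \<le> b"
  shows "12 * b \<le> exp (b / 2)" "48 \<le> exp (b / 2)"
proof -
  let ?y = "b / 8"
  have y: "2 \<le> ?y" using assms by simp
  have "1 + ?y + ?y\<^sup>2 / 2 \<le> exp ?y" using y by (intro exp_lower_Taylor_quadratic) simp
  moreover have "4 \<le> ?y\<^sup>2" using y power_mono[of 2 ?y 2] by simp
  ultimately have e: "5 \<le> exp ?y" "?y \<le> exp ?y" using y by linarith+
  have eq: "exp (b / 2) = exp ?y ^ 3 * exp ?y" by (simp flip: exp_add exp_of_nat_mult add: power3_eq_cube)
  have e3: "125 \<le> exp ?y ^ 3" using power_mono[OF e(1), of 3] by simp
  have "125 * ?y \<le> exp ?y ^ 3 * exp ?y" using e3 e(2) y by (intro mult_mono) auto
  thus "12 * b \<le> exp (b / 2)" using y unfolding eq by linarith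
  have "125 * 5 \<le> exp ?y ^ 3 * exp ?y" using e3 e(1) by (intro mult_mono) auto
  thus "48 \<le> exp (b / 2)" unfolding eq by linarith
qed

context ordered_clients
begin

text \<open>The summand \<open>G / card C\<close> of the weight lets a small total weight bound the number of
  clients left over.\<close>

lemma phases_cost:
  fixes g :: real and K :: nat and b :: "nat \<Rightarrow> real" and Ps Os :: "nat \<Rightarrow> nat set"
  assumes g: "\<And>i. i \<in> E \<Longrightarrow> f i \<le> g"
  defines "G \<equiv> g + subset_min C R p"
  defines "X \<equiv> \<lambda>u. R u + G / card C"
  assumes b: "\<And>k. k < K \<Longrightarrow> 16 \<le> b k" "\<And>k. k < K \<Longrightarrow> b (Suc k) \<le> (b k)\<^sup>2" "\<And>k. 0 \<le> b k" "b 0 \<le> 16"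
    and start: "Ps 0 = served" "Os 0 = {}"
    and phase: "\<And>k. k < K \<Longrightarrow> \<exists>T\<subseteq>Ps k.
          (\<Sum>u\<in>T. f (chp u)) \<le> 3 * b k * sum X (Ps k) \<and>
          (\<Sum>j | j \<in> Ps k \<and> B (tau j) \<subseteq> Ps k \<and> B (tau j) \<inter> T = {}. X j) \<le> 6 * exp (- b k / 2) * sum X (Ps k) \<and>
          Os (Suc k) = Os k \<union> chp ` T \<and>
          Ps (Suc k) = {u\<in>Ps k. \<forall>i\<in>Os (Suc k). 11 * 4 ^ Suc k * R u < d i u}"
    and final: "K = 0 \<and> card C \<le> 3000 \<or> (\<exists>k. K = Suc k \<and> real (card C) \<le> exp (b k / 2))"
  defines "F' \<equiv> Os K \<union> chp ` Ps K"
  shows "F' \<subseteq> E" "F' \<noteq> {}" "(\<Sum>i\<in>F'. f i) + (\<Sum>u\<in>served. Min ((\<lambda>i. d i u) ` F')) \<le> 4000 * G"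
proof -
  let ?n = "real (card C)"
  have n: "1 \<le> ?n" using p_pos p_le by simp
  obtain S where S: "S \<subseteq> C" "card S = p" "subset_min C R p = sum R S"
    using subset_min_obtain[OF finite_C p_le] by blast
  have g0: "0 < g" using g f_pos E_ne by (meson all_not_in_conv less_le_trans)
  have sumS: "0 \<le> sum R S" using S R_pos by (intro sum_nonneg) (auto simp: less_imp_le subset_iff)
  have gG: "g \<le> G" and G0: "0 < G" using g0 sumS S by (auto simp: G_def)
  have RX: "R u \<le> X u" for u using G0 n by (simp add: X_def)
  have X0: "0 < X u" if "u \<in> C" for u using RX[of u] R_pos[OF that] by linarith
  define Y where "Y k = sum X (Ps k)" for k
  \<comment> \<open>The budget of phase \<open>k\<close>: \<open>3 * b k * Y k\<close> for opening,
    and \<open>11 * 4 ^ Suc k = 44 * 4 ^ k\<close> times the weight for connecting newly served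
    clients. As \<open>2 * Z (Suc k) \<le> Z k\<close>, the cost so far plus \<open>2 * Z k\<close>
    never increases.\<close>
  define Z where "Z k = (3 * b k + 44 * 4 ^ k) * Y k" for k
  \<comment> \<open>\<open>3 * G\<close> from \<open>sum_served_le\<close>, and one more
    \<open>G\<close> because at most \<open>card C\<close> clients carry the extra
    \<open>G / card C\<close>.\<close>
  have Y0: "Y 0 \<le> 4 * G"
  proof -
    have "real (card served) * (G / ?n) \<le> ?n * (G / ?n)"
      using card_mono[OF finite_C served_sub] G0 n by (intro mult_right_mono) auto
    moreover have "sum R served \<le> 3 * G" using sum_served_le[OF g S(1,2)] S(3) by (simp add: G_def)
    ultimately show ?thesis using n by (simp add: Y_def X_def start sum.distrib)
  qed
  have served_ne: "served \<noteq> {}" using steps(1) p_pos by auto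
  have inv: "Ps k \<subseteq> served \<and> Os k \<subseteq> E \<and>
      (\<forall>u\<in>served - Ps k. \<exists>i\<in>Os k. d i u \<le> 11 * 4 ^ k * R u) \<and> Y k \<le> Y 0 \<and>
      (\<Sum>i\<in>Os k. f i) + (\<Sum>u\<in>served - Ps k. Min ((\<lambda>i. d i u) ` Os k)) + 2 * Z k \<le> 2 * Z 0 \<and>
      (k > 0 \<longrightarrow> Y k \<le> 6 * exp (- b (k - 1) / 2) * Y (k - 1))"
    if "k \<le> K" for k
    using that
  proof (induction k)
    case 0
    show ?case by (simp add: start)
  next
    case (Suc k)
    hence k: "k < K" by simp
    have IH: "Ps k \<subseteq> served" "Os k \<subseteq> E" "\<And>u. u \<in> served - Ps k \<Longrightarrow> \<exists>i\<in>Os k. d i u \<le> 11 * 4 ^ k * R u"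
      "Y k \<le> Y 0" "(\<Sum>i\<in>Os k. f i) + (\<Sum>u\<in>served - Ps k. Min ((\<lambda>i. d i u) ` Os k)) + 2 * Z k \<le> 2 * Z 0"
      using Suc.IH Suc.prems by auto
    let ?\<delta> = "6 * exp (- b k / 2)"
    let ?\<kappa> = "11 * 4 ^ k :: real"
    obtain T where T: "T \<subseteq> Ps k" "(\<Sum>u\<in>T. f (chp u)) \<le> 3 * b k * Y k"
      "(\<Sum>j | j \<in> Ps k \<and> B (tau j) \<subseteq> Ps k \<and> B (tau j) \<inter> T = {}. X j) \<le> ?\<delta> * Y k"
      and Os: "Os (Suc k) = Os k \<union> chp ` T"
      and Ps: "Ps (Suc k) = {u\<in>Ps k. \<forall>i\<in>Os (Suc k). 11 * 4 ^ Suc k * R u < d i u}"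
      using phase[OF k] unfolding Y_def by blast
    have fin: "finite (Ps k)" "finite (Os k)" "finite T"
      using IH(1,2) T(1) finite_served finite_E by (auto intro: finite_subset)
    have PC: "Ps k \<subseteq> C" using IH(1) served_sub by auto
    have chpT: "chp ` T \<subseteq> E" using T(1) PC chp(1) by auto
    have sub: "Ps (Suc k) \<subseteq> Ps k" using Ps by auto
    have OE: "Os (Suc k) \<subseteq> E" using Os IH(2) chpT by auto
    have finO: "finite (Os (Suc k))" using OE finite_E by (rule finite_subset)
    have bk: "16 \<le> b k" using b(1)[OF k] .
    have Yk0: "0 \<le> Y k" unfolding Y_def using PC X0 by (intro sum_nonneg) (auto simp: less_imp_le subset_iff)
    have near: "\<exists>i\<in>Os (Suc k). d i u \<le> 11 * 4 ^ Suc k * R u" if u: "u \<in> served - Ps (Suc k)" for u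
    proof (cases "u \<in> Ps k")
      case True
      thus ?thesis using u Ps by (auto simp: not_less)
    next
      case False
      then obtain i where i: "i \<in> Os k" "d i u \<le> 11 * 4 ^ k * R u" using IH(3)[of u] u by auto
      have "11 * 4 ^ k * R u \<le> 11 * 4 ^ Suc k * R u"
        using R_pos[of u] u served_sub by (intro mult_right_mono) auto
      thus ?thesis using i Os by (intro bexI[of _ i] order_trans[OF i(2)]) auto
    qed
    have "Y (Suc k) \<le> (\<Sum>j | j \<in> Ps k \<and> B (tau j) \<subseteq> Ps k \<and> B (tau j) \<inter> T = {}. X j)"
      unfolding Y_def
    proof (rule sum_mono2)
      show "Ps (Suc k) \<subseteq> {j \<in> Ps k. B (tau j) \<subseteq> Ps k \<and> B (tau j) \<inter> T = {}}"
      proof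
        fix j assume j: "j \<in> Ps (Suc k)"
        have "4 * ?\<kappa> * R j < d i j" if "i \<in> Os k \<union> chp ` T" for i
          using j that unfolding Ps Os by auto
        moreover have "(11::real) \<le> ?\<kappa>" using one_le_power[of "4::real" k] by simp
        ultimately show "j \<in> {j \<in> Ps k. B (tau j) \<subseteq> Ps k \<and> B (tau j) \<inter> T = {}}"
          using unserved_step[OF IH(1,2) T(1) IH(3), of j] j sub by blast
      qed
    qed (use fin X0 PC in \<open>auto simp: less_imp_le subset_iff\<close>)
    also note T(3)
    finally have Ydec: "Y (Suc k) \<le> ?\<delta> * Y k" .
    have e: "12 * b k \<le> exp (b k / 2)" "48 \<le> exp (b k / 2)" using exp_half_ge[OF bk] by auto
    have \<delta>0: "0 \<le> ?\<delta>" by simp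
    have \<delta>b: "?\<delta> * (b k)\<^sup>2 \<le> b k / 2" "?\<delta> \<le> 1 / 8"
    proof -
      have "12 * b k * b k \<le> exp (b k / 2) * b k" using e(1) bk by (intro mult_right_mono) auto
      thus "?\<delta> * (b k)\<^sup>2 \<le> b k / 2" by (simp add: exp_minus field_simps power2_eq_square)
      show "?\<delta> \<le> 1 / 8" using e(2) by (simp add: exp_minus field_simps)
    qed
    \<comment> \<open>Both coefficients reappear: \<open>6 * (b k / 2) = 3 * b k\<close> absorbs the
      squaring, and \<open>352 / 8 = 44\<close> absorbs the factor 4.\<close>
    have "2 * Z (Suc k) \<le> Z k"
    proof -
      have Y1: "0 \<le> Y (Suc k)" unfolding Y_def using PC sub X0 by (intro sum_nonneg) (auto simp: less_imp_le subset_iff)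
      have "2 * Z (Suc k) \<le> 2 * (3 * (b k)\<^sup>2 + 176 * 4 ^ k) * Y (Suc k)"
        using b(2)[OF k] Y1 unfolding Z_def mult.assoc[symmetric] by (intro mult_right_mono) auto
      also have "\<dots> \<le> 2 * (3 * (b k)\<^sup>2 + 176 * 4 ^ k) * (?\<delta> * Y k)"
        using Ydec by (intro mult_left_mono) auto
      also have "\<dots> = (6 * (?\<delta> * (b k)\<^sup>2) + ?\<delta> * (352 * 4 ^ k)) * Y k" by (simp add: algebra_simps)
      also have "\<dots> \<le> (6 * (b k / 2) + 1 / 8 * (352 * 4 ^ k)) * Y k"
        using \<delta>b Yk0 by (intro mult_right_mono add_mono mult_left_mono) auto
      finally show ?thesis by (simp add: Z_def)
    qed
    moreover have "(\<Sum>i\<in>Os (Suc k). f i) \<le> (\<Sum>i\<in>Os k. f i) + 3 * b k * Y k"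
    proof -
      have "(\<Sum>i\<in>Os (Suc k). f i) \<le> (\<Sum>i\<in>Os k. f i) + (\<Sum>i\<in>chp ` T. f i)"
        unfolding Os using IH(2) chpT f_pos fin
        by (subst sum_Un) (auto intro!: sum_nonneg simp: less_imp_le subset_iff)
      also have "(\<Sum>i\<in>chp ` T. f i) \<le> (\<Sum>u\<in>T. f (chp u))"
        using fin f_chp_pos T(1) PC by (intro sum_image_le[where g=f, unfolded comp_def]) (auto simp: less_imp_le subset_iff)
      finally show ?thesis using T(2) by linarith
    qed
    moreover have "(\<Sum>u\<in>served - Ps (Suc k). Min ((\<lambda>i. d i u) ` Os (Suc k)))
       \<le> (\<Sum>u\<in>served - Ps k. Min ((\<lambda>i. d i u) ` Os k)) + 44 * 4 ^ k * Y k"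
    proof -
      have "served - Ps (Suc k) = (served - Ps k) \<union> (Ps k - Ps (Suc k))" using IH(1) sub by auto
      hence "(\<Sum>u\<in>served - Ps (Suc k). Min ((\<lambda>i. d i u) ` Os (Suc k)))
        = (\<Sum>u\<in>served - Ps k. Min ((\<lambda>i. d i u) ` Os (Suc k))) + (\<Sum>u\<in>Ps k - Ps (Suc k). Min ((\<lambda>i. d i u) ` Os (Suc k)))"
        using finite_served fin by (simp only:) (rule sum.union_disjoint, auto)
      also have "(\<Sum>u\<in>served - Ps k. Min ((\<lambda>i. d i u) ` Os (Suc k))) \<le> (\<Sum>u\<in>served - Ps k. Min ((\<lambda>i. d i u) ` Os k))"
      proof (rule sum_mono)
        fix u assume "u \<in> served - Ps k"
        hence "Os k \<noteq> {}" using IH(3)[of u] by auto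
        thus "Min ((\<lambda>i. d i u) ` Os (Suc k)) \<le> Min ((\<lambda>i. d i u) ` Os k)"
          using Os finO by (intro Min_antimono) auto
      qed
      also have "(\<Sum>u\<in>Ps k - Ps (Suc k). Min ((\<lambda>i. d i u) ` Os (Suc k))) \<le> (\<Sum>u\<in>Ps k - Ps (Suc k). 44 * 4 ^ k * X u)"
      proof (rule sum_mono)
        fix u assume u: "u \<in> Ps k - Ps (Suc k)"
        then obtain i where i: "i \<in> Os (Suc k)" "d i u \<le> 11 * 4 ^ Suc k * R u" using near[of u] IH(1) by auto
        have "Min ((\<lambda>i. d i u) ` Os (Suc k)) \<le> d i u" using i(1) finO by (intro Min_le) auto
        also have "\<dots> \<le> 44 * 4 ^ k * R u" using i(2) by simp
        also have "\<dots> \<le> 44 * 4 ^ k * X u" using RX by (intro mult_left_mono) auto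
        finally show "Min ((\<lambda>i. d i u) ` Os (Suc k)) \<le> 44 * 4 ^ k * X u" .
      qed
      also have "\<dots> \<le> 44 * 4 ^ k * Y k"
        unfolding sum_distrib_left[symmetric] Y_def using fin X0 PC
        by (intro mult_left_mono sum_mono2) (auto simp: less_imp_le subset_iff)
      finally show ?thesis by simp
    qed
    ultimately have "(\<Sum>i\<in>Os (Suc k). f i) + (\<Sum>u\<in>served - Ps (Suc k). Min ((\<lambda>i. d i u) ` Os (Suc k)))
        + 2 * Z (Suc k) \<le> 2 * Z 0"
      using IH(5) by (simp add: Z_def algebra_simps)
    moreover have "Y (Suc k) \<le> Y 0"
      using IH(4) Ydec mult_right_mono[OF \<delta>b(2) Yk0] Yk0 by linarith
    ultimately show ?case
      using IH(1) sub OE near Ydec by simp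
  qed
  have fin: "Ps K \<subseteq> served" "Os K \<subseteq> E" "\<And>u. u \<in> served - Ps K \<Longrightarrow> \<exists>i\<in>Os K. d i u \<le> 11 * 4 ^ K * R u"
    "Y K \<le> Y 0" "(\<Sum>i\<in>Os K. f i) + (\<Sum>u\<in>served - Ps K. Min ((\<lambda>i. d i u) ` Os K)) + 2 * Z K \<le> 2 * Z 0"
    "K > 0 \<Longrightarrow> Y K \<le> 6 * exp (- b (K - 1) / 2) * Y (K - 1)" "K > 0 \<Longrightarrow> Y (K - 1) \<le> Y 0"
    using inv[of K] inv[of "K - 1"] by auto
  have PC: "Ps K \<subseteq> C" using fin(1) served_sub by auto
  have finP: "finite (Ps K)" and finO: "finite (Os K)"
    using fin(1,2) finite_served finite_E by (auto intro: finite_subset)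
  show FE: "F' \<subseteq> E" using fin(2) PC chp(1) by (auto simp: F'_def)
  have finF: "finite F'" using FE finite_E by (rule finite_subset)
  show "F' \<noteq> {}"
  proof
    assume "F' = {}"
    hence "Os K = {}" "Ps K = {}" by (auto simp: F'_def)
    thus False using fin(3) served_ne by fastforce
  qed
  \<comment> \<open>After a last phase with \<open>n \<le> exp (b k / 2)\<close> the weight left is
    at most \<open>24 * G / n\<close>, while every client weighs at least \<open>G / n\<close>; so
    24 clients remain. Without phases, \<open>n\<close> itself is at most 3000.\<close>
  have few: "real (card (Ps K)) \<le> 3000"
    using final
  proof
    assume "K = 0 \<and> card C \<le> 3000"
    thus ?thesis using card_mono[OF finite_C PC] by simp
  next
    assume "\<exists>k. K = Suc k \<and> ?n \<le> exp (b k / 2)"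
    then obtain k where k: "K = Suc k" "?n \<le> exp (b k / 2)" by blast
    have "real (card (Ps K)) * (G / ?n) \<le> Y K"
      unfolding Y_def X_def using R_pos PC
      by (simp add: sum.distrib) (auto intro!: sum_nonneg simp: less_imp_le subset_iff)
    also have "\<dots> \<le> 6 * exp (- b k / 2) * Y k" using fin(6) k(1) by simp
    also have "\<dots> \<le> 6 * exp (- b k / 2) * (4 * G)"
      using fin(7) k(1) Y0 by (intro mult_left_mono) auto
    also have "\<dots> \<le> 6 * (1 / ?n) * (4 * G)"
      using k(2) n G0 by (intro mult_right_mono mult_left_mono) (auto simp: exp_minus field_simps)
    finally have "real (card (Ps K)) \<le> 24" using n G0 by (simp add: field_simps)
    thus ?thesis by simp
  qed
  have costF: "(\<Sum>i\<in>F'. f i) \<le> (\<Sum>i\<in>Os K. f i) + 3000 * G"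
  proof -
    have "(\<Sum>i\<in>F'. f i) \<le> (\<Sum>i\<in>Os K. f i) + (\<Sum>i\<in>chp ` Ps K. f i)"
      unfolding F'_def using FE f_pos finP finO
      by (subst sum_Un) (auto intro!: sum_nonneg simp: less_imp_le subset_iff F'_def)
    also have "(\<Sum>i\<in>chp ` Ps K. f i) \<le> real (card (chp ` Ps K)) * G"
      using g gG FE by (intro sum_bounded_above) (force simp: F'_def)
    also have "\<dots> \<le> 3000 * G"
      using few card_image_le[OF finP, of chp] G0 by (intro mult_right_mono) linarith+
    finally show ?thesis by simp
  qed
  have conn: "(\<Sum>u\<in>served. Min ((\<lambda>i. d i u) ` F')) \<le> (\<Sum>u\<in>served - Ps K. Min ((\<lambda>i. d i u) ` Os K)) + 12 * G"
  proof -
    have "(\<Sum>u\<in>served. Min ((\<lambda>i. d i u) ` F'))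
        = (\<Sum>u\<in>served - Ps K. Min ((\<lambda>i. d i u) ` F')) + (\<Sum>u\<in>Ps K. Min ((\<lambda>i. d i u) ` F'))"
      using fin(1) finite_served by (rule sum.subset_diff)
    also have "(\<Sum>u\<in>served - Ps K. Min ((\<lambda>i. d i u) ` F')) \<le> (\<Sum>u\<in>served - Ps K. Min ((\<lambda>i. d i u) ` Os K))"
    proof (rule sum_mono)
      fix u assume "u \<in> served - Ps K"
      hence "Os K \<noteq> {}" using fin(3)[of u] by auto
      thus "Min ((\<lambda>i. d i u) ` F') \<le> Min ((\<lambda>i. d i u) ` Os K)"
        using finF by (intro Min_antimono) (auto simp: F'_def)
    qed
    also have "(\<Sum>u\<in>Ps K. Min ((\<lambda>i. d i u) ` F')) \<le> (\<Sum>u\<in>Ps K. 3 * X u)"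
    proof (rule sum_mono)
      fix u assume u: "u \<in> Ps K"
      have "Min ((\<lambda>i. d i u) ` F') \<le> d (chp u) u" using finF u by (intro Min_le) (auto simp: F'_def)
      also have "\<dots> \<le> 3 * X u" using dist_chp[of u] u PC RX[of u] by force
      finally show "Min ((\<lambda>i. d i u) ` F') \<le> 3 * X u" .
    qed
    also have "\<dots> = 3 * Y K" by (simp add: Y_def sum_distrib_left)
    finally show ?thesis using fin(4) Y0 by linarith
  qed
  have "0 \<le> Z K"
  proof -
    have "0 \<le> Y K" unfolding Y_def using PC X0 by (intro sum_nonneg) (auto simp: less_imp_le subset_iff)
    moreover have "0 \<le> b K"
      by (rule b(3))
    ultimately show ?thesis unfolding Z_def by (intro mult_nonneg_nonneg) auto
  qed
  moreover have "Z 0 \<le> 92 * (4 * G)"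
  proof -
    have "Z 0 \<le> (3 * b 0 + 44) * (4 * G)"
      unfolding Z_def using b(3)[of 0] Y0 by (simp add: mult_left_mono)
    also have "\<dots> \<le> 92 * (4 * G)" using b(4) G0 by (intro mult_right_mono) auto
    finally show ?thesis .
  qed
  \<comment> \<open>The phases cost \<open>2 * Z 0 \<le> 736 * G\<close>, the leftover clients 3000
    and 12 times \<open>G\<close>.\<close>
  ultimately show "(\<Sum>i\<in>F'. f i) + (\<Sum>u\<in>served. Min ((\<lambda>i. d i u) ` F')) \<le> 4000 * G"
    using fin(5) costF conn G0 by linarith
qed

end

section \<open>Rounded radii\<close>

definition grid :: "nat \<Rightarrow> nat \<Rightarrow> real" where "grid L e = 2 ^ e / 2 ^ L"

definition round_up :: "nat \<Rightarrow> real \<Rightarrow> real" where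
  "round_up L x = grid L (LEAST e. x \<le> grid L e)"

definition grid_radius :: "nat \<Rightarrow> nat set \<Rightarrow> (nat \<Rightarrow> real) \<Rightarrow> real \<Rightarrow> real" where
  "grid_radius L C \<delta> c = grid L (LEAST e. c \<le> real (card {j\<in>C. \<delta> j \<le> grid L e}) * grid L e)"

text \<open>The full ball may hold far more clients than needed; it is cut down to the number of
  shares \<open>r\<close> that pay \<open>c\<close>. The facility alone chooses which.\<close>

definition funding_ball :: "nat set \<Rightarrow> (nat \<Rightarrow> real) \<Rightarrow> real \<Rightarrow> real \<Rightarrow> nat set" where
  "funding_ball C \<delta> c r = (SOME S. S \<subseteq> {j\<in>C. \<delta> j \<le> r} \<and> card S = nat \<lceil>c / r\<rceil>)"

lemma grid_pos [simp]: "0 < grid L e"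
  by (simp add: grid_def)

lemma grid_mono: "e \<le> e' \<Longrightarrow> grid L e \<le> grid L e'"
  by (simp add: grid_def divide_right_mono)

lemma grid_Suc: "grid L (Suc e) = 2 * grid L e"
  by (simp add: grid_def)

lemma round_up:
  assumes "x \<le> grid L m" "grid L 0 < x"
  shows "\<exists>e\<le>m. round_up L x = grid L e" "x \<le> round_up L x" "round_up L x \<le> 2 * x"
proof -
  define e where "e = (LEAST e. x \<le> grid L e)"
  have e: "x \<le> grid L e" "e \<le> m" unfolding e_def using assms(1) by (auto intro: LeastI Least_le)
  moreover obtain e' where e': "e = Suc e'" using e(1) assms(2) by (cases e) auto
  have "\<not> x \<le> grid L e'" using e' unfolding e_def by (metis lessI not_less_Least)
  ultimately show "\<exists>e\<le>m. round_up L x = grid L e" "x \<le> round_up L x" "round_up L x \<le> 2 * x"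
    unfolding round_up_def e_def[symmetric] by (auto simp: e' grid_Suc)
qed

text \<open>The last claim is minimality of the exponent: the next smaller grid value is
  \<open>r / 2\<close> and does not pay. It exists since \<open>small\<close> excludes exponent
  0.\<close>

lemma grid_radius:
  assumes C: "finite C" "C \<noteq> {}" and far: "\<And>j. j \<in> C \<Longrightarrow> \<delta> j \<le> grid L m" and c: "c \<le> grid L m"
    and small: "real (card C) * grid L 0 < c"
  defines "r \<equiv> grid_radius L C \<delta> c"
  shows "\<exists>e\<le>m. r = grid L e" "c \<le> real (card {j\<in>C. \<delta> j \<le> r}) * r"
    "real (card {j\<in>C. \<delta> j \<le> r / 2}) * (r / 2) \<le> c"
proof -
  let ?Q = "\<lambda>e. c \<le> real (card {j\<in>C. \<delta> j \<le> grid L e}) * grid L e"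
  define e where "e = (LEAST e. ?Q e)"
  have "{j\<in>C. \<delta> j \<le> grid L m} = C" using far by auto
  moreover have "c \<le> real (card C) * grid L m"
  proof (rule order_trans[OF c])
    have "1 * grid L m \<le> real (card C) * grid L m"
      using C by (intro mult_right_mono) (auto simp: Suc_le_eq card_gt_0_iff less_imp_le)
    thus "grid L m \<le> real (card C) * grid L m" by simp
  qed
  ultimately have Qm: "?Q m" by simp
  have e: "?Q e" unfolding e_def by (rule LeastI[of ?Q, OF Qm])
  have em: "e \<le> m" unfolding e_def by (rule Least_le[of ?Q, OF Qm])
  have "real (card {j\<in>C. \<delta> j \<le> grid L 0}) * grid L 0 \<le> real (card C) * grid L 0"
    using C by (intro mult_right_mono) (auto intro!: card_mono simp: less_imp_le)
  hence "\<not> ?Q 0" using small by linarith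
  hence "e \<noteq> 0" using e by (intro notI) simp
  then obtain e' where e': "e = Suc e'" by (cases e) auto
  have "\<not> ?Q e'" using e' unfolding e_def by (metis (no_types, lifting) lessI not_less_Least)
  moreover have r: "r = grid L e" unfolding r_def grid_radius_def e_def ..
  moreover have "grid L e' = r / 2" using r e' by (simp add: grid_Suc)
  ultimately show "\<exists>e\<le>m. r = grid L e" "c \<le> real (card {j\<in>C. \<delta> j \<le> r}) * r"
    "real (card {j\<in>C. \<delta> j \<le> r / 2}) * (r / 2) \<le> c"
    using e em by auto
qed

lemma funding_ball:
  assumes C: "finite C" and r: "0 < r" and c: "0 < c" and le: "c \<le> real (card {j\<in>C. \<delta> j \<le> r}) * r"
  defines "S \<equiv> funding_ball C \<delta> c r"
  shows "S \<subseteq> {j\<in>C. \<delta> j \<le> r}" "c \<le> real (card S) * r" "real (card S) * r \<le> c + r"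
proof -
  have "c / r \<le> real (card {j\<in>C. \<delta> j \<le> r})" using r le by (simp add: field_simps)
  hence "nat \<lceil>c / r\<rceil> \<le> card {j\<in>C. \<delta> j \<le> r}" by simp
  from obtain_subset_with_card_n[OF this] have "\<exists>S. S \<subseteq> {j\<in>C. \<delta> j \<le> r} \<and> card S = nat \<lceil>c / r\<rceil>" by metis
  from someI_ex[OF this] have S: "S \<subseteq> {j\<in>C. \<delta> j \<le> r}" "card S = nat \<lceil>c / r\<rceil>"
    unfolding S_def funding_ball_def by auto
  show "S \<subseteq> {j\<in>C. \<delta> j \<le> r}" by fact
  have "0 < c / r" using r c by simp
  hence "real (card S) = of_int \<lceil>c / r\<rceil>" using S(2) by (simp add: of_nat_nat less_imp_le)
  hence "c / r \<le> real (card S)" "real (card S) \<le> c / r + 1" by linarith+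
  thus "c \<le> real (card S) * r" "real (card S) * r \<le> c + r" using r by (simp_all add: field_simps)
qed

text \<open>A function of \<open>C\<close> and \<open>R\<close> only, so all nodes knowing the
  reaches visit the clients in the same order, however ties are broken.\<close>

definition enumeration :: "nat set \<Rightarrow> (nat \<Rightarrow> real) \<Rightarrow> nat \<Rightarrow> nat" where
  "enumeration C R = (SOME e. bij_betw e {..<card C} C \<and> (\<forall>k l. k \<le> l \<longrightarrow> l < card C \<longrightarrow> R (e k) \<le> R (e l)))"

lemma enumeration:
  assumes "finite C"
  shows "bij_betw (enumeration C R) {..<card C} C"
    and "k \<le> l \<Longrightarrow> l < card C \<Longrightarrow> R (enumeration C R k) \<le> R (enumeration C R l)"
proof -
  define xs where "xs = sort_key R (sorted_list_of_set C)"
  have xs: "set xs = C" "distinct xs" "length xs = card C" "sorted (map R xs)"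
    using assms by (simp_all add: xs_def)
  have "bij_betw (\<lambda>k. xs ! k) {..<card C} C" using xs by (metis bij_betw_nth)
  moreover have "R (xs ! k) \<le> R (xs ! l)" if "k \<le> l" "l < card C" for k l
    using sorted_nth_mono[OF xs(4), of k l] that xs(3) by simp
  ultimately have "\<exists>e. bij_betw e {..<card C} C \<and> (\<forall>k l. k \<le> l \<longrightarrow> l < card C \<longrightarrow> R (e k) \<le> R (e l))"
    by blast
  from someI_ex[OF this]
  show "bij_betw (enumeration C R) {..<card C} C"
    "k \<le> l \<Longrightarrow> l < card C \<Longrightarrow> R (enumeration C R k) \<le> R (enumeration C R l)"
    unfolding enumeration_def by blast+
qed

lemma representable_mono:
  assumes "representable k x" "k \<le> k'"
  shows "representable k' x"
proof -
  have "(2::nat) ^ k \<le> 2 ^ k'" using assms(2) by (intro power_increasing) auto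
  moreover obtain a b :: nat where "a < 2 ^ k" "0 < b" "b < 2 ^ k" "x = real a / real b"
    using assms(1) unfolding representable_def by blast
  ultimately show ?thesis
    unfolding representable_def by (intro exI[of _ a] exI[of _ b]) linarith
qed

lemma representable_bounds:
  assumes "representable k x"
  shows "0 \<le> x" "x \<le> 2 ^ k" "x \<noteq> 0 \<Longrightarrow> 1 / 2 ^ k \<le> x"
proof -
  obtain a b :: nat where ab: "a < 2 ^ k" "0 < b" "b < 2 ^ k" "x = real a / real b"
    using assms by (auto simp: representable_def)
  have a: "real a \<le> 2 ^ k" "real b \<le> 2 ^ k" 
    using ab(1,3) by (metis numeral_power_le_of_nat_cancel_iff of_nat_le_numeral_power_cancel_iff less_imp_le)+
  show "0 \<le> x" using ab by simp
  have "real a / real b \<le> real a / 1" using ab by (intro divide_left_mono) auto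
  thus "x \<le> 2 ^ k" using a(1) unfolding ab(4) by linarith
  assume "x \<noteq> 0"
  hence "1 \<le> real a" using ab by (cases a) auto
  hence "1 / 2 ^ k \<le> real a / real b" using a ab by (intro frac_le) auto
  thus "1 / 2 ^ k \<le> x" using ab by simp
qed

lemma representable_0: "0 < k \<Longrightarrow> representable k 0"
  unfolding representable_def by (rule exI[of _ 0], rule exI[of _ 1]) (simp add: one_less_power del: One_nat_def)

lemma representable_grid:
  assumes "e \<le> 2 * L"
  shows "representable (2 * L + 1) (grid L e)"
proof -
  have "2 ^ e < (2::nat) ^ (2 * L + 1)" "2 ^ L < (2::nat) ^ (2 * L + 1)"
    using assms by (intro power_strict_increasing, simp, simp)+
  thus ?thesis unfolding representable_def grid_def by (intro exI[of _ "2 ^ e"] exI[of _ "2 ^ L"]) auto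
qed

lemma card_representable: "finite {x. representable k x}" "card {x. representable k x} \<le> 4 ^ k"
proof -
  have sub: "{x. representable k x} \<subseteq> (\<lambda>(a, b). real a / real b) ` ({..<2 ^ k} \<times> {..<2 ^ k})"
  proof
    fix x assume "x \<in> {x. representable k x}"
    then obtain a b where "a < 2 ^ k" "b < 2 ^ k" "x = real a / real b"
      unfolding representable_def by blast
    thus "x \<in> (\<lambda>(a, b). real a / real b) ` ({..<2 ^ k} \<times> {..<2 ^ k})"
      by (intro image_eqI[of _ _ "(a, b)"]) auto
  qed
  thus "finite {x. representable k x}" by (rule finite_subset) simp
  have "card {x. representable k x} \<le> card ((\<lambda>(a, b). real a / real b) ` ({..<2 ^ k::nat} \<times> {..<2 ^ k::nat}))"
    using sub by (intro card_mono) auto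
  also have "\<dots> \<le> card ({..<2 ^ k::nat} \<times> {..<2 ^ k::nat})" by (intro card_image_le) simp
  also have "\<dots> = 4 ^ k" by (simp add: card_cartesian_product flip: power_mult_distrib)
  finally show "card {x. representable k x} \<le> 4 ^ k" .
qed

section \<open>Congruence rules: dependence only on values at actual facilities and clients\<close>

lemma subset_min_cong:
  assumes "\<And>j. j \<in> C \<Longrightarrow> R j = R' j"
  shows "subset_min C R p = subset_min C R' p"
proof -
  have "sum R ` {S. S \<subseteq> C \<and> card S = p} = sum R' ` {S. S \<subseteq> C \<and> card S = p}"
    using assms by (intro image_cong sum.cong) auto
  thus ?thesis by (simp add: subset_min_def)
qed

lemma reach_cong: "(\<And>i. i \<in> E \<Longrightarrow> \<delta> i = \<delta>' i) \<Longrightarrow> reach E r \<delta> = reach E r \<delta>'"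
  unfolding reach_def by (simp cong: image_cong_simp)

lemma target_cong:
  assumes "\<And>i. i \<in> E \<Longrightarrow> \<delta> i = \<delta>' i"
  shows "target E r \<delta> = target E r \<delta>'"
proof -
  have "(\<lambda>i. i \<in> E \<and> 2 * r i + \<delta> i = reach E r \<delta>) = (\<lambda>i. i \<in> E \<and> 2 * r i + \<delta>' i = reach E r \<delta>')"
    using assms reach_cong[OF assms] by auto
  thus ?thesis unfolding target_def by simp
qed

lemma cheapest_cong:
  assumes "\<And>i. i \<in> E \<Longrightarrow> \<delta> i = \<delta>' i"
  shows "cheapest E f r \<delta> = cheapest E f r \<delta>'"
proof -
  have "(\<lambda>i. i \<in> E \<and> 2 * r i + \<delta> i \<le> 3 * reach E r \<delta>) = (\<lambda>i. i \<in> E \<and> 2 * r i + \<delta>' i \<le> 3 * reach E r \<delta>')"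
    using assms reach_cong[OF assms] by auto
  thus ?thesis unfolding cheapest_def by simp
qed

lemma is_hitting_family_cong:
  assumes "\<And>u. u \<in> P \<Longrightarrow> q u = q' u" "\<And>u. u \<in> P \<Longrightarrow> c u = c' u" "V = V'"
  shows "is_hitting_family P J q c V b H \<longleftrightarrow> is_hitting_family P J q' c' V' b H"
proof (cases "\<forall>x\<in>J. H x \<subseteq> P")
  case True
  have "(\<Sum>x\<in>J. \<Sum>u\<in>H x. c u) = (\<Sum>x\<in>J. \<Sum>u\<in>H x. c' u)"
    using True assms(2) by (intro sum.cong) auto
  moreover have "(\<Prod>u\<in>S. 1 - q u) = (\<Prod>u\<in>S. 1 - q' u)" if "S \<subseteq> P" for S
    using that assms(1) by (intro prod.cong) auto
  ultimately show ?thesis using assms(3) unfolding is_hitting_family_def by auto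
qed (auto simp: is_hitting_family_def)

lemma score_cong:
  assumes "\<And>u. u \<in> P \<Longrightarrow> \<tau> u = \<tau>' u" "\<And>u. u \<in> P \<Longrightarrow> X u = X' u" "cost = cost'"
    "\<And>i. i \<in> \<tau> ` P \<Longrightarrow> cnt i = cnt' i"
  shows "score P \<tau> X b cost cnt = score P \<tau>' X' b cost' cnt'"
proof -
  have im: "\<tau> ` P = \<tau>' ` P" using assms(1) by (intro image_cong) auto
  have "(\<Sum>j | j \<in> P \<and> \<tau> j = i. X j) = (\<Sum>j | j \<in> P \<and> \<tau>' j = i. X' j)" for i
    using assms(1,2) by (intro sum.cong) auto
  thus ?thesis unfolding score_def im[symmetric] assms(3)
    using assms(4) by (auto intro!: arg_cong2[where f="(+)"] arg_cong2[where f="(*)"] sum.cong)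
qed

lemma score_bound_cong:
  "(\<And>u. u \<in> P \<Longrightarrow> X u = X' u) \<Longrightarrow> score_bound P X b = score_bound P X' b"
  unfolding score_bound_def by (simp cong: sum.cong_simp)

section \<open>The algorithm\<close>

text \<open>What all nodes know when the phases start. The balls are deliberately absent; they stay
  with their facilities.\<close>

record plan =
  plan_reach :: "nat \<Rightarrow> real"
  plan_choice :: "nat \<Rightarrow> nat"
  plan_price :: "nat \<Rightarrow> real"
  plan_aim :: "nat \<Rightarrow> nat"
  plan_weight :: "nat \<Rightarrow> real"
  plan_members :: "nat set"

locale protocol =
  fixes F C :: "nat set" and p \<beta> \<nu> :: nat
  assumes finite_F: "finite F" and finite_C: "finite C" and card_F: "card F = card C"
    and p_pos: "1 \<le> p" and p_le: "p \<le> card C" and card_C: "card C \<le> 2 ^ \<nu>"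
begin

text \<open>Radii and estimates are powers of two between \<open>2 ^ - L\<close> and \<open>2 ^ L\<close>. Opening costs are
  raised to at least \<open>\<eta>\<close>, which is so small that it is negligible against the least positive
  cost \<open>2 ^ - \<beta>\<close> of a solution.\<close>

definition L :: nat where "L = \<beta> + 2 * \<nu> + 20"
definition \<eta> :: real where "\<eta> = 1 / 2 ^ (\<beta> + \<nu> + 17)"

definition valid :: "rfl_instance set" where
  "valid = {I. rfl_instance I \<and> facilities I = F \<and> clients I = C \<and> threshold I = p \<and> rfl_representable \<beta> I}"

definition price_of :: "knowledge \<Rightarrow> real" where
  "price_of k = max \<eta> (case own_cost k of None \<Rightarrow> 0 | Some x \<Rightarrow> x)"
definition radius_of :: "knowledge \<Rightarrow> real" where
  "radius_of k = grid_radius L C (dist_row k) (price_of k)"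
definition ball_of :: "knowledge \<Rightarrow> nat set" where
  "ball_of k = funding_ball C (dist_row k) (price_of k) (radius_of k)"

text \<open>Zero outside \<open>F\<close>, and likewise for the client functions below: nodes
  rebuild these functions from messages and must obtain equal functions, not merely equal relevant
  values.\<close>

definition fcost :: "rfl_instance \<Rightarrow> nat \<Rightarrow> real" where
  "fcost I i = (if i \<in> F then price_of (initial_knowledge I (Inl i)) else 0)"
definition frad :: "rfl_instance \<Rightarrow> nat \<Rightarrow> real" where
  "frad I i = (if i \<in> F then radius_of (initial_knowledge I (Inl i)) else 0)"
definition fball :: "rfl_instance \<Rightarrow> nat \<Rightarrow> nat set" where
  "fball I i = ball_of (initial_knowledge I (Inl i))"
definition row :: "rfl_instance \<Rightarrow> nat \<Rightarrow> nat \<Rightarrow> real" where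
  "row I j = dist_row (initial_knowledge I (Inr j))"

definition afford :: "(nat \<Rightarrow> real) \<Rightarrow> real \<Rightarrow> nat set" where
  "afford f g = {i\<in>F. f i \<le> g}"

text \<open>Up to constants, a lower bound for the solutions whose dearest facility is
  \<open>i\<close>, and the budget \<open>G\<close> of \<open>phases_cost\<close> for the guess
  \<open>fcost I i\<close>.\<close>

definition raw_est :: "rfl_instance \<Rightarrow> nat \<Rightarrow> real" where
  "raw_est I i = fcost I i + subset_min C (\<lambda>j. reach (afford (fcost I) (fcost I i)) (frad I) (row I j)) p"

definition guess :: "(nat \<Rightarrow> real) \<Rightarrow> (nat \<Rightarrow> real) \<Rightarrow> real" where
  "guess f est = f (SOME i. i \<in> F \<and> (\<forall>i'\<in>F. est i \<le> est i'))"

definition gcost :: "rfl_instance \<Rightarrow> real" where "gcost I = guess (fcost I) (\<lambda>i. round_up L (raw_est I i))"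
definition elig :: "rfl_instance \<Rightarrow> nat set" where "elig I = afford (fcost I) (gcost I)"

definition ctgt :: "rfl_instance \<Rightarrow> nat \<Rightarrow> nat" where
  "ctgt I j = (if j \<in> C then target (elig I) (frad I) (row I j) else 0)"
definition cchp :: "rfl_instance \<Rightarrow> nat \<Rightarrow> nat" where
  "cchp I j = (if j \<in> C then cheapest (elig I) (fcost I) (frad I) (row I j) else 0)"
definition creach :: "rfl_instance \<Rightarrow> nat \<Rightarrow> real" where
  "creach I j = (if j \<in> C then reach (elig I) (frad I) (row I j) else 0)"

text \<open>Unlike in \<open>idx\<close>, the search is limited to genuine positions
  \<open>l\<close>, whose targets are facilities that can report membership; \<open>cidx\<close>
  shows that the value is the same.\<close>

definition cidx :: "rfl_instance \<Rightarrow> nat \<Rightarrow> nat" where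
  "cidx I u = (if u \<in> C then LEAST l. l < card C \<and> (u = enumeration C (creach I) l \<or> u \<in> fball I (ctgt I (enumeration C (creach I) l))) else 0)"

definition make_plan ::
  "(nat \<Rightarrow> real) \<Rightarrow> real \<Rightarrow> (nat \<Rightarrow> nat) \<Rightarrow> (nat \<Rightarrow> nat) \<Rightarrow> (nat \<Rightarrow> real) \<Rightarrow> (nat \<Rightarrow> nat) \<Rightarrow> plan" where
  "make_plan f g t c R im =
    \<lparr>plan_reach = R, plan_choice = c, plan_price = (\<lambda>u. f (c u)),
     plan_aim = (\<lambda>u. t (enumeration C R (im u))),
     plan_weight = (\<lambda>u. R u + (g + subset_min C R p) / card C),
     plan_members = {u\<in>C. im u < (LEAST m. p \<le> card {u\<in>C. im u < m})}\<rparr>"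

definition the_plan :: "rfl_instance \<Rightarrow> plan" where
  "the_plan I = make_plan (fcost I) (gcost I) (ctgt I) (cchp I) (creach I) (cidx I)"

text \<open>Determined by the plan and the unserved set, so all nodes hold the same family without
  communication.\<close>

definition family :: "plan \<Rightarrow> real \<Rightarrow> nat set \<Rightarrow> nat \<times> nat \<Rightarrow> nat set" where
  "family S b P = (SOME H. is_hitting_family P (C \<times> C) (\<lambda>u. min 1 (b * plan_reach S u / plan_price S u))
     (plan_price S) (b * sum (plan_weight S) P) b H)"

text \<open>The ball \<open>D\<close> is a parameter because this is evaluated at the facility node
  owning it.\<close>

definition block_misses :: "plan \<Rightarrow> real \<Rightarrow> nat set \<Rightarrow> nat set \<Rightarrow> nat \<Rightarrow> nat" where
  "block_misses S b P D x = card {y\<in>C. D \<subseteq> P \<and> family S b P (x, y) \<inter> D = {}}"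
definition seed_misses :: "plan \<Rightarrow> real \<Rightarrow> nat set \<Rightarrow> nat set \<Rightarrow> nat \<Rightarrow> nat \<Rightarrow> nat" where
  "seed_misses S b P D x y = (if D \<subseteq> P \<and> family S b P (x, y) \<inter> D = {} then 1 else 0)"

definition good_block :: "plan \<Rightarrow> real \<Rightarrow> nat set \<Rightarrow> (nat \<Rightarrow> nat) \<Rightarrow> nat \<Rightarrow> bool" where
  "good_block S b P cnt x \<longleftrightarrow>
     score P (plan_aim S) (plan_weight S) b (\<Sum>y\<in>C. \<Sum>u\<in>family S b P (x, y). plan_price S u) cnt
       \<le> real (card C) * score_bound P (plan_weight S) b"
definition good_seed :: "plan \<Rightarrow> real \<Rightarrow> nat set \<Rightarrow> nat \<Rightarrow> (nat \<Rightarrow> nat) \<Rightarrow> nat \<Rightarrow> bool" where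
  "good_seed S b P x cnt y \<longleftrightarrow>
     score P (plan_aim S) (plan_weight S) b (\<Sum>u\<in>family S b P (x, y). plan_price S u) cnt
       \<le> score_bound P (plan_weight S) b"

definition pick :: "(nat \<Rightarrow> bool) \<Rightarrow> nat" where "pick Q = (SOME x. x \<in> C \<and> Q x)"

definition pick_block :: "rfl_instance \<Rightarrow> real \<Rightarrow> nat set \<Rightarrow> nat" where
  "pick_block I b P = pick (\<lambda>x. good_block (the_plan I) b P (\<lambda>i. block_misses (the_plan I) b P (fball I i) x) x)"
definition pick_seed :: "rfl_instance \<Rightarrow> real \<Rightarrow> nat set \<Rightarrow> nat" where
  "pick_seed I b P = pick (\<lambda>y. good_seed (the_plan I) b P (pick_block I b P)
     (\<lambda>i. seed_misses (the_plan I) b P (fball I i) (pick_block I b P) y) y)"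

definition sample :: "rfl_instance \<Rightarrow> real \<Rightarrow> nat set \<Rightarrow> nat set" where
  "sample I b P = family (the_plan I) b P (pick_block I b P, pick_seed I b P)"

primrec phases :: "(nat \<Rightarrow> real) \<Rightarrow> rfl_instance \<Rightarrow> nat \<Rightarrow> nat set \<times> nat set" where
  "phases b I 0 = (plan_members (the_plan I), {})"
| "phases b I (Suc k) =
     (let (P, Op) = phases b I k; Op' = Op \<union> plan_choice (the_plan I) ` sample I (b k) P
      in ({u\<in>P. \<forall>i\<in>Op'. 11 * 4 ^ Suc k * plan_reach (the_plan I) u < row I u i}, Op'))"

definition opened :: "(nat \<Rightarrow> real) \<Rightarrow> rfl_instance \<Rightarrow> nat \<Rightarrow> nat set" where
  "opened b I K = snd (phases b I K) \<union> plan_choice (the_plan I) ` fst (phases b I K)"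

section \<open>The computed quantities satisfy the assumptions of the locales\<close>

lemma C_ne: "C \<noteq> {}" using p_pos p_le by auto

lemma F_ne: "F \<noteq> {}" using card_F p_pos p_le by auto

lemma \<eta>_pos: "0 < \<eta>" by (simp add: \<eta>_def)

lemma \<eta>_le: "\<eta> \<le> 1" by (simp add: \<eta>_def)

lemma card_grid_less: "real (card C) * grid L 0 < \<eta>"
proof -
  have "real (card C) \<le> 2 ^ \<nu>" using card_C by (metis of_nat_le_iff of_nat_numeral of_nat_power)
  hence "real (card C) * grid L 0 \<le> 2 ^ \<nu> * (1 / 2 ^ L)" by (simp add: grid_def divide_right_mono)
  also have "\<dots> < \<eta>" by (simp add: L_def \<eta>_def power_add field_simps power_mult power2_eq_square)
  finally show ?thesis .
qed

lemma grid_0_less: "grid L 0 < \<eta>"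
proof -
  have "1 * grid L 0 \<le> real (card C) * grid L 0" using p_pos p_le by (intro mult_right_mono) (auto simp: less_imp_le)
  thus ?thesis using card_grid_less by linarith
qed

lemma grid_\<beta>: "grid L (L + \<beta>) = 2 ^ \<beta>"
  by (simp add: grid_def power_add)

lemma afford_sub: "afford f g \<subseteq> F" by (auto simp: afford_def)

context
  fixes I assumes I: "I \<in> valid"
begin

lemma inst: "rfl_instance I" "facilities I = F" "clients I = C" "threshold I = p" "rfl_representable \<beta> I"
  using I by (auto simp: valid_def)

lemma metric: "Metric_space (F \<union> C) (distance I)"
  using inst by (simp add: rfl_instance_def)

lemma representable_distance: "u \<in> F \<union> C \<Longrightarrow> v \<in> F \<union> C \<Longrightarrow> representable \<beta> (distance I u v)"
  using inst by (auto simp: rfl_representable_def)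

lemma representable_cost: "i \<in> F \<Longrightarrow> representable \<beta> (opening_cost I i)"
  using inst by (auto simp: rfl_representable_def)

lemma dist_sym: "distance I u v = distance I v u"
  using metric by (simp add: Metric_space.commute)

lemma row: "i \<in> F \<union> C \<Longrightarrow> row I j i = distance I i j"
  using inst by (simp add: row_def initial_knowledge_def)

lemma row_F: "u \<in> F \<union> C \<Longrightarrow> dist_row (initial_knowledge I (Inl i)) u = distance I i u"
  using inst dist_sym by (simp add: initial_knowledge_def)

lemma dist_bounds:
  assumes "u \<in> F \<union> C" "v \<in> F \<union> C"
  shows "0 \<le> distance I u v" "distance I u v \<le> 2 ^ \<beta>"
  using representable_bounds[OF representable_distance[OF assms]] by auto

lemma fcost:
  assumes "i \<in> F"
  shows "fcost I i = max \<eta> (opening_cost I i)" "\<eta> \<le> fcost I i" "fcost I i \<le> 2 ^ \<beta>" "opening_cost I i \<le> fcost I i"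
    "fcost I i \<le> opening_cost I i + \<eta>"
proof -
  show eq: "fcost I i = max \<eta> (opening_cost I i)" using assms by (simp add: fcost_def price_of_def initial_knowledge_def)
  have "\<eta> \<le> 2 ^ \<beta>" by (rule order_trans[OF \<eta>_le]) simp
  thus "\<eta> \<le> fcost I i" "fcost I i \<le> 2 ^ \<beta>" "opening_cost I i \<le> fcost I i" "fcost I i \<le> opening_cost I i + \<eta>"
    using \<eta>_le \<eta>_pos representable_bounds[OF representable_cost[OF assms]] unfolding eq by auto
qed

lemma radius:
  assumes i: "i \<in> F"
  shows "\<exists>e\<le>L + \<beta>. frad I i = grid L e" "fball I i \<subseteq> {j\<in>C. distance I i j \<le> frad I i}"
    "fcost I i \<le> real (card (fball I i)) * frad I i" "real (card (fball I i)) * frad I i \<le> fcost I i + frad I i"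
    "real (card {j\<in>C. distance I i j \<le> frad I i / 2}) * (frad I i / 2) \<le> fcost I i"
    "0 < frad I i" "frad I i \<le> 2 ^ \<beta>"
proof -
  let ?\<delta> = "dist_row (initial_knowledge I (Inl i))"
  have r: "frad I i = grid_radius L C ?\<delta> (fcost I i)" using i by (simp add: frad_def fcost_def radius_of_def)
  have B: "fball I i = funding_ball C ?\<delta> (fcost I i) (frad I i)" using i by (simp add: frad_def fcost_def fball_def ball_of_def)
  have set_eq: "{j\<in>C. ?\<delta> j \<le> x} = {j\<in>C. distance I i j \<le> x}" for x using row_F by auto
  have far: "?\<delta> j \<le> grid L (L + \<beta>)" if "j \<in> C" for j
    using that i row_F dist_bounds[of i j] grid_\<beta> by simp
  have c: "fcost I i \<le> grid L (L + \<beta>)" using fcost[OF i] grid_\<beta> by simp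
  have small: "real (card C) * grid L 0 < fcost I i" using fcost[OF i] card_grid_less by linarith
  note gr = grid_radius[where \<delta> = ?\<delta>, OF finite_C C_ne far c small]
  show ex: "\<exists>e\<le>L + \<beta>. frad I i = grid L e" unfolding r by (rule gr(1))
  thus r0: "0 < frad I i" "frad I i \<le> 2 ^ \<beta>" using grid_mono[of _ "L + \<beta>" L] grid_\<beta> by auto
  show "real (card {j\<in>C. distance I i j \<le> frad I i / 2}) * (frad I i / 2) \<le> fcost I i"
    using gr(3) by (simp only: r[symmetric] set_eq)
  have f0: "0 < fcost I i" using fcost(2)[OF i] \<eta>_pos by linarith
  have le: "fcost I i \<le> real (card {j\<in>C. ?\<delta> j \<le> frad I i}) * frad I i" using gr(2) by (simp only: r[symmetric])
  note fb = funding_ball[OF finite_C r0(1) f0 le, folded B]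
  show "fball I i \<subseteq> {j\<in>C. distance I i j \<le> frad I i}" using fb(1) by (simp only: set_eq)
  show "fcost I i \<le> real (card (fball I i)) * frad I i" "real (card (fball I i)) * frad I i \<le> fcost I i + frad I i"
    by (rule fb(2), rule fb(3))
qed

lemma facility_radii:
  assumes "i \<in> F" "fcost I i \<le> g"
  shows "facility_radii (afford (fcost I) g) C (distance I) (fcost I) (frad I) (fball I)"
proof
  fix x y z
  assume "x \<in> afford (fcost I) g \<union> C" "y \<in> afford (fcost I) g \<union> C" "z \<in> afford (fcost I) g \<union> C"
  thus "distance I x z \<le> distance I x y + distance I y z"
    by (intro Metric_space.triangle[OF metric]) (auto simp: afford_def)
next
  fix i assume i: "i \<in> afford (fcost I) g"
  hence iF: "i \<in> F" by (simp add: afford_def)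
  show "0 < fcost I i" using fcost(2)[OF iF] \<eta>_pos by linarith
  show "fball I i \<subseteq> C" using radius(2)[OF iF] by auto
  show "0 < frad I i" "fcost I i \<le> real (card (fball I i)) * frad I i"
    "real (card (fball I i)) * frad I i \<le> fcost I i + frad I i"
    "real (card {j\<in>C. distance I i j \<le> frad I i / 2}) * (frad I i / 2) \<le> fcost I i"
    by (fact radius(6)[OF iF], fact radius(3)[OF iF], fact radius(4)[OF iF], fact radius(5)[OF iF])
  fix u assume "u \<in> fball I i"
  thus "distance I i u \<le> frad I i" using radius(2)[OF iF] by blast
next
  fix x y
  show "distance I x y = distance I y x" by (rule dist_sym)
  assume "x \<in> afford (fcost I) g \<union> C" "y \<in> afford (fcost I) g \<union> C"
  thus "0 \<le> distance I x y" by (intro dist_bounds(1)) (auto simp: afford_def)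
qed (use assms finite_F finite_C in \<open>auto simp: afford_def\<close>)

lemma reach_row:
  assumes "E \<subseteq> F"
  shows "reach E r (row I j) = reach E r (\<lambda>i. distance I i j)"
    "target E r (row I j) = target E r (\<lambda>i. distance I i j)"
    "cheapest E f r (row I j) = cheapest E f r (\<lambda>i. distance I i j)"
proof -
  have "row I j i = distance I i j" if "i \<in> E" for i using that assms row by auto
  from reach_cong[OF this] target_cong[OF this] cheapest_cong[OF this]
  show "reach E r (row I j) = reach E r (\<lambda>i. distance I i j)"
    "target E r (row I j) = target E r (\<lambda>i. distance I i j)"
    "cheapest E f r (row I j) = cheapest E f r (\<lambda>i. distance I i j)"
    by simp_all
qed

lemma raw_est_bounds:
  assumes i: "i \<in> F"
  shows "\<eta> \<le> raw_est I i" "raw_est I i \<le> grid L (2 * L)"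
proof -
  interpret facility_radii "afford (fcost I) (fcost I i)" C "distance I" "fcost I" "frad I" "fball I"
    using facility_radii[OF i] by simp
  have R: "reach (afford (fcost I) (fcost I i)) (frad I) (row I j) = R j" for j
    unfolding R_def by (rule reach_row[OF afford_sub])
  obtain S where S: "S \<subseteq> C" "card S = p" "subset_min C R p = sum R S"
    using subset_min_obtain[OF finite_C p_le] by blast
  have "0 \<le> sum R S" using S R_pos by (intro sum_nonneg) (auto simp: less_imp_le subset_iff)
  thus "\<eta> \<le> raw_est I i" using fcost(2,3)[OF i] S(3) by (simp add: raw_est_def R)
  have "sum R S \<le> (\<Sum>j\<in>S. 3 * 2 ^ \<beta>)"
  proof (rule sum_mono)
    fix j assume "j \<in> S"
    hence j: "j \<in> C" using S by auto
    have "R j \<le> 2 * frad I i + distance I i j" using i by (intro R_le) (simp add: afford_def)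
    thus "R j \<le> 3 * 2 ^ \<beta>" using radius(7)[OF i] dist_bounds(2)[of i j] i j by auto
  qed
  also have "\<dots> = real p * (3 * 2 ^ \<beta>)" using S(2) by simp
  also have "\<dots> \<le> 2 ^ \<nu> * (3 * 2 ^ \<beta>)"
  proof (rule mult_right_mono)
    have "p \<le> 2 ^ \<nu>" using p_le card_C by (rule order_trans)
    hence "real p \<le> real (2 ^ \<nu>)" by (rule of_nat_mono)
    thus "real p \<le> 2 ^ \<nu>" by simp
  qed simp
  finally have "raw_est I i \<le> 2 ^ \<beta> + 2 ^ \<nu> * (3 * 2 ^ \<beta>)" using fcost(2,3)[OF i] S(3) by (simp add: raw_est_def R)
  also have "\<dots> \<le> 4 * (2 ^ \<nu> * 2 ^ \<beta>)" by simp
  also have "\<dots> = 2 ^ (\<nu> + \<beta> + 2)" by (simp add: power_add)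
  also have "\<dots> \<le> 2 ^ L" by (intro power_increasing) (auto simp: L_def)
  also have "\<dots> = grid L (2 * L)" by (simp add: grid_def mult_2 power_add)
  finally show "raw_est I i \<le> grid L (2 * L)" .
qed

lemma round_est:
  assumes i: "i \<in> F"
  shows "\<exists>e\<le>2 * L. round_up L (raw_est I i) = grid L e"
    "raw_est I i \<le> round_up L (raw_est I i)" "round_up L (raw_est I i) \<le> 2 * raw_est I i"
proof -
  have "grid L 0 < raw_est I i" using raw_est_bounds(1)[OF i] grid_0_less by linarith
  note ru = round_up[OF raw_est_bounds(2)[OF i] this]
  show "\<exists>e\<le>2 * L. round_up L (raw_est I i) = grid L e" by (rule ru)
  show "raw_est I i \<le> round_up L (raw_est I i)" "round_up L (raw_est I i) \<le> 2 * raw_est I i"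
    by (fact ru(2), fact ru(3))
qed

lemma gcost_guess:
  obtains i where "i \<in> F" "gcost I = fcost I i" "\<And>i'. i' \<in> F \<Longrightarrow> round_up L (raw_est I i) \<le> round_up L (raw_est I i')"
proof -
  have "\<exists>i. i \<in> F \<and> (\<forall>i'\<in>F. round_up L (raw_est I i) \<le> round_up L (raw_est I i'))"
    using finite_F F_ne arg_min_if_finite[of F "\<lambda>i. round_up L (raw_est I i)"] by (metis linorder_not_le)
  from someI_ex[OF this] show ?thesis by (intro that) (auto simp: gcost_def guess_def)
qed

lemma elig_radii: "facility_radii (elig I) C (distance I) (fcost I) (frad I) (fball I)"
proof (rule gcost_guess)
  fix i assume "i \<in> F" "gcost I = fcost I i"
  thus ?thesis unfolding elig_def by (intro facility_radii) auto
qed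

interpretation fr: facility_radii "elig I" C "distance I" "fcost I" "frad I" "fball I"
  by (rule elig_radii)

lemma elig_sub: "elig I \<subseteq> F" by (simp add: elig_def afford_sub)

lemma creach: "j \<in> C \<Longrightarrow> creach I j = fr.R j"
  and ctgt: "j \<in> C \<Longrightarrow> ctgt I j = fr.tgt j"
  and cchp: "j \<in> C \<Longrightarrow> cchp I j = fr.chp j"
  by (simp_all add: creach_def ctgt_def cchp_def fr.R_def fr.tgt_def fr.chp_def reach_row[OF elig_sub])

lemma enum_ordered: "ordered_clients (elig I) C (distance I) (fcost I) (frad I) (fball I) (enumeration C (creach I)) p"
proof (unfold_locales)
  show bij: "bij_betw (enumeration C (creach I)) {..<card C} C" by (rule enumeration[OF finite_C])
  fix k l assume "k \<le> l" "l < card C"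
  moreover have "enumeration C (creach I) k \<in> C" "enumeration C (creach I) l \<in> C"
    using bij calculation by (auto simp: bij_betw_def)
  ultimately show "fr.R (enumeration C (creach I) k) \<le> fr.R (enumeration C (creach I) l)"
    using enumeration(2)[OF finite_C, of k l "creach I"] creach by simp
qed (use p_pos p_le in auto)

interpretation oc: ordered_clients "elig I" C "distance I" "fcost I" "frad I" "fball I" "enumeration C (creach I)" p
  by (rule enum_ordered)

lemma cidx: "u \<in> C \<Longrightarrow> cidx I u = oc.idx u"
proof -
  let ?e = "enumeration C (creach I)"
  assume u: "u \<in> C"
  have "(LEAST l. l < card C \<and> (u = ?e l \<or> u \<in> fball I (ctgt I (?e l)))) = oc.idx u"
  proof (rule Least_equality)
    show "oc.idx u < card C \<and> (u = ?e (oc.idx u) \<or> u \<in> fball I (ctgt I (?e (oc.idx u))))"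
      using oc.idx[OF u] ctgt oc.e_in by auto
    fix l assume "l < card C \<and> (u = ?e l \<or> u \<in> fball I (ctgt I (?e l)))"
    thus "oc.idx u \<le> l" using ctgt oc.e_in by (intro oc.idx_le) auto
  qed
  thus ?thesis using u by (simp add: cidx_def)
qed

lemma cidx_less: "u \<in> C \<Longrightarrow> cidx I u < card C"
  using cidx oc.idx(1) by simp

lemma members: "plan_members (the_plan I) = oc.served"
proof -
  have "{u\<in>C. cidx I u < m} = oc.prefix m" for m
    unfolding oc.prefix_def by (intro Collect_cong conj_cong refl) (simp add: cidx)
  thus ?thesis by (simp add: the_plan_def make_plan_def oc.served_def oc.steps_def)
qed

lemma plan_simps:
  assumes "u \<in> C"
  shows "plan_reach (the_plan I) u = fr.R u" "plan_choice (the_plan I) u = fr.chp u"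
    "plan_price (the_plan I) u = fcost I (fr.chp u)" "plan_aim (the_plan I) u = oc.tau u"
    "plan_weight (the_plan I) u = fr.R u + (gcost I + subset_min C fr.R p) / card C"
proof -
  have "enumeration C (creach I) (oc.idx u) \<in> C" using oc.e_in[OF oc.idx(1)[OF assms]] .
  moreover have "subset_min C (creach I) p = subset_min C fr.R p" by (rule subset_min_cong) (rule creach)
  ultimately show "plan_reach (the_plan I) u = fr.R u" "plan_choice (the_plan I) u = fr.chp u"
    "plan_price (the_plan I) u = fcost I (fr.chp u)" "plan_aim (the_plan I) u = oc.tau u"
    "plan_weight (the_plan I) u = fr.R u + (gcost I + subset_min C fr.R p) / card C"
    using creach[OF assms] cchp[OF assms] cidx[OF assms] ctgt
    by (simp_all add: the_plan_def make_plan_def oc.tau_def)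
qed

end

end

section \<open>Approximation guarantee\<close>

lemma Min_image_in:
  assumes "finite A" "A \<noteq> {}"
  obtains a where "a \<in> A" "Min (g ` A) = g a"
proof -
  have "Min (g ` A) \<in> g ` A" using assms by (intro Min_in) auto
  thus ?thesis using that by auto
qed

context protocol
begin

context
  fixes I assumes I: "I \<in> valid"
begin

interpretation fr: facility_radii "elig I" C "distance I" "fcost I" "frad I" "fball I"
  by (rule elig_radii[OF I])

interpretation oc: ordered_clients "elig I" C "distance I" "fcost I" "frad I" "fball I" "enumeration C (creach I)" p
  by (rule enum_ordered[OF I])

text \<open>Take \<open>m\<close> as the dearest facility of \<open>F'\<close>: the guess
  \<open>fcost I m\<close> admits all of \<open>F'\<close>, so \<open>lower_bound\<close> gives
  \<open>raw_est I m \<le> (1 + 5) * cost\<close>. The announced guess has the least rounded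
  estimate, and rounding loses a factor 2.\<close>

lemma gcost_optimal:
  assumes C': "C' \<subseteq> C" "p \<le> card C'" and F': "F' \<subseteq> F" "F' \<noteq> {}"
  shows "gcost I + subset_min C fr.R p \<le> 12 * ((\<Sum>i\<in>F'. fcost I i) + (\<Sum>j\<in>C'. Min ((\<lambda>i. distance I i j) ` F')))"
proof -
  let ?cost = "(\<Sum>i\<in>F'. fcost I i) + (\<Sum>j\<in>C'. Min ((\<lambda>i. distance I i j) ` F'))"
  have fin: "finite F'" "finite C'" using C' F' finite_C finite_F by (auto intro: finite_subset)
  have f0: "0 \<le> fcost I i" if "i \<in> F'" for i using fcost(2)[OF I, of i] that F' \<eta>_pos by force
  have "Max (fcost I ` F') \<in> fcost I ` F'" using fin F' by (intro Max_in) auto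
  then obtain m where m: "m \<in> F'" "Max (fcost I ` F') = fcost I m" by auto
  have m_max: "fcost I i \<le> fcost I m" if "i \<in> F'" for i
    unfolding m(2)[symmetric] using that fin by (intro Max_ge) auto
  have mF: "m \<in> F" using m F' by auto
  interpret fm: facility_radii "afford (fcost I) (fcost I m)" C "distance I" "fcost I" "frad I" "fball I"
    using facility_radii[OF I mF] by simp
  obtain S where S: "S \<subseteq> C'" "card S = p" using obtain_subset_with_card_n[OF C'(2)] by metis
  have SC: "S \<subseteq> C" using S C' by auto
  have Min0: "0 \<le> Min ((\<lambda>i. distance I i j) ` F')" if "j \<in> C'" for j
  proof -
    obtain i where "i \<in> F'" "Min ((\<lambda>i. distance I i j) ` F') = distance I i j"
      by (rule Min_image_in[OF fin(1) F'(2)])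
    thus ?thesis using dist_bounds(1)[OF I, of i j] that C' F' by auto
  qed
  have "raw_est I m = fcost I m + subset_min C fm.R p"
    unfolding raw_est_def fm.R_def[abs_def] reach_row[OF I afford_sub] ..
  also have "\<dots> \<le> fcost I m + sum fm.R S" using subset_min_le[OF finite_C SC S(2)] by simp
  also have "sum fm.R S \<le> 5 * ((\<Sum>i\<in>F'. fcost I i) + (\<Sum>j\<in>S. Min ((\<lambda>i. distance I i j) ` F')))"
    using F' m_max SC by (intro fm.lower_bound) (auto simp: afford_def)
  also have "(\<Sum>j\<in>S. Min ((\<lambda>i. distance I i j) ` F')) \<le> (\<Sum>j\<in>C'. Min ((\<lambda>i. distance I i j) ` F'))"
    using S fin Min0 by (intro sum_mono2) auto
  also have "fcost I m \<le> ?cost"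
  proof -
    have "fcost I m \<le> (\<Sum>i\<in>F'. fcost I i)" using m(1) fin f0 by (intro member_le_sum) auto
    moreover have "0 \<le> (\<Sum>j\<in>C'. Min ((\<lambda>i. distance I i j) ` F'))" using Min0 by (intro sum_nonneg)
    ultimately show ?thesis by linarith
  qed
  finally have est: "raw_est I m \<le> 6 * ?cost" by simp
  obtain i where i: "i \<in> F" "gcost I = fcost I i"
    "\<And>i'. i' \<in> F \<Longrightarrow> round_up L (raw_est I i) \<le> round_up L (raw_est I i')"
    using gcost_guess[OF I] by metis
  have "gcost I + subset_min C fr.R p = raw_est I i"
    unfolding raw_est_def i(2)[symmetric] fr.R_def[abs_def] elig_def[symmetric] reach_row[OF I elig_sub[OF I]] ..
  also have "\<dots> \<le> round_up L (raw_est I i)" using round_est(2)[OF I i(1)] .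
  also have "\<dots> \<le> round_up L (raw_est I m)" using i(3)[OF mF] .
  also have "\<dots> \<le> 2 * raw_est I m" using round_est(3)[OF I mF] .
  finally show ?thesis using est by linarith
qed

lemma sample:
  fixes b :: real and P :: "nat set"
  defines "X \<equiv> \<lambda>u. fr.R u + (gcost I + subset_min C fr.R p) / card C"
  assumes P: "P \<subseteq> C" and b: "3 \<le> b" and size: "exp (b / 2) \<le> real (card C)"
  shows "sample I b P \<subseteq> P" "(\<Sum>u\<in>sample I b P. fcost I (fr.chp u)) \<le> 3 * b * sum X P"
    "(\<Sum>j | j \<in> P \<and> fball I (oc.tau j) \<subseteq> P \<and> fball I (oc.tau j) \<inter> sample I b P = {}. X j) \<le> 6 * exp (- b / 2) * sum X P"
proof -
  let ?S = "the_plan I"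
  define H where "H = family ?S b P"
  have "gcost I > 0"
  proof -
    obtain i where "i \<in> F" "gcost I = fcost I i" using gcost_guess[OF I] by metis
    thus ?thesis using fcost(2)[OF I, of i] \<eta>_pos by simp
  qed
  moreover have "0 \<le> subset_min C fr.R p"
  proof -
    obtain S where S: "S \<subseteq> C" "subset_min C fr.R p = sum fr.R S"
      by (rule subset_min_obtain[OF finite_C p_le])
    show ?thesis unfolding S(2)
    proof (rule sum_nonneg)
      fix u assume "u \<in> S"
      thus "0 \<le> fr.R u" using fr.R_pos[of u] S(1) by auto
    qed
  qed
  ultimately have RX: "fr.R u \<le> X u" for u by (simp add: X_def)
  have X0: "0 \<le> X u" if "u \<in> C" for u using RX[of u] fr.R_pos[OF that] by linarith
  have plan: "plan_reach ?S u = fr.R u" "plan_choice ?S u = fr.chp u"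
    "plan_price ?S u = fcost I (fr.chp u)" "plan_aim ?S u = oc.tau u" "plan_weight ?S u = X u" if "u \<in> P" for u
    using plan_simps[OF I, of u] that P by (auto simp: X_def)
  have cong: "is_hitting_family P (C \<times> C) (\<lambda>u. min 1 (b * plan_reach ?S u / plan_price ?S u)) (plan_price ?S) (b * sum (plan_weight ?S) P) b H'
     \<longleftrightarrow> is_hitting_family P (C \<times> C) (oc.opening_prob b) (\<lambda>u. fcost I (fr.chp u)) (b * sum X P) b H'" for H'
    by (rule is_hitting_family_cong) (simp_all add: plan oc.opening_prob_def)
  have H: "is_hitting_family P (C \<times> C) (oc.opening_prob b) (\<lambda>u. fcost I (fr.chp u)) (b * sum X P) b H"
    using someI_ex[OF oc.hitting_family_exists[OF P RX b size]] unfolding H_def family_def cong .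
  have HP: "H (x, y) \<subseteq> P" if "x \<in> C" "y \<in> C" for x y using H that by (auto simp: is_hitting_family_def)
  let ?cnt = "\<lambda>x i. card {y\<in>C. fball I i \<subseteq> P \<and> H (x, y) \<inter> fball I i = {}}"
  let ?hit = "\<lambda>x y i. if fball I i \<subseteq> P \<and> H (x, y) \<inter> fball I i = {} then 1 else 0"
  have price: "(\<Sum>u\<in>H (x, y). plan_price ?S u) = (\<Sum>u\<in>H (x, y). fcost I (fr.chp u))" if "x \<in> C" "y \<in> C" for x y
    using HP[OF that] by (intro sum.cong) (auto simp: plan)
  have bound: "score_bound P (plan_weight ?S) b = score_bound P X b"
    by (rule score_bound_cong) (rule plan)
  have block: "good_block ?S b P (\<lambda>i. block_misses ?S b P (fball I i) x) x \<longleftrightarrow>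
      score P oc.tau X b (\<Sum>y\<in>C. \<Sum>u\<in>H (x, y). fcost I (fr.chp u)) (?cnt x) \<le> real (card C) * score_bound P X b"
    if x: "x \<in> C" for x
  proof -
    have "score P (plan_aim ?S) (plan_weight ?S) b (\<Sum>y\<in>C. \<Sum>u\<in>H (x, y). plan_price ?S u) (\<lambda>i. block_misses ?S b P (fball I i) x)
      = score P oc.tau X b (\<Sum>y\<in>C. \<Sum>u\<in>H (x, y). fcost I (fr.chp u)) (?cnt x)"
      using price[OF x] by (intro score_cong) (simp_all add: plan block_misses_def H_def)
    thus ?thesis by (simp add: good_block_def H_def[symmetric] bound)
  qed
  have seed: "good_seed ?S b P x (\<lambda>i. seed_misses ?S b P (fball I i) x y) y \<longleftrightarrow>
      score P oc.tau X b (\<Sum>u\<in>H (x, y). fcost I (fr.chp u)) (?hit x y) \<le> score_bound P X b"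
    if x: "x \<in> C" "y \<in> C" for x y
  proof -
    have "score P (plan_aim ?S) (plan_weight ?S) b (\<Sum>u\<in>H (x, y). plan_price ?S u) (\<lambda>i. seed_misses ?S b P (fball I i) x y)
      = score P oc.tau X b (\<Sum>u\<in>H (x, y). fcost I (fr.chp u)) (?hit x y)"
      using price[OF x] by (intro score_cong) (simp_all add: plan seed_misses_def H_def)
    thus ?thesis by (simp add: good_seed_def H_def[symmetric] bound)
  qed
  note pick = oc.hitting_family_pick[OF P X0 b H]
  have "\<exists>x. x \<in> C \<and> good_block ?S b P (\<lambda>i. block_misses ?S b P (fball I i) x) x"
    using pick(1) block by blast
  from someI_ex[OF this]
  have x: "pick_block I b P \<in> C" "good_block ?S b P (\<lambda>i. block_misses ?S b P (fball I i) (pick_block I b P)) (pick_block I b P)"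
    unfolding pick_block_def pick_def by blast+
  have "\<exists>y. y \<in> C \<and> good_seed ?S b P (pick_block I b P) (\<lambda>i. seed_misses ?S b P (fball I i) (pick_block I b P) y) y"
    using pick(2)[OF _ x(1)] x(2) block[OF x(1)] seed[OF x(1)] by blast
  from someI_ex[OF this]
  have y: "pick_seed I b P \<in> C"
    "good_seed ?S b P (pick_block I b P) (\<lambda>i. seed_misses ?S b P (fball I i) (pick_block I b P) (pick_seed I b P)) (pick_seed I b P)"
    unfolding pick_seed_def pick_def by blast+
  have sam: "sample I b P = H (pick_block I b P, pick_seed I b P)" by (simp add: sample_def H_def)
  show "sample I b P \<subseteq> P" unfolding sam by (rule HP[OF x(1) y(1)])
  show "(\<Sum>u\<in>sample I b P. fcost I (fr.chp u)) \<le> 3 * b * sum X P"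
    "(\<Sum>j | j \<in> P \<and> fball I (oc.tau j) \<subseteq> P \<and> fball I (oc.tau j) \<inter> sample I b P = {}. X j) \<le> 6 * exp (- b / 2) * sum X P"
    using pick(3)[OF _ x(1) y(1)] y(2) seed[OF x(1) y(1)] unfolding sam by blast+
qed

text \<open>A cost is a sum of nonnegative input numbers, minima being attained, and a nonzero input
  number is at least \<open>1 / 2 ^ \<beta>\<close>. This disposes of the additive error from
  raising the opening costs to \<open>\<eta>\<close>.\<close>

lemma cost_gap:
  assumes "rfl_feasible I (C', F')" "rfl_cost I (C', F') \<noteq> 0"
  shows "1 / 2 ^ \<beta> \<le> rfl_cost I (C', F')"
proof -
  have sub: "C' \<subseteq> C" "F' \<subseteq> F" "C' \<noteq> {} \<Longrightarrow> F' \<noteq> {}"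
    using assms(1) inst[OF I] by (auto simp: rfl_feasible_def)
  have fin: "finite C'" "finite F'" using sub finite_C finite_F by (auto intro: finite_subset)
  let ?m = "\<lambda>j. Min ((\<lambda>i. distance I i j) ` F')"
  have rep_m: "representable \<beta> (?m j)" if j: "j \<in> C'" for j
  proof -
    have "F' \<noteq> {}" using sub j by auto
    then obtain i where "i \<in> F'" "?m j = distance I i j"
      using Min_image_in[OF fin(2), of "\<lambda>i. distance I i j"] by blast
    thus ?thesis using representable_distance[OF I, of i j] j sub by auto
  qed
  have rep_f: "representable \<beta> (opening_cost I i)" if "i \<in> F'" for i
    using representable_cost[OF I] that sub by auto
  have pos: "0 \<le> (\<Sum>i\<in>F'. opening_cost I i)" "0 \<le> (\<Sum>j\<in>C'. ?m j)"
    using rep_m rep_f representable_bounds(1) by (auto intro!: sum_nonneg)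
  have "(\<exists>i\<in>F'. opening_cost I i \<noteq> 0) \<or> (\<exists>j\<in>C'. ?m j \<noteq> 0)"
  proof (rule ccontr)
    assume "\<not> ?thesis"
    hence "\<forall>i\<in>F'. opening_cost I i = 0" "\<forall>j\<in>C'. ?m j = 0" by blast+
    from sum.neutral[OF this(1)] sum.neutral[OF this(2)] show False
      using assms(2) by (simp add: rfl_cost_def)
  qed
  thus ?thesis
  proof
    assume "\<exists>i\<in>F'. opening_cost I i \<noteq> 0"
    then obtain i where i: "i \<in> F'" "opening_cost I i \<noteq> 0" by blast
    have "opening_cost I i \<le> (\<Sum>i\<in>F'. opening_cost I i)"
      using i(1) fin rep_f representable_bounds(1) by (intro member_le_sum) auto
    thus ?thesis using representable_bounds(3)[OF rep_f[OF i(1)] i(2)] pos by (simp add: rfl_cost_def)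
  next
    assume "\<exists>j\<in>C'. ?m j \<noteq> 0"
    then obtain j where j: "j \<in> C'" "?m j \<noteq> 0" by blast
    have "?m j \<le> (\<Sum>j\<in>C'. ?m j)"
      using j(1) fin rep_m representable_bounds(1) by (intro member_le_sum) auto
    thus ?thesis using representable_bounds(3)[OF rep_m[OF j(1)] j(2)] pos by (simp add: rfl_cost_def)
  qed
qed

lemma phases_approx:
  fixes b :: "nat \<Rightarrow> real"
  assumes b: "\<And>k. k < K \<Longrightarrow> 16 \<le> b k" "\<And>k. k < K \<Longrightarrow> b (Suc k) \<le> (b k)\<^sup>2" "\<And>k. 0 \<le> b k" "b 0 \<le> 16"
    and size: "\<And>k. k < K \<Longrightarrow> exp (b k / 2) \<le> real (card C)"
    and final: "K = 0 \<and> card C \<le> 3000 \<or> (\<exists>k. K = Suc k \<and> real (card C) \<le> exp (b k / 2))"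
  shows "rfl_approx_solution 48001 I (plan_members (the_plan I), opened b I K)"
proof -
  let ?S = "the_plan I" and ?G = "gcost I + subset_min C fr.R p"
  let ?A = "plan_members ?S" and ?O = "opened b I K"
  define Ps where "Ps k = fst (phases b I k)" for k
  define Os where "Os k = snd (phases b I k)" for k
  have Os_Suc: "Os (Suc k) = Os k \<union> plan_choice ?S ` sample I (b k) (Ps k)" for k
    by (simp add: Os_def Ps_def case_prod_beta Let_def)
  have Ps_Suc: "Ps (Suc k) = {u\<in>Ps k. \<forall>i\<in>Os (Suc k). 11 * 4 ^ Suc k * plan_reach ?S u < row I u i}" for k
    by (simp add: Os_def Ps_def case_prod_beta Let_def)
  have PC: "Ps k \<subseteq> C" for k
  proof (induction k)
    case 0
    show ?case using oc.served_sub by (simp add: Ps_def members[OF I])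
  qed (auto simp: Ps_Suc)
  have choice: "plan_choice ?S ` P = fr.chp ` P" if "P \<subseteq> C" for P
    using that plan_simps(2)[OF I] by (intro image_cong) auto
  have sam: "sample I (b k) (Ps k) \<subseteq> Ps k" if "k < K" for k
    using sample(1)[OF PC _ size[OF that]] b(1)[OF that] by force
  have OE: "Os k \<subseteq> elig I" if "k \<le> K" for k
    using that
  proof (induction k)
    case (Suc k)
    have T: "sample I (b k) (Ps k) \<subseteq> C" using sam[of k] PC[of k] Suc.prems by auto
    show ?case using Suc fr.chp(1) T unfolding Os_Suc choice[OF T] by auto
  qed (simp add: Os_def)
  have fin_eq: "?O = Os K \<union> fr.chp ` Ps K"
    unfolding opened_def Os_def[symmetric] Ps_def[symmetric] choice[OF PC] ..
  have main: "?O \<subseteq> elig I" "?O \<noteq> {}"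
    "(\<Sum>i\<in>?O. fcost I i) + (\<Sum>u\<in>oc.served. Min ((\<lambda>i. distance I i u) ` ?O)) \<le> 4000 * ?G"
  proof -
    have g: "fcost I i \<le> gcost I" if "i \<in> elig I" for i using that by (simp add: elig_def afford_def)
    have start: "Ps 0 = oc.served" "Os 0 = {}" by (simp_all add: Ps_def Os_def members[OF I])
    have phase: "\<exists>T\<subseteq>Ps k.
          (\<Sum>u\<in>T. fcost I (fr.chp u)) \<le> 3 * b k * (\<Sum>u\<in>Ps k. fr.R u + ?G / card C) \<and>
          (\<Sum>j | j \<in> Ps k \<and> fball I (oc.tau j) \<subseteq> Ps k \<and> fball I (oc.tau j) \<inter> T = {}. fr.R j + ?G / card C)
            \<le> 6 * exp (- b k / 2) * (\<Sum>u\<in>Ps k. fr.R u + ?G / card C) \<and>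
          Os (Suc k) = Os k \<union> fr.chp ` T \<and>
          Ps (Suc k) = {u\<in>Ps k. \<forall>i\<in>Os (Suc k). 11 * 4 ^ Suc k * fr.R u < distance I i u}" if k: "k < K" for k
    proof (intro exI[of _ "sample I (b k) (Ps k)"] conjI)
      have b3: "3 \<le> b k" using b(1)[OF k] by simp
      note s = sample[OF PC b3 size[OF k]]
      show "sample I (b k) (Ps k) \<subseteq> Ps k" by (rule s)
      show "(\<Sum>u\<in>sample I (b k) (Ps k). fcost I (fr.chp u)) \<le> 3 * b k * (\<Sum>u\<in>Ps k. fr.R u + ?G / card C)"
        by (rule s)
      show "(\<Sum>j | j \<in> Ps k \<and> fball I (oc.tau j) \<subseteq> Ps k \<and> fball I (oc.tau j) \<inter> sample I (b k) (Ps k) = {}. fr.R j + ?G / card C)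
            \<le> 6 * exp (- b k / 2) * (\<Sum>u\<in>Ps k. fr.R u + ?G / card C)" by (rule s)
      show "Os (Suc k) = Os k \<union> fr.chp ` sample I (b k) (Ps k)"
        unfolding Os_Suc using choice[of "sample I (b k) (Ps k)"] s(1) PC[of k] by auto
      have "row I u i = distance I i u" if "i \<in> Os (Suc k)" for u i
        using that OE[of "Suc k"] k elig_sub[OF I] row[OF I, of i] by auto
      thus "Ps (Suc k) = {u\<in>Ps k. \<forall>i\<in>Os (Suc k). 11 * 4 ^ Suc k * fr.R u < distance I i u}"
        unfolding Ps_Suc using PC[of k] plan_simps(1)[OF I] by auto
    qed
    note pc = oc.phases_cost[of "gcost I" K b Ps Os, OF g b start phase final, folded fin_eq]
    show "?O \<subseteq> elig I" "?O \<noteq> {}"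
      "(\<Sum>i\<in>?O. fcost I i) + (\<Sum>u\<in>oc.served. Min ((\<lambda>i. distance I i u) ` ?O)) \<le> 4000 * ?G"
      using pc by blast+
  qed
  have OF: "?O \<subseteq> F" using main(1) elig_sub[OF I] by auto
  have feas: "rfl_feasible I (?A, ?O)"
    using OF main(2) oc.served_sub oc.steps(1) inst[OF I] by (auto simp: rfl_feasible_def members[OF I])
  have alg: "rfl_cost I (?A, ?O) \<le> 4000 * ?G"
  proof -
    have "(\<Sum>i\<in>?O. opening_cost I i) \<le> (\<Sum>i\<in>?O. fcost I i)" using OF fcost(4)[OF I] by (intro sum_mono) auto
    thus ?thesis using main(3) by (simp add: rfl_cost_def members[OF I])
  qed
  have finfeas: "finite {S. rfl_feasible I S}"
  proof (rule finite_subset)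
    show "{S. rfl_feasible I S} \<subseteq> Pow C \<times> Pow F" using inst[OF I] by (auto simp: rfl_feasible_def)
  qed (use finite_C finite_F in simp)
  obtain S where S: "S \<in> {S. rfl_feasible I S}" "rfl_opt I = rfl_cost I S"
    using Min_image_in[OF finfeas, of "rfl_cost I"] feas unfolding rfl_opt_def by blast
  obtain C' F' where CF: "S = (C', F')" by (cases S)
  have opt: "rfl_feasible I (C', F')" "rfl_opt I = rfl_cost I (C', F')" using S CF by auto
  have CF': "C' \<subseteq> C" "p \<le> card C'" "F' \<subseteq> F" "F' \<noteq> {}"
    using opt(1) inst[OF I] p_pos by (auto simp: rfl_feasible_def)
  have "?G \<le> 12 * ((\<Sum>i\<in>F'. fcost I i) + (\<Sum>j\<in>C'. Min ((\<lambda>i. distance I i j) ` F')))"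
    by (rule gcost_optimal[OF CF'])
  also have "(\<Sum>i\<in>F'. fcost I i) \<le> (\<Sum>i\<in>F'. opening_cost I i + \<eta>)"
    using CF'(3) fcost(5)[OF I] by (intro sum_mono) auto
  also have "\<dots> \<le> (\<Sum>i\<in>F'. opening_cost I i) + 2 ^ \<nu> * \<eta>"
  proof -
    have "card F' \<le> 2 ^ \<nu>" using card_mono[OF finite_F CF'(3)] card_F card_C by simp
    hence "real (card F') \<le> real (2 ^ \<nu>)" by (rule of_nat_mono)
    thus ?thesis using \<eta>_pos by (simp add: sum.distrib)
  qed
  finally have "?G \<le> 12 * (rfl_opt I + 2 ^ \<nu> * \<eta>)" unfolding opt(2) by (simp add: rfl_cost_def)
  \<comment> \<open>48000 is 4000 from the phases times 12 from the guess.\<close>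
  hence le: "rfl_cost I (?A, ?O) \<le> 48000 * rfl_opt I + 48000 * (2 ^ \<nu> * \<eta>)" using alg by argo
  \<comment> \<open>The 17 in \<open>\<eta>\<close> provides this, as \<open>48000 < 2 ^ 17\<close>.
    With optimum zero the cost falls below the least positive cost and so vanishes; otherwise one
    more multiple of the optimum covers the error.\<close>
  have small: "48000 * (2 ^ \<nu> * \<eta>) < 1 / 2 ^ \<beta>"
    by (simp add: \<eta>_def power_add field_simps)
  have "rfl_cost I (?A, ?O) \<le> 48001 * rfl_opt I"
  proof (cases "rfl_opt I = 0")
    case True
    hence "rfl_cost I (?A, ?O) < 1 / 2 ^ \<beta>" using le small by simp
    hence "rfl_cost I (?A, ?O) = 0" using cost_gap[OF feas] by fastforce
    thus ?thesis using True by simp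
  next
    case False
    hence "1 / 2 ^ \<beta> \<le> rfl_opt I" using cost_gap[OF opt(1)] opt(2) by simp
    thus ?thesis using le small by linarith
  qed
  thus ?thesis using feas by (simp add: rfl_approx_solution_def)
qed

end

end

section \<open>Message format and communication rounds\<close>

type_synonym msg = "nat \<times> nat \<times> real \<times> real"

abbreviation id1 :: "msg \<Rightarrow> nat" where "id1 m \<equiv> fst m"
abbreviation id2 :: "msg \<Rightarrow> nat" where "id2 m \<equiv> fst (snd m)"
abbreviation val1 :: "msg \<Rightarrow> real" where "val1 m \<equiv> fst (snd (snd m))"
abbreviation val2 :: "msg \<Rightarrow> real" where "val2 m \<equiv> snd (snd (snd m))"

abbreviation silent :: msg where "silent \<equiv> (0, 0, 0, 0)"

context protocol
begin

text \<open>One format for all rounds. The range \<open>{..card C}\<close> is for bits, positions in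
  the visiting order and miss counts.\<close>

definition msgs :: "msg set" where
  "msgs = (let ids = F \<union> C \<union> {..card C}; vals = {x. representable (2 * L + 1) x} in ids \<times> ids \<times> vals \<times> vals)"

text \<open>Two identifiers of \<open>\<nu> + 2\<close> bits and two fractions of
  \<open>4 * L + 2\<close> bits.\<close>

lemma msgs: "finite msgs" "card msgs \<le> 2 ^ (8 * \<beta> + 18 * \<nu> + 168)"
proof -
  let ?ids = "F \<union> C \<union> {..card C}" and ?vals = "{x. representable (2 * L + 1) x}"
  have fin: "finite ?ids" using finite_F finite_C by simp
  thus "finite msgs" unfolding msgs_def Let_def using card_representable(1)[of "2 * L + 1"] by simp
  have "card ?ids \<le> card F + card C + card {..card C}"
    by (meson add_le_mono card_Un_le le_trans order_refl)
  also have "\<dots> \<le> 4 * card C" using card_F p_pos p_le by simp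
  also have "\<dots> \<le> 2 ^ (\<nu> + 2)" using card_C by simp
  finally have ids: "card ?ids \<le> 2 ^ (\<nu> + 2)" .
  have vals: "card ?vals \<le> 2 ^ (4 * L + 2)"
  proof -
    have "(4::nat) ^ (2 * L + 1) = 2 ^ (4 * L + 2)"
      using power_mult[of "2::nat" 2 "2 * L + 1"] by (simp add: algebra_simps)
    thus ?thesis using card_representable(2)[of "2 * L + 1"] by simp
  qed
  have "card msgs = card ?ids * (card ?ids * (card ?vals * card ?vals))"
    unfolding msgs_def Let_def by (simp add: card_cartesian_product)
  also have "\<dots> \<le> 2 ^ (\<nu> + 2) * (2 ^ (\<nu> + 2) * (2 ^ (4 * L + 2) * 2 ^ (4 * L + 2)))"
    by (intro mult_le_mono ids vals)
  also have "\<dots> = 2 ^ (8 * \<beta> + 18 * \<nu> + 168)"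
    unfolding power_add[symmetric] by (rule arg_cong[of _ _ "\<lambda>k. 2 ^ k"]) (simp add: L_def)
  finally show "card msgs \<le> 2 ^ (8 * \<beta> + 18 * \<nu> + 168)" .
qed

lemma in_msgs:
  assumes "a \<in> F \<union> C \<union> {..card C}" "b \<in> F \<union> C \<union> {..card C}"
    "representable (2 * L + 1) x" "representable (2 * L + 1) y"
  shows "(a, b, x, y) \<in> msgs"
  using assms by (simp add: msgs_def Let_def)

lemma rep_0: "representable (2 * L + 1) 0" by (rule representable_0) simp

lemma id_in_msgs: "a \<le> card C \<Longrightarrow> (a, 0, 0, 0) \<in> msgs"
  by (intro in_msgs rep_0) auto

lemma silent_in_msgs: "silent \<in> msgs" by (rule id_in_msgs) simp

lemma bit_in_msgs: "(if Q then 1 else 0, 0, 0, 0) \<in> msgs"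
  by (rule id_in_msgs) (use p_pos p_le in auto)

lemma nodes: "I \<in> valid \<Longrightarrow> nodes I = F <+> C"
  by (simp add: nodes_def valid_def)

lemma Inl_in_nodes: "I \<in> valid \<Longrightarrow> Inl i \<in> nodes I \<longleftrightarrow> i \<in> F"
  and Inr_in_nodes: "I \<in> valid \<Longrightarrow> Inr j \<in> nodes I \<longleftrightarrow> j \<in> C"
  by (auto simp: nodes)

lemma rep_dist:
  assumes "I \<in> valid" "u \<in> F \<union> C" "v \<in> F \<union> C"
  shows "representable (2 * L + 1) (distance I u v)"
  using representable_distance[OF assms] by (rule representable_mono) (simp add: L_def)

lemma rep_fcost:
  assumes I: "I \<in> valid" and i: "i \<in> F"
  shows "representable (2 * L + 1) (fcost I i)"
proof -
  have "\<eta> = grid L (\<nu> + 3)" by (simp add: \<eta>_def grid_def L_def power_add field_simps power_mult power2_eq_square)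
  hence "representable (2 * L + 1) \<eta>" using representable_grid[of "\<nu> + 3" L] by (simp add: L_def)
  moreover have "representable (2 * L + 1) (opening_cost I i)"
    using representable_cost[OF I i] by (rule representable_mono) (simp add: L_def)
  ultimately show ?thesis unfolding fcost(1)[OF I i] by (simp add: max_def)
qed

lemma rep_frad:
  assumes I: "I \<in> valid" and i: "i \<in> F"
  shows "representable (2 * L + 1) (frad I i)"
proof -
  obtain e where "e \<le> L + \<beta>" "frad I i = grid L e" using radius(1)[OF I i] by blast
  thus ?thesis using representable_grid[of e L] by (simp add: L_def)
qed

lemma common_prices: "common_after valid msgs (Suc 0) (\<lambda>I. (fcost I, frad I))"
proof (rule common_after_broadcast[where c="\<lambda>_. ()" and
    m="\<lambda>k c. case self k of Inl i \<Rightarrow> (0, 0, price_of k, radius_of k) | Inr j \<Rightarrow> silent" and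
    f="\<lambda>c ms. (\<lambda>i. if i \<in> F then val1 (ms (Inl i)) else 0, \<lambda>i. if i \<in> F then val2 (ms (Inl i)) else 0)"])
  show "common_after valid msgs 0 (\<lambda>_. ())" by (rule common_after_const)
next
  fix I u assume I: "I \<in> valid" and u: "u \<in> nodes I"
  show "(case self (initial_knowledge I u) of
      Inl i \<Rightarrow> (0, 0, price_of (initial_knowledge I u), radius_of (initial_knowledge I u)) | Inr j \<Rightarrow> silent) \<in> msgs"
    using u rep_fcost[OF I] rep_frad[OF I] silent_in_msgs unfolding nodes[OF I]
    by (auto intro!: in_msgs simp: fcost_def frad_def split: sum.split)
qed (auto simp: nodes fcost_def frad_def fun_eq_iff)

lemma guess_cong: "(\<And>i. i \<in> F \<Longrightarrow> est i = est' i) \<Longrightarrow> guess f est = guess f est'"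
proof -
  assume "\<And>i. i \<in> F \<Longrightarrow> est i = est' i"
  hence "(\<lambda>i. i \<in> F \<and> (\<forall>i'\<in>F. est i \<le> est i')) = (\<lambda>i. i \<in> F \<and> (\<forall>i'\<in>F. est' i \<le> est' i'))" by auto
  thus ?thesis unfolding guess_def by simp
qed

lemma row_target:
  assumes I: "I \<in> valid" and j: "j \<in> C" and E: "E \<subseteq> F" "E \<noteq> {}"
  shows "target E r (row I j) \<in> F" "representable (2 * L + 1) (row I j (target E r (row I j)))"
    "2 * r (target E r (row I j)) + row I j (target E r (row I j)) = reach E r (row I j)"
proof -
  have "finite E" using E finite_F by (auto intro: finite_subset)
  note t = target_spec[OF this E(2), of r "row I j"]
  show "target E r (row I j) \<in> F" using t(1) E by auto
  thus "representable (2 * L + 1) (row I j (target E r (row I j)))"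
    using row[OF I] rep_dist[OF I] j by auto
  show "2 * r (target E r (row I j)) + row I j (target E r (row I j)) = reach E r (row I j)" by (rule t)
qed

text \<open>For each guess the client reports target and distance instead of the reach; the receiver
  adds twice the known radius, and only numbers of certified length are sent.\<close>

definition client_bid :: "knowledge \<Rightarrow> (nat \<Rightarrow> real) \<times> (nat \<Rightarrow> real) \<Rightarrow> node \<Rightarrow> msg" where
  "client_bid k c v = (case self k of Inl _ \<Rightarrow> silent | Inr j \<Rightarrow> (case v of Inr _ \<Rightarrow> silent | Inl i \<Rightarrow>
     (let t = target (afford (fst c) (fst c i)) (snd c) (dist_row k) in (t, 0, dist_row k t, 0))))"

text \<open>A sum of \<open>p\<close> reaches need not have a short exact representation; its
  rounding to a power of two does.\<close>

definition facility_est :: "knowledge \<Rightarrow> (nat \<Rightarrow> real) \<times> (nat \<Rightarrow> real) \<Rightarrow> (node \<Rightarrow> msg) \<Rightarrow> msg" where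
  "facility_est k c ms = (case self k of Inr _ \<Rightarrow> silent | Inl i \<Rightarrow>
     (0, 0, round_up L (fst c i + subset_min C (\<lambda>j. 2 * snd c (id1 (ms (Inr j))) + val1 (ms (Inr j))) p), 0))"

lemma client_bid:
  assumes I: "I \<in> valid" and i: "i \<in> F" and j: "j \<in> C"
  shows "client_bid (initial_knowledge I (Inr j)) (fcost I, frad I) (Inl i) \<in> msgs"
    "2 * frad I (id1 (client_bid (initial_knowledge I (Inr j)) (fcost I, frad I) (Inl i))) +
       val1 (client_bid (initial_knowledge I (Inr j)) (fcost I, frad I) (Inl i)) = reach (afford (fcost I) (fcost I i)) (frad I) (row I j)"
proof -
  have "afford (fcost I) (fcost I i) \<noteq> {}" using i by (auto simp: afford_def)
  note t = row_target[OF I j afford_sub this]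
  show "client_bid (initial_knowledge I (Inr j)) (fcost I, frad I) (Inl i) \<in> msgs"
    using t unfolding row_def by (auto simp: client_bid_def Let_def intro!: in_msgs rep_0)
  show "2 * frad I (id1 (client_bid (initial_knowledge I (Inr j)) (fcost I, frad I) (Inl i))) +
       val1 (client_bid (initial_knowledge I (Inr j)) (fcost I, frad I) (Inl i)) = reach (afford (fcost I) (fcost I i)) (frad I) (row I j)"
    using t(3)[of "frad I"] unfolding row_def by (simp add: client_bid_def Let_def)
qed

lemma facility_est:
  assumes I: "I \<in> valid" and i: "i \<in> F"
  shows "facility_est (initial_knowledge I (Inl i)) (fcost I, frad I)
      (\<lambda>u. if u \<in> nodes I then client_bid (initial_knowledge I u) (fcost I, frad I) (Inl i) else undefined)
    = (0, 0, round_up L (raw_est I i), 0)"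
proof -
  let ?ms = "\<lambda>u. if u \<in> nodes I then client_bid (initial_knowledge I u) (fcost I, frad I) (Inl i) else undefined"
  have "subset_min C (\<lambda>j. 2 * frad I (id1 (?ms (Inr j))) + val1 (?ms (Inr j))) p
     = subset_min C (\<lambda>j. reach (afford (fcost I) (fcost I i)) (frad I) (row I j)) p"
    by (rule subset_min_cong) (use client_bid(2)[OF I i] in \<open>simp add: Inr_in_nodes[OF I]\<close>)
  thus ?thesis by (simp add: facility_est_def raw_est_def)
qed

lemma common_guess: "common_after valid msgs (Suc (Suc (Suc 0))) (\<lambda>I. (fcost I, frad I, gcost I))"
proof (rule common_after_gather[OF common_prices, where m=client_bid and m'=facility_est and
    f="\<lambda>c ms. (fst c, snd c, guess (fst c) (\<lambda>i. val1 (ms (Inl i))))"])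
  fix I u v assume I: "I \<in> valid" and "u \<in> nodes I" "v \<in> nodes I"
  thus "client_bid (initial_knowledge I u) (fcost I, frad I) v \<in> msgs"
    using client_bid(1)[OF I] silent_in_msgs unfolding nodes[OF I]
    by (cases u; cases v) (auto simp: client_bid_def)
next
  fix I v assume I: "I \<in> valid" and v: "v \<in> nodes I"
  show "facility_est (initial_knowledge I v) (fcost I, frad I)
      (\<lambda>u. if u \<in> nodes I then client_bid (initial_knowledge I u) (fcost I, frad I) v else undefined) \<in> msgs"
  proof (cases v)
    case (Inl i)
    hence i: "i \<in> F" using v nodes[OF I] by auto
    obtain e where "e \<le> 2 * L" "round_up L (raw_est I i) = grid L e" using round_est(1)[OF I i] by blast
    thus ?thesis unfolding Inl facility_est[OF I i] using representable_grid[of e L] by (auto intro!: in_msgs rep_0)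
  next
    case (Inr j)
    thus ?thesis using silent_in_msgs by (simp add: facility_est_def)
  qed
next
  fix I assume I: "I \<in> valid"
  have "guess (fcost I) (\<lambda>i. round_up L (raw_est I i)) = guess (fcost I) (\<lambda>i. val1
     (if Inl i \<in> nodes I then facility_est (initial_knowledge I (Inl i)) (fcost I, frad I)
      (\<lambda>u. if u \<in> nodes I then client_bid (initial_knowledge I u) (fcost I, frad I) (Inl i) else undefined) else undefined))"
    by (rule guess_cong) (simp add: facility_est[OF I] Inl_in_nodes[OF I])
  thus "(fcost I, frad I, gcost I) = (fst (fcost I, frad I), snd (fcost I, frad I), guess (fst (fcost I, frad I)) (\<lambda>i. val1
     (if Inl i \<in> nodes I then facility_est (initial_knowledge I (Inl i)) (fcost I, frad I)
      (\<lambda>u. if u \<in> nodes I then client_bid (initial_knowledge I u) (fcost I, frad I) (Inl i) else undefined) else undefined)))"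
    by (simp add: gcost_def)
qed

lemma elig_ne: "I \<in> valid \<Longrightarrow> elig I \<noteq> {}"
  using facility_radii.E_ne[OF elig_radii] .

lemma ctgt_in:
  assumes "I \<in> valid" "j \<in> C"
  shows "ctgt I j \<in> F" "cchp I j \<in> F"
  using ctgt[OF assms] cchp[OF assms] facility_radii.tgt(1)[OF elig_radii[OF assms(1)]]
    facility_radii.chp(1)[OF elig_radii[OF assms(1)] assms(2)] elig_sub[OF assms(1)] by auto

lemma common_targets:
  "common_after valid msgs (Suc (Suc (Suc (Suc 0)))) (\<lambda>I. (fcost I, frad I, gcost I, ctgt I, cchp I, creach I))"
proof (rule common_after_broadcast[OF common_guess, where
    m="\<lambda>k (f, r, g). case self k of Inl _ \<Rightarrow> silent | Inr j \<Rightarrow>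
       (let E = afford f g; t = target E r (dist_row k) in (t, cheapest E f r (dist_row k), dist_row k t, 0))" and
    f="\<lambda>(f, r, g) ms. (f, r, g, \<lambda>j. if j \<in> C then id1 (ms (Inr j)) else 0,
       \<lambda>j. if j \<in> C then id2 (ms (Inr j)) else 0,
       \<lambda>j. if j \<in> C then 2 * r (id1 (ms (Inr j))) + val1 (ms (Inr j)) else 0)"])
  fix I u assume I: "I \<in> valid" and u: "u \<in> nodes I"
  show "(case (fcost I, frad I, gcost I) of (f, r, g) \<Rightarrow> case self (initial_knowledge I u) of Inl _ \<Rightarrow> silent | Inr j \<Rightarrow>
       (let E = afford f g; t = target E r (dist_row (initial_knowledge I u)) in
         (t, cheapest E f r (dist_row (initial_knowledge I u)), dist_row (initial_knowledge I u) t, 0))) \<in> msgs"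
  proof (cases u)
    case (Inr j)
    hence j: "j \<in> C" using u nodes[OF I] by auto
    show ?thesis
      using ctgt_in[OF I j] row_target[OF I j elig_sub[OF I] elig_ne[OF I], of "frad I"] j
      by (auto simp: Inr Let_def ctgt_def cchp_def elig_def[symmetric] row_def[symmetric] intro!: in_msgs rep_0)
  qed (simp add: silent_in_msgs)
next
  fix I assume I: "I \<in> valid"
  show "(fcost I, frad I, gcost I, ctgt I, cchp I, creach I) = (case (fcost I, frad I, gcost I) of (f, r, g) \<Rightarrow> \<lambda>ms. (f, r, g, \<lambda>j. if j \<in> C then id1 (ms (Inr j)) else 0,
       \<lambda>j. if j \<in> C then id2 (ms (Inr j)) else 0,
       \<lambda>j. if j \<in> C then 2 * r (id1 (ms (Inr j))) + val1 (ms (Inr j)) else 0))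
     (\<lambda>u. if u \<in> nodes I then (case (fcost I, frad I, gcost I) of (f, r, g) \<Rightarrow> case self (initial_knowledge I u) of Inl _ \<Rightarrow> silent | Inr j \<Rightarrow>
       (let E = afford f g; t = target E r (dist_row (initial_knowledge I u)) in
         (t, cheapest E f r (dist_row (initial_knowledge I u)), dist_row (initial_knowledge I u) t, 0))) else undefined)"
    using row_target(3)[OF I _ elig_sub[OF I] elig_ne[OF I], of _ "frad I"]
    by (auto simp: Let_def ctgt_def cchp_def creach_def elig_def[symmetric] row_def[symmetric] nodes[OF I] fun_eq_iff)
qed

text \<open>Order and targets are already common; only membership is missing. Each facility sends
  each client one bit, from which the client finds its step and announces it.\<close>

lemma common_plan: "common_after valid msgs 6 the_plan"
proof -
  let ?m = "\<lambda>k (c::(nat \<Rightarrow> real) \<times> (nat \<Rightarrow> real) \<times> real \<times> (nat \<Rightarrow> nat) \<times> (nat \<Rightarrow> nat) \<times> (nat \<Rightarrow> real)) (v :: node).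
     case self (k :: knowledge) of Inr _ \<Rightarrow> silent | Inl i \<Rightarrow> (case v of Inl _ \<Rightarrow> silent | Inr u \<Rightarrow> (if u \<in> ball_of k then 1 else 0, 0, 0, 0))"
  let ?m' = "\<lambda>k (f::nat \<Rightarrow> real, r::nat \<Rightarrow> real, g::real, t::nat \<Rightarrow> nat, c::nat \<Rightarrow> nat, R::nat \<Rightarrow> real) (ms::node \<Rightarrow> msg).
     case self (k :: knowledge) of Inl _ \<Rightarrow> silent | Inr u \<Rightarrow>
       (LEAST l. l < card C \<and> (u = enumeration C R l \<or> id1 (ms (Inl (t (enumeration C R l)))) = 1), 0::nat, 0::real, 0::real)"
  let ?c = "\<lambda>I. (fcost I, frad I, gcost I, ctgt I, cchp I, creach I)"
  have e_in: "enumeration C (creach I) l \<in> C" if "l < card C" for I l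
    using enumeration(1)[OF finite_C, of "creach I"] that by (auto simp: bij_betw_def)
  have m': "?m' (initial_knowledge I (Inr u)) (?c I)
      (\<lambda>w. if w \<in> nodes I then ?m (initial_knowledge I w) (?c I) (Inr u) else undefined) = (cidx I u, 0, 0, 0)"
    if I: "I \<in> valid" and u: "u \<in> C" for I u
  proof -
    let ?ms = "\<lambda>w. if w \<in> nodes I then ?m (initial_knowledge I w) (?c I) (Inr u) else undefined"
    have bit: "id1 (?ms (Inl (ctgt I (enumeration C (creach I) l)))) = 1 \<longleftrightarrow> u \<in> fball I (ctgt I (enumeration C (creach I) l))"
      if "l < card C" for l
      using ctgt_in(1)[OF I e_in[OF that]] by (simp add: Inl_in_nodes[OF I] fball_def)
    have "(\<lambda>l. l < card C \<and> (u = enumeration C (creach I) l \<or> id1 (?ms (Inl (ctgt I (enumeration C (creach I) l)))) = 1))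
       = (\<lambda>l. l < card C \<and> (u = enumeration C (creach I) l \<or> u \<in> fball I (ctgt I (enumeration C (creach I) l))))"
      using bit by blast
    thus ?thesis using u by (simp only: prod.case self_initial_knowledge sum.case cidx_def if_True)
  qed
  have "common_after valid msgs (Suc (Suc (Suc (Suc (Suc (Suc 0)))))) the_plan"
  proof (rule common_after_gather[OF common_targets, where m="?m" and m'="?m'" and
      f="\<lambda>(f, r, g, t, c, R) ms. make_plan f g t c R (\<lambda>u. if u \<in> C then id1 (ms (Inr u)) else 0)"])
    fix I u v
    show "?m (initial_knowledge I u) (?c I) v \<in> msgs"
      using silent_in_msgs bit_in_msgs by (auto split: sum.split)
  next
    fix I v assume I: "I \<in> valid" and v: "v \<in> nodes I"
    show "?m' (initial_knowledge I v) (?c I) (\<lambda>w. if w \<in> nodes I then ?m (initial_knowledge I w) (?c I) v else undefined) \<in> msgs"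
    proof (cases v)
      case (Inr u)
      hence u: "u \<in> C" using v nodes[OF I] by auto
      show ?thesis unfolding Inr m'[OF I u] using cidx_less[OF I u] by (intro id_in_msgs) simp
    qed (simp add: silent_in_msgs)
  next
    fix I assume I: "I \<in> valid"
    have "cidx I = (\<lambda>u. if u \<in> C then id1 (if Inr u \<in> nodes I then ?m' (initial_knowledge I (Inr u)) (?c I)
      (\<lambda>w. if w \<in> nodes I then ?m (initial_knowledge I w) (?c I) (Inr u) else undefined) else undefined) else 0)"
    proof (rule ext)
      fix u show "cidx I u = (if u \<in> C then id1 (if Inr u \<in> nodes I then ?m' (initial_knowledge I (Inr u)) (?c I)
      (\<lambda>w. if w \<in> nodes I then ?m (initial_knowledge I w) (?c I) (Inr u) else undefined) else undefined) else 0)"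
      proof (cases "u \<in> C")
        case True
        hence "Inr u \<in> nodes I" using nodes[OF I] by auto
        thus ?thesis using True by (simp only: m'[OF I True] if_True fst_conv)
      qed (simp add: cidx_def)
    qed
    thus "the_plan I = (case ?c I of (f, r, g, t, c, R) \<Rightarrow> \<lambda>ms. make_plan f g t c R (\<lambda>u. if u \<in> C then id1 (ms (Inr u)) else 0))
     (\<lambda>v. if v \<in> nodes I then ?m' (initial_knowledge I v) (?c I)
       (\<lambda>w. if w \<in> nodes I then ?m (initial_knowledge I w) (?c I) v else undefined) else undefined)"
      unfolding the_plan_def by (simp only: prod.case)
  qed
  thus ?thesis by (simp add: eval_nat_numeral)
qed

lemma pick_cong: "(\<And>x. x \<in> C \<Longrightarrow> Q x \<longleftrightarrow> Q' x) \<Longrightarrow> pick Q = pick Q'"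
  unfolding pick_def by (intro arg_cong[where f=Eps] ext) auto

text \<open>Facility \<open>i\<close> sends the count for its own ball and candidate
  \<open>x\<close> to the node of client \<open>x\<close>, which judges that one candidate and
  announces a bit. The assumption on \<open>good\<close> reflects that counts arrive from actual
  facilities only.\<close>

lemma common_pick:
  assumes c: "common_after valid msgs t c"
    and cnt: "\<And>a D x. cnt a D x \<le> card C"
    and good: "\<And>I h h' x. I \<in> valid \<Longrightarrow> (\<And>i. i \<in> F \<Longrightarrow> h i = h' i) \<Longrightarrow> good (c I) h x \<longleftrightarrow> good (c I) h' x"
  shows "common_after valid msgs (Suc (Suc t)) (\<lambda>I. (c I, pick (\<lambda>x. good (c I) (\<lambda>i. cnt (c I) (fball I i) x) x)))"
proof -
  let ?m = "\<lambda>(k::knowledge) a (v::node). case self k of Inr _ \<Rightarrow> silent | Inl i \<Rightarrow>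
     (case v of Inl _ \<Rightarrow> silent | Inr x \<Rightarrow> (cnt a (ball_of k) x, 0, 0, 0))"
  let ?m' = "\<lambda>(k::knowledge) a (ms::node \<Rightarrow> msg). case self k of Inl _ \<Rightarrow> silent | Inr x \<Rightarrow>
     (if good a (\<lambda>i. id1 (ms (Inl i))) x then 1::nat else 0, 0::nat, 0::real, 0::real)"
  show ?thesis
  proof (rule common_after_gather[OF c, where m="?m" and m'="?m'" and f="\<lambda>a ms. (a, pick (\<lambda>x. id1 (ms (Inr x)) = 1))"])
    fix I u v
    show "?m (initial_knowledge I u) (c I) v \<in> msgs"
      using silent_in_msgs id_in_msgs[OF cnt] by (auto split: sum.split)
  next
    fix I v
    show "?m' (initial_knowledge I v) (c I) (\<lambda>u. if u \<in> nodes I then ?m (initial_knowledge I u) (c I) v else undefined) \<in> msgs"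
      using silent_in_msgs bit_in_msgs by (cases v) (simp_all only: self_initial_knowledge sum.case)
  next
    fix I assume I: "I \<in> valid"
    have "pick (\<lambda>x. good (c I) (\<lambda>i. cnt (c I) (fball I i) x) x) =
        pick (\<lambda>x. id1 (if Inr x \<in> nodes I then ?m' (initial_knowledge I (Inr x)) (c I)
          (\<lambda>u. if u \<in> nodes I then ?m (initial_knowledge I u) (c I) (Inr x) else undefined) else undefined) = 1)"
    proof (rule pick_cong)
      fix x assume x: "x \<in> C"
      have "good (c I) (\<lambda>i. cnt (c I) (fball I i) x) x \<longleftrightarrow> good (c I) (\<lambda>i. id1 (if Inl i \<in> nodes I
          then ?m (initial_knowledge I (Inl i)) (c I) (Inr x) else undefined)) x"
        by (rule good[OF I]) (simp add: Inl_in_nodes[OF I] fball_def)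
      thus "good (c I) (\<lambda>i. cnt (c I) (fball I i) x) x \<longleftrightarrow>
        id1 (if Inr x \<in> nodes I then ?m' (initial_knowledge I (Inr x)) (c I)
          (\<lambda>u. if u \<in> nodes I then ?m (initial_knowledge I u) (c I) (Inr x) else undefined) else undefined) = 1"
        using x by (simp add: Inr_in_nodes[OF I])
    qed
    thus "(c I, pick (\<lambda>x. good (c I) (\<lambda>i. cnt (c I) (fball I i) x) x)) =
      (c I, pick (\<lambda>x. id1 (if Inr x \<in> nodes I then ?m' (initial_knowledge I (Inr x)) (c I)
          (\<lambda>u. if u \<in> nodes I then ?m (initial_knowledge I u) (c I) (Inr x) else undefined) else undefined) = 1))"
      by (rule arg_cong)
  qed
qed

lemma members_sub: "plan_members (the_plan I) \<subseteq> C"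
  by (auto simp: the_plan_def make_plan_def)

lemma phases_sub: "fst (phases b I k) \<subseteq> C"
proof (induction k)
  case (Suc k)
  thus ?case by (auto simp: case_prod_beta Let_def)
qed (simp add: members_sub)

lemma plan_aim_in:
  assumes I: "I \<in> valid" and u: "u \<in> C"
  shows "plan_aim (the_plan I) u \<in> F"
proof -
  have "enumeration C (creach I) (cidx I u) \<in> C"
    using enumeration(1)[OF finite_C, of "creach I"] cidx_less[OF I u] by (auto simp: bij_betw_def)
  thus ?thesis using ctgt_in(1)[OF I] by (simp add: the_plan_def make_plan_def)
qed

lemma score_aim_cong:
  assumes I: "I \<in> valid" and "P \<subseteq> C" and "\<And>i. i \<in> F \<Longrightarrow> h i = h' i"
  shows "score P (plan_aim (the_plan I)) X b cost h = score P (plan_aim (the_plan I)) X b cost h'"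
proof (rule score_cong)
  fix i assume "i \<in> plan_aim (the_plan I) ` P"
  hence "i \<in> F" using plan_aim_in[OF I] assms(2) by auto
  thus "h i = h' i" by (rule assms(3))
qed simp_all

text \<open>Two rounds find the block, two the member, and in the fifth each client tests the new
  facilities against its own distances and announces whether it is still unserved.\<close>

lemma common_phase:
  assumes c: "common_after valid msgs t (\<lambda>I. (the_plan I, phases b I k))"
  shows "common_after valid msgs (t + 5) (\<lambda>I. (the_plan I, phases b I (Suc k)))"
proof -
  have block: "common_after valid msgs (Suc (Suc t)) (\<lambda>I. ((the_plan I, phases b I k), pick_block I (b k) (fst (phases b I k))))"
  proof -
    have "common_after valid msgs (Suc (Suc t)) (\<lambda>I. ((the_plan I, phases b I k),
      pick (\<lambda>x. good_block (fst (the_plan I, phases b I k)) (b k) (fst (snd (the_plan I, phases b I k)))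
        (\<lambda>i. block_misses (fst (the_plan I, phases b I k)) (b k) (fst (snd (the_plan I, phases b I k))) (fball I i) x) x)))"
    proof (rule common_pick[OF c, where
        cnt="\<lambda>a D x. block_misses (fst a) (b k) (fst (snd a)) D x" and
        good="\<lambda>a h x. good_block (fst a) (b k) (fst (snd a)) h x"])
      show "block_misses (fst a) (b k) (fst (snd a)) D x \<le> card C" for a :: "plan \<times> nat set \<times> nat set" and D x
        unfolding block_misses_def using finite_C by (intro card_mono) auto
      fix I and h h' :: "nat \<Rightarrow> nat" and x assume "I \<in> valid" "\<And>i. i \<in> F \<Longrightarrow> h i = h' i"
      thus "good_block (fst (the_plan I, phases b I k)) (b k) (fst (snd (the_plan I, phases b I k))) h x \<longleftrightarrow>
          good_block (fst (the_plan I, phases b I k)) (b k) (fst (snd (the_plan I, phases b I k))) h' x"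
        using score_aim_cong[OF _ phases_sub, of I h h'] by (simp add: good_block_def)
    qed
    thus ?thesis by (simp add: pick_block_def)
  qed
  have seed: "common_after valid msgs (Suc (Suc (Suc (Suc t)))) (\<lambda>I.
     (((the_plan I, phases b I k), pick_block I (b k) (fst (phases b I k))), pick_seed I (b k) (fst (phases b I k))))"
  proof -
    let ?c = "\<lambda>I. ((the_plan I, phases b I k), pick_block I (b k) (fst (phases b I k)))"
    let ?cnt = "\<lambda>(a :: (plan \<times> nat set \<times> nat set) \<times> nat) D y. seed_misses (fst (fst a)) (b k) (fst (snd (fst a))) D (snd a) y"
    let ?good = "\<lambda>(a :: (plan \<times> nat set \<times> nat set) \<times> nat) h y. good_seed (fst (fst a)) (b k) (fst (snd (fst a))) (snd a) h y"
    have "common_after valid msgs (Suc (Suc (Suc (Suc t)))) (\<lambda>I. (?c I,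
      pick (\<lambda>y. ?good (?c I) (\<lambda>i. ?cnt (?c I) (fball I i) y) y)))"
    proof (rule common_pick[OF block, where cnt="?cnt" and good="?good"])
      show "?cnt a D y \<le> card C" for a D y
        unfolding seed_misses_def using p_pos p_le by auto
      fix I and h h' :: "nat \<Rightarrow> nat" and y assume "I \<in> valid" "\<And>i. i \<in> F \<Longrightarrow> h i = h' i"
      thus "?good (?c I) h y \<longleftrightarrow> ?good (?c I) h' y"
        using score_aim_cong[OF _ phases_sub, of I h h'] by (simp add: good_seed_def)
    qed
    thus ?thesis by (simp add: pick_seed_def)
  qed
  define Op' where "Op' a = (case a of (((S, P, Op), x), y) \<Rightarrow> Op \<union> plan_choice S ` family S (b k) P (x, y))"
    for a :: "((plan \<times> nat set \<times> nat set) \<times> nat) \<times> nat"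
  define reach_of where "reach_of a = (case a of (((S, P, Op), x), y) \<Rightarrow> plan_reach S)"
    for a :: "((plan \<times> nat set \<times> nat set) \<times> nat) \<times> nat"
  define far where "far k' a = (case self k' of Inl _ \<Rightarrow> silent | Inr u \<Rightarrow>
     (if \<forall>i\<in>Op' a. 11 * 4 ^ Suc k * reach_of a u < dist_row k' i then 1::nat else 0, 0::nat, 0::real, 0::real))"
    for k' :: knowledge and a
  let ?c = "\<lambda>I. (((the_plan I, phases b I k), pick_block I (b k) (fst (phases b I k))), pick_seed I (b k) (fst (phases b I k)))"
  have "common_after valid msgs (Suc (Suc (Suc (Suc (Suc t))))) (\<lambda>I. (the_plan I, phases b I (Suc k)))"
  proof (rule common_after_broadcast[OF seed, where m=far and
      f="\<lambda>a ms. (fst (fst (fst a)), {u\<in>fst (snd (fst (fst a))). id1 (ms (Inr u)) = 1}, Op' a)"])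
    fix I u
    show "far (initial_knowledge I u) (?c I) \<in> msgs"
      unfolding far_def using silent_in_msgs bit_in_msgs by (cases u) (simp_all only: self_initial_knowledge sum.case)
  next
    fix I assume I: "I \<in> valid"
    obtain P Op where PO: "phases b I k = (P, Op)" by (cases "phases b I k")
    have P: "P \<subseteq> C" using phases_sub[of b I k] PO by simp
    have O: "Op' (?c I) = Op \<union> plan_choice (the_plan I) ` sample I (b k) P"
      by (simp add: Op'_def PO sample_def)
    have "id1 (if Inr u \<in> nodes I then far (initial_knowledge I (Inr u)) (?c I) else undefined) = 1 \<longleftrightarrow>
       (\<forall>i\<in>Op \<union> plan_choice (the_plan I) ` sample I (b k) P. 11 * 4 ^ Suc k * plan_reach (the_plan I) u < row I u i)"
      if "u \<in> P" for u
      using that P unfolding far_def O by (auto simp: Inr_in_nodes[OF I] reach_of_def PO row_def)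
    thus "(the_plan I, phases b I (Suc k)) = (fst (fst (fst (?c I))), {u\<in>fst (snd (fst (fst (?c I)))).
       id1 (if Inr u \<in> nodes I then far (initial_knowledge I (Inr u)) (?c I) else undefined) = 1}, Op' (?c I))"
      unfolding O by (simp add: PO Let_def cong: conj_cong)
  qed
  thus ?thesis by (simp add: eval_nat_numeral)
qed

lemma common_phases: "common_after valid msgs (6 + 5 * K) (\<lambda>I. (the_plan I, phases b I K))"
proof (induction K)
  case 0
  show ?case by (rule common_after_map[where f="\<lambda>S. (S, plan_members S, {})"]) (simp_all add: common_plan)
next
  case (Suc K)
  show ?case using common_phase[OF Suc] by (simp add: add.commute add.left_commute)
qed

text \<open>Six planning rounds, five per phase, and one to halt.\<close>

lemma algorithm:
  fixes b :: "nat \<Rightarrow> real"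
  assumes "\<And>k. k < K \<Longrightarrow> 16 \<le> b k" "\<And>k. k < K \<Longrightarrow> b (Suc k) \<le> (b k)\<^sup>2" "\<And>k. 0 \<le> b k" "b 0 \<le> 16"
    and "\<And>k. k < K \<Longrightarrow> exp (b k / 2) \<le> real (card C)"
    and "K = 0 \<and> card C \<le> 3000 \<or> (\<exists>k. K = Suc k \<and> real (card C) \<le> exp (b k / 2))"
  obtains A where "\<And>I. bandwidth_le A I (8 * \<beta> + 18 * \<nu> + 168)"
    "\<And>I \<omega>. I \<in> valid \<Longrightarrow> halted_by A I \<omega> (7 + 5 * K) \<and> rfl_approx_solution 48001 I (result A I \<omega> (7 + 5 * K))"
proof -
  define out where "out k a = (case self k of
      Inl i \<Rightarrow> i \<in> snd (snd a) \<union> plan_choice (fst a) ` fst (snd a) | Inr j \<Rightarrow> j \<in> plan_members (fst a))"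
    for k :: knowledge and a :: "plan \<times> nat set \<times> nat set"
  obtain A where A: "\<And>I. bandwidth_le A I (8 * \<beta> + 18 * \<nu> + 168)"
    "\<And>I \<omega> v. I \<in> valid \<Longrightarrow> v \<in> nodes I \<Longrightarrow>
       run A I \<omega> (Suc (6 + 5 * K)) v = Halted (out (initial_knowledge I v) (the_plan I, phases b I K))"
    by (rule common_after_algorithm[OF common_phases[of K b] msgs, of out]) blast
  show ?thesis
  proof (rule that[OF A(1)])
    fix I \<omega> assume I: "I \<in> valid"
    have run: "run A I \<omega> (7 + 5 * K) v = Halted (out (initial_knowledge I v) (the_plan I, phases b I K))"
      if "v \<in> nodes I" for v
      using A(2)[OF I that, of \<omega>] by (simp only: eval_nat_numeral add_Suc)
    have approx: "rfl_approx_solution 48001 I (plan_members (the_plan I), opened b I K)"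
      by (rule phases_approx[OF I assms])
    hence sub: "opened b I K \<subseteq> F"
      using inst[OF I] by (auto simp: rfl_approx_solution_def rfl_feasible_def)
    have "result A I \<omega> (7 + 5 * K) = (plan_members (the_plan I), opened b I K)"
    proof -
      have "{j \<in> C. run A I \<omega> (7 + 5 * K) (Inr j) = Halted True} = plan_members (the_plan I)"
        using run Inr_in_nodes[OF I] members_sub[of I] by (auto simp: out_def)
      moreover have "{i \<in> F. run A I \<omega> (7 + 5 * K) (Inl i) = Halted True} = opened b I K"
        using run Inl_in_nodes[OF I] sub by (auto simp: out_def opened_def)
      ultimately show ?thesis using inst[OF I] by (simp add: result_def)
    qed
    thus "halted_by A I \<omega> (7 + 5 * K) \<and> rfl_approx_solution 48001 I (result A I \<omega> (7 + 5 * K))"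
      using approx run by (simp add: halted_by_def)
  qed
qed

end

section \<open>Number of phases and asymptotics\<close>

text \<open>The cap \<open>2 * ln n\<close> is the largest value with
  \<open>exp (b / 2) \<le> n\<close>, as the family of \<open>n^2\<close> members requires; reaching
  it is the condition for stopping.\<close>

definition phase_boost :: "nat \<Rightarrow> nat \<Rightarrow> real" where
  "phase_boost n k = min (16 ^ (2 ^ k)) (2 * ln (real n))"

definition phase_count :: "nat \<Rightarrow> nat" where
  "phase_count n = (if ln (real n) < 8 then 0 else Suc (nat \<lceil>log 2 (log 2 (ln (real n)))\<rceil>))"

lemma phase_boost:
  assumes n: "1 \<le> n"
  shows "0 \<le> phase_boost n k" "phase_boost n 0 \<le> 16"
    and "k < phase_count n \<Longrightarrow> 16 \<le> phase_boost n k"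
    and "k < phase_count n \<Longrightarrow> phase_boost n (Suc k) \<le> (phase_boost n k)\<^sup>2"
    and "exp (phase_boost n k / 2) \<le> real n"
    and "phase_count n = 0 \<and> n \<le> 3000 \<or> (\<exists>k. phase_count n = Suc k \<and> real n \<le> exp (phase_boost n k / 2))"
proof -
  have ln0: "0 \<le> ln (real n)" using n by simp
  show "0 \<le> phase_boost n k" "phase_boost n 0 \<le> 16" using ln0 by (auto simp: phase_boost_def)
  have "exp (phase_boost n k / 2) \<le> exp (ln (real n))" by (simp add: phase_boost_def)
  thus "exp (phase_boost n k / 2) \<le> real n" using n by simp
  have ln8: "8 \<le> ln (real n)" if "k < phase_count n" for k
    using that by (auto simp: phase_count_def split: if_splits)
  have pow: "(16::real) \<le> 16 ^ (2 ^ k)" for k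
    using power_increasing[of 1 "2 ^ k" "16::real"] by simp
  show "16 \<le> phase_boost n k" if "k < phase_count n"
    using ln8[OF that] pow[of k] by (simp add: phase_boost_def)
  show "phase_boost n (Suc k) \<le> (phase_boost n k)\<^sup>2" if k: "k < phase_count n"
  proof -
    have sq: "(16::real) ^ (2 ^ Suc k) = (16 ^ (2 ^ k))\<^sup>2" by (simp add: power_mult[symmetric] mult.commute)
    have "2 * ln (real n) \<le> (2 * ln (real n))\<^sup>2"
      using ln8[OF k] by (simp add: power2_eq_square)
    thus ?thesis unfolding phase_boost_def sq by (auto simp: min_def)
  qed
  show "phase_count n = 0 \<and> n \<le> 3000 \<or> (\<exists>k. phase_count n = Suc k \<and> real n \<le> exp (phase_boost n k / 2))"
  proof (cases "ln (real n) < 8")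
    case True
    hence "real n < exp 8" using n by (metis exp_less_mono exp_ln of_nat_0_less_iff not_one_le_zero not_gr0)
    also have "exp 8 = exp (1::real) ^ 8" by (simp flip: exp_of_nat_mult)
    also have "\<dots> \<le> (272 / 100) ^ 8" using e_less_272 by (intro power_mono) auto
    also have "\<dots> \<le> (3000::real)" by (simp add: power_divide)
    finally show ?thesis using True by (simp add: phase_count_def)
  next
    case False
    let ?x = "ln (real n)"
    define k where "k = nat \<lceil>log 2 (log 2 ?x)\<rceil>"
    have x: "8 \<le> ?x" using False by simp
    have "log 2 (log 2 ?x) \<le> real k" unfolding k_def by linarith
    moreover have "0 < log 2 ?x" using x by simp
    ultimately have "log 2 ?x \<le> 2 powr real k" by (simp add: log_le_iff)
    hence "log 2 ?x \<le> real (2 ^ k)" by (simp add: powr_realpow)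
    hence "?x \<le> 2 powr real (2 ^ k)" using x by (subst (asm) log_le_iff) auto
    hence "?x \<le> 2 ^ (2 ^ k)" by (subst (asm) powr_realpow) auto
    \<comment> \<open>Base 16 instead of 2 makes up for the factor 2 in the cap.\<close>
    moreover have "2 * (2::real) ^ (2 ^ k) \<le> 16 ^ (2 ^ k)"
    proof -
      have "(2::real) \<le> 8 ^ (2 ^ k)" using power_increasing[of 1 "2 ^ k" "8::real"] by simp
      hence "2 * (2::real) ^ (2 ^ k) \<le> 8 ^ (2 ^ k) * 2 ^ (2 ^ k)" by (intro mult_right_mono) auto
      also have "\<dots> = 16 ^ (2 ^ k)" by (simp flip: power_mult_distrib)
      finally show ?thesis .
    qed
    ultimately have "phase_boost n k = 2 * ?x" by (simp add: phase_boost_def)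
    hence "real n \<le> exp (phase_boost n k / 2)" using n by simp
    thus ?thesis using False by (auto simp: phase_count_def k_def)
  qed
qed

lemma rounds_bigo: "(\<lambda>n. real (7 + 5 * phase_count n)) \<in> O(\<lambda>n. ln (ln (ln (real n))))"
proof -
  have "eventually (\<lambda>n. norm (real (7 + 5 * phase_count n)) \<le> norm (17 + 5 * log 2 (log 2 (ln (real n))))) at_top"
  proof -
    have "eventually (\<lambda>n::nat. 0 \<le> log 2 (log 2 (ln (real n)))) at_top" by real_asymp
    thus ?thesis
    proof eventually_elim
      case (elim n)
      have "of_int \<lceil>log 2 (log 2 (ln (real n)))\<rceil> \<le> 1 + log 2 (log 2 (ln (real n)))" by linarith
      hence "real (phase_count n) \<le> 2 + log 2 (log 2 (ln (real n)))"
        using elim by (auto simp: phase_count_def)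
      thus ?case using elim by simp
    qed
  qed
  hence "(\<lambda>n. real (7 + 5 * phase_count n)) \<in> O(\<lambda>n. 17 + 5 * log 2 (log 2 (ln (real n))))"
    by (rule landau_o.big_mono)
  also have "(\<lambda>n::nat. 17 + 5 * log 2 (log 2 (ln (real n)))) \<in> O(\<lambda>n. ln (ln (ln (real n))))"
    by real_asymp
  finally show ?thesis .
qed

lemma message_bigo:
  assumes "(\<lambda>n. real (B n)) \<in> O(\<lambda>n. ln (real n))"
  shows "(\<lambda>n. real (8 * B n + 18 * nat \<lceil>log 2 (real n)\<rceil> + 168)) \<in> O(\<lambda>n. ln (real n))"
proof -
  have "(\<lambda>n. real (nat \<lceil>log 2 (real n)\<rceil>)) \<in> O(\<lambda>n. log 2 (real n) + 1)"
  proof (rule landau_o.big_mono)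
    have "eventually (\<lambda>n::nat. 0 \<le> log 2 (real n)) at_top" by real_asymp
    thus "eventually (\<lambda>n. norm (real (nat \<lceil>log 2 (real n)\<rceil>)) \<le> norm (log 2 (real n) + 1)) at_top"
    proof eventually_elim
      case (elim n)
      hence "real (nat \<lceil>log 2 (real n)\<rceil>) \<le> log 2 (real n) + 1" by linarith
      thus ?case using elim by simp
    qed
  qed
  also have "(\<lambda>n::nat. log 2 (real n) + 1) \<in> O(\<lambda>n. ln (real n))" by real_asymp
  finally have \<nu>: "(\<lambda>n. real (nat \<lceil>log 2 (real n)\<rceil>)) \<in> O(\<lambda>n. ln (real n))" .
  have const: "(\<lambda>n::nat. 168) \<in> O(\<lambda>n. ln (real n))" by real_asymp
  have "(\<lambda>n. 8 * real (B n) + 18 * real (nat \<lceil>log 2 (real n)\<rceil>) + 168) \<in> O(\<lambda>n. ln (real n))"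
    by (intro sum_in_bigo const) (use assms \<nu> in simp_all)
  thus ?thesis by simp
qed

lemma le_power_log:
  assumes "1 \<le> n"
  shows "n \<le> 2 ^ nat \<lceil>log 2 (real n)\<rceil>"
proof -
  have "log 2 (real n) \<le> real (nat \<lceil>log 2 (real n)\<rceil>)" by linarith
  hence "real n \<le> 2 powr real (nat \<lceil>log 2 (real n)\<rceil>)" using assms by (subst (asm) log_le_iff) auto
  also have "\<dots> = real (2 ^ nat \<lceil>log 2 (real n)\<rceil>)" by (simp add: powr_realpow)
  finally show ?thesis by (simp only: of_nat_le_iff)
qed

text \<open>With \<open>p = 0\<close> the empty solution is feasible and costs nothing. This also
  covers \<open>n = 0\<close>.\<close>

lemma idle_algorithm:
  fixes A :: algorithm
  defines "A \<equiv> \<lambda>_ _ _. Halt False"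
  assumes I: "rfl_instance I" "threshold I = 0"
  shows "bandwidth_le A I M" "halted_by A I \<omega> (Suc t)" "rfl_approx_solution 48001 I (result A I \<omega> (Suc t))"
proof -
  show "bandwidth_le A I M"
    by (auto simp: bandwidth_le_def sent_def node_action_def A_def split: state.split)
  have run: "run A I \<omega> (Suc t) v = Halted False" for v
    by (induction t) (simp_all add: round_step_def node_action_def A_def)
  thus "halted_by A I \<omega> (Suc t)" unfolding halted_by_def by blast
  have res: "result A I \<omega> (Suc t) = ({}, {})" unfolding result_def run by simp
  have feas: "rfl_feasible I ({}, {})" using I by (simp add: rfl_feasible_def)
  have fin: "finite (facilities I)" "finite (clients I)" using I by (auto simp: rfl_instance_def)
  have nonneg: "0 \<le> rfl_cost I S" if S: "rfl_feasible I S" for S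
  proof -
    obtain C' F' where CF: "S = (C', F')" by (cases S)
    have sub: "C' \<subseteq> clients I" "F' \<subseteq> facilities I" "C' \<noteq> {} \<Longrightarrow> F' \<noteq> {}"
      using S CF by (auto simp: rfl_feasible_def)
    have finF': "finite F'" using sub fin by (auto intro: finite_subset)
    have metric: "Metric_space (facilities I \<union> clients I) (distance I)" using I by (simp add: rfl_instance_def)
    have "0 \<le> Min ((\<lambda>i. distance I i j) ` F')" if "j \<in> C'" for j
      using that sub(3) finF' Metric_space.nonneg[OF metric] by (subst Min_ge_iff) auto
    moreover have "0 \<le> opening_cost I i" if "i \<in> F'" for i using that sub I by (auto simp: rfl_instance_def)
    ultimately show ?thesis unfolding CF rfl_cost_def by (auto intro!: add_nonneg_nonneg sum_nonneg)
  qed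
  have "finite {S. rfl_feasible I S}"
  proof (rule finite_subset)
    show "{S. rfl_feasible I S} \<subseteq> Pow (clients I) \<times> Pow (facilities I)" by (auto simp: rfl_feasible_def)
  qed (use fin in simp)
  hence "0 \<le> rfl_opt I" unfolding rfl_opt_def using feas nonneg by (subst Min_ge_iff) auto
  thus "rfl_approx_solution 48001 I (result A I \<omega> (Suc t))"
    unfolding res rfl_approx_solution_def using feas by (simp add: rfl_cost_def)
qed

lemma prob_space_coin_space: "prob_space coin_space"
  unfolding coin_space_def by (intro prob_space_PiM measure_pmf.prob_space_axioms)

theorem theorem41:
  shows "\<exists>\<alpha>::real. \<forall>B :: nat \<Rightarrow> nat. (\<lambda>n. real (B n)) \<in> O(\<lambda>n. ln (real n)) \<longrightarrow>
    (\<exists>(A :: algorithm) (M :: nat \<Rightarrow> nat) (T :: nat \<Rightarrow> nat) (c :: nat).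
       (\<lambda>n. real (M n)) \<in> O(\<lambda>n. ln (real n)) \<and>
       (\<lambda>n. real (T n)) \<in> O(\<lambda>n. ln (ln (ln (real n)))) \<and>
       1 \<le> c \<and>
       (\<forall>(n :: nat) (I :: rfl_instance).
          rfl_instance I \<and> card (facilities I) = n \<and> card (clients I) = n \<and>
          rfl_representable (B n) I \<longrightarrow>
            bandwidth_le A I (M n) \<and>
            outputs_approx A I \<alpha> \<and>
            halting_probability A I (T n) \<ge> 1 - 1 / real n ^ c))"
proof (intro exI[of _ 48001] allI impI)
  fix B :: "nat \<Rightarrow> nat" assume B: "(\<lambda>n. real (B n)) \<in> O(\<lambda>n. ln (real n))"
  define M where "M n = 8 * B n + 18 * nat \<lceil>log 2 (real n)\<rceil> + 168" for n
  define T where "T n = 7 + 5 * phase_count n" for n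
  have M: "(\<lambda>n. real (M n)) \<in> O(\<lambda>n. ln (real n))" unfolding M_def by (rule message_bigo[OF B])
  have T: "(\<lambda>n. real (T n)) \<in> O(\<lambda>n. ln (ln (ln (real n))))" unfolding T_def by (rule rounds_bigo)
  let ?valid = "\<lambda>F C p I. rfl_instance I \<and> facilities I = F \<and> clients I = C \<and> threshold I = p \<and>
      card F = card C \<and> rfl_representable (B (card C)) I"
  \<comment> \<open>Participants and \<open>p\<close> are known to every node, so a separate
    algorithm for each triple suffices; the choice principle combines them below.\<close>
  have "\<exists>A. \<forall>I. ?valid F C p I \<longrightarrow> bandwidth_le A I (M (card C)) \<and>
      (\<forall>\<omega>. halted_by A I \<omega> (T (card C)) \<and> rfl_approx_solution 48001 I (result A I \<omega> (T (card C))))" for F C p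
  proof (cases "finite F \<and> finite C \<and> card F = card C \<and> 1 \<le> p \<and> p \<le> card C")
    case True
    hence n: "1 \<le> card C" by simp
    interpret protocol F C p "B (card C)" "nat \<lceil>log 2 (real (card C))\<rceil>"
      by unfold_locales (use True le_power_log[OF n] in auto)
    obtain A where "\<And>I. bandwidth_le A I (M (card C))"
      "\<And>I \<omega>. I \<in> valid \<Longrightarrow> halted_by A I \<omega> (T (card C)) \<and> rfl_approx_solution 48001 I (result A I \<omega> (T (card C)))"
      unfolding M_def T_def
      by (rule algorithm[where K="phase_count (card C)" and b="phase_boost (card C)"])
        (use phase_boost[OF n] in blast)+
    thus ?thesis unfolding valid_def by blast
  next
    case False
    have "threshold I = 0" if "?valid F C p I" for I
      using False that by (auto simp: rfl_instance_def)
    moreover have "T n = Suc (6 + 5 * phase_count n)" for n by (simp add: T_def)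
    ultimately show ?thesis
      using idle_algorithm by (intro exI[of _ "\<lambda>_ _ _. Halt False"]) metis
  qed
  hence "\<exists>A. \<forall>x I. ?valid (fst x) (fst (snd x)) (snd (snd x)) I \<longrightarrow>
      bandwidth_le (A x) I (M (card (fst (snd x)))) \<and>
      (\<forall>\<omega>. halted_by (A x) I \<omega> (T (card (fst (snd x)))) \<and>
        rfl_approx_solution 48001 I (result (A x) I \<omega> (T (card (fst (snd x))))))"
    by (intro choice allI)
  then obtain A' :: "nat set \<times> nat set \<times> nat \<Rightarrow> algorithm" where A': "\<And>F C p I. ?valid F C p I \<Longrightarrow>
      bandwidth_le (A' (F, C, p)) I (M (card C)) \<and>
      (\<forall>\<omega>. halted_by (A' (F, C, p)) I \<omega> (T (card C)) \<and>
        rfl_approx_solution 48001 I (result (A' (F, C, p)) I \<omega> (T (card C))))"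
    by auto
  define A :: algorithm where
    "A k = A' (known_facilities k, known_clients k, known_threshold k) k" for k
  have "bandwidth_le A I (M n) \<and> outputs_approx A I 48001 \<and> halting_probability A I (T n) \<ge> 1 - 1 / real n ^ 1"
    if I: "rfl_instance I" "card (facilities I) = n" "card (clients I) = n" "rfl_representable (B n) I" for n I
  proof -
    let ?A = "A' (facilities I, clients I, threshold I)"
    let ?K = "range (initial_knowledge I)"
    have eq: "A k w h = ?A k w h" if "k \<in> ?K" for k w h using that by (auto simp: A_def)
    have run: "run A I \<omega> t = run ?A I \<omega> t" and sent: "sent A I \<omega> S = sent ?A I \<omega> S" for \<omega> t S
      by (rule run_cong[of I ?K A ?A], simp, erule eq)+
    have *: "bandwidth_le ?A I (M n)" "\<And>\<omega>. halted_by ?A I \<omega> (T n)"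
      "\<And>\<omega>. rfl_approx_solution 48001 I (result ?A I \<omega> (T n))"
      using A'[of I "facilities I" "clients I" "threshold I"] I by auto
    have bw: "bandwidth_le A I (M n)" using *(1) unfolding bandwidth_le_def run sent .
    have halt: "halted_by A I \<omega> (T n)" for \<omega> using *(2) unfolding halted_by_def run .
    have approx: "rfl_approx_solution 48001 I (result A I \<omega> (T n))" for \<omega>
      using *(3) unfolding result_def run .
    interpret prob_space coin_space by (rule prob_space_coin_space)
    \<comment> \<open>Every run halts by \<open>T n\<close>. Probability 1 also meets the bound at
      \<open>n = 0\<close>, where \<open>1 / 0\<close> is read as 0.\<close>
    have "halting_probability A I (T n) = 1"
      unfolding halting_probability_def using halt prob_space by simp
    moreover have "outputs_approx A I 48001"
      unfolding outputs_approx_def using halt approx by (intro AE_I2) blast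
    ultimately show ?thesis using bw by simp
  qed
  thus "\<exists>(A :: algorithm) (M :: nat \<Rightarrow> nat) (T :: nat \<Rightarrow> nat) (c :: nat).
       (\<lambda>n. real (M n)) \<in> O(\<lambda>n. ln (real n)) \<and>
       (\<lambda>n. real (T n)) \<in> O(\<lambda>n. ln (ln (ln (real n)))) \<and>
       1 \<le> c \<and>
       (\<forall>(n :: nat) (I :: rfl_instance).
          rfl_instance I \<and> card (facilities I) = n \<and> card (clients I) = n \<and>
          rfl_representable (B n) I \<longrightarrow>
            bandwidth_le A I (M n) \<and>
            outputs_approx A I 48001 \<and>
            halting_probability A I (T n) \<ge> 1 - 1 / real n ^ c)"
    using M T by - (rule exI[of _ A], rule exI[of _ M], rule exI[of _ T], rule exI[of _ 1], blast)
qed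

end
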